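(* Let $\Omega\subset\mathbb{R}^N$ be a domain of class $C^2$ (not necessarily bounded) with boundary $\Gamma$, and let $x\in\Omega$, $R>0$ and $z_x\in\Gamma$ be such that $B_R(x)\subset\Omega$, $\overline{B_R(x)}\cap\left(\mathbb{R}^N\setminus\Omega\right)=\{z_x\}$ and $\kappa_j(z_x)<\frac1R$ for $j=1,\dots,N-1$. Set $\Pi_0(z_x)=\prod_{j=1}^{N-1}\left[1-R\,\kappa_j(z_x)\right]$. For $\varepsilon>0$ let $u^\varepsilon_\pm$ be the solution of $$-\varepsilon^2\mathcal{M}^{\pm}(\nabla^2u)+u=0\ \text{ in }\ \Omega,\qquad u=1\ \text{ on }\ \Gamma,$$ and for $1<q\le\infty$ let $\mu^\pm_{q,\varepsilon}(x)$ be the $q$-mean of $u^\varepsilon_\pm$ on $B_R(x)$. Then, for any $1<q<\infty$, $$\lim_{\varepsilon\to0^+}\left(\frac{R}{\varepsilon}\right)^{\frac{N+1}{2(q-1)}}\mu^-_{q,\varepsilon}(x)=c_{N,q}\left\{\frac{\Pi_0(z_x)}{\lambda^{\frac{N+1}{2}}}\right\}^{-\frac{1}{2(q-1)}},\qquad \lim_{\varepsilon\to0^+}\left(\frac{R}{\varepsilon}\right)^{\frac{N+1}{2(q-1)}}\mu^+_{q,\varepsilon}(x)=c_{N,q}\left\{\frac{\Pi_0(z_x)}{\Lambda^{\frac{N+1}{2}}}\right\}^{-\frac{1}{2(q-1)}},$$ where $$c_{N,q}=\left[\frac{2^{-\frac{N+1}{2}}N!}{(q-1)^{\frac{N+1}{2}}\,\Gamma\left(\frac{N+1}{2}\right)}\right]^{\frac{1}{q-1}}$$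 and $\Gamma\left(\frac{N+1}{2}\right)$ denotes Euler's gamma function at $\frac{N+1}{2}$. In the case $q=\infty$, $$\lim_{\varepsilon\to0^+}\mu^\pm_{\infty,\varepsilon}(x)=\frac12 .$$
   Context: Let $N\ge2$ be an integer and let $0<\lambda\le\Lambda$ be real numbers. For a symmetric real $N\times N$ matrix $X$ with eigenvalues $\lambda_1,\dots,\lambda_N$ (counted with multiplicity), the Pucci extremal operators are $$\mathcal{M}^-(X)=\Lambda\sum_{\lambda_i<0}\lambda_i+\lambda\sum_{\lambda_i>0}\lambda_i,\qquad \mathcal{M}^+(X)=\lambda\sum_{\lambda_i<0}\lambda_i+\Lambda\sum_{\lambda_i>0}\lambda_i .$$ The signs correspond: $u^\varepsilon_-$ (and $\mu^-_{q,\varepsilon}$) refer to $\mathcal{M}^-$, $u^\varepsilon_+$ (and $\mu^+_{q,\varepsilon}$) to $\mathcal{M}^+$. Equations hold in the viscosity sense; solutions are continuous on $\overline{\Omega}$ and attain the boundary values pointwise; if $\Omega$ is unbounded, the solution means the bounded solution. $\nabla^2u$ is the Hessian. $B_R(x)$ is the open ball of radius $R$ centered at $x$. $\kappa_1,\dots,\kappa_{N-1}$ are the principal curvatures of $\Gamma$ (with respect to the inward normal, so that they are positive when $\Omega$ is a ball). For $1\le q\le\infty$ and a continuous function $u:\overline{B}\to\mathbb{R}$ on the closure of a ball $B$, the $q$-mean of $u$ on $B$ is the unique minimum point of the function $\mathbb{R}\ni\mu\mapsto\|u-\mu\|_{L^q(B)}$. *)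

theory Defs
  imports
    "HOL-Analysis.Analysis"
    "HOL-Computational_Algebra.Polynomial"
    "HOL-Probability.Essential_Supremum"
begin

section \<open>Pucci extremal operators\<close>

definition charpoly :: "real^'n^'n \<Rightarrow> real poly" where
  "charpoly X = det (\<chi> i j. (if i = j then [:0, 1:] else 0) - [:X $ i $ j:])"

text \<open>Eigenvalues are counted with multiplicity: each distinct root of the characteristic
  polynomial is weighted by its order.\<close>

definition neg_eigenvalue_sum :: "real^'n^'n \<Rightarrow> real" where
  "neg_eigenvalue_sum X =
     (\<Sum>l \<in> {l. poly (charpoly X) l = 0 \<and> l < 0}. real (order l (charpoly X)) * l)"

definition pos_eigenvalue_sum :: "real^'n^'n \<Rightarrow> real" where
  "pos_eigenvalue_sum X =
     (\<Sum>l \<in> {l. poly (charpoly X) l = 0 \<and> l > 0}. real (order l (charpoly X)) * l)"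

definition pucci_minus :: "real \<Rightarrow> real \<Rightarrow> real^'n^'n \<Rightarrow> real" where
  "pucci_minus lam Lam X = Lam * neg_eigenvalue_sum X + lam * pos_eigenvalue_sum X"

definition pucci_plus :: "real \<Rightarrow> real \<Rightarrow> real^'n^'n \<Rightarrow> real" where
  "pucci_plus lam Lam X = lam * neg_eigenvalue_sum X + Lam * pos_eigenvalue_sum X"


section \<open>Twice continuously differentiable functions and domains\<close>

definition C2_with ::
  "(real^'n) set \<Rightarrow> (real^'n \<Rightarrow> real) \<Rightarrow> (real^'n \<Rightarrow> real^'n) \<Rightarrow> (real^'n \<Rightarrow> real^'n^'n) \<Rightarrow> bool"
where
  \<comment> \<open>the function is C2 on the open set, with the given gradient and Hessian\<close>
  "C2_with U f grad hess \<longleftrightarrow> open U \<and>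
     (\<forall>y\<in>U. (f has_derivative (\<lambda>v. grad y \<bullet> v)) (at y)) \<and>
     (\<forall>y\<in>U. (grad has_derivative (\<lambda>v. hess y *v v)) (at y)) \<and>
     continuous_on U hess"

definition local_defining_function ::
  "(real^'n) set \<Rightarrow> real^'n \<Rightarrow> (real^'n) set \<Rightarrow> (real^'n \<Rightarrow> real) \<Rightarrow> (real^'n \<Rightarrow> real^'n) \<Rightarrow> bool"
where
  \<comment> \<open>positive inside the domain, so that its gradient points inward\<close>
  "local_defining_function \<Omega> z U \<psi> grad \<longleftrightarrow>
     z \<in> U \<and> (\<exists>hess. C2_with U \<psi> grad hess) \<and> (\<forall>y\<in>U. grad y \<noteq> 0) \<and>
     \<Omega> \<inter> U = {y\<in>U. \<psi> y > 0} \<and> frontier \<Omega> \<inter> U = {y\<in>U. \<psi> y = 0}"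

definition C2_domain :: "(real^'n) set \<Rightarrow> bool" where
  "C2_domain \<Omega> \<longleftrightarrow> open \<Omega> \<and> connected \<Omega> \<and> \<Omega> \<noteq> {} \<and>
     (\<forall>z\<in>frontier \<Omega>. \<exists>U \<psi> grad. local_defining_function \<Omega> z U \<psi> grad)"

text \<open>With \<open>\<nu>\<close> the inward unit normal field, the principal curvatures at \<open>z\<close> are the eigenvalues,
  counted with multiplicity, of the Weingarten map \<open>v \<mapsto> - d\<nu>(z) v\<close> on the tangent space
  at \<open>z\<close>; they are listed along an orthonormal basis of principal directions \<open>e\<close>.  For a ball of
  radius \<open>R\<close> they are all \<open>1/R\<close>.\<close>

definition principal_curvatures :: "(real^'n) set \<Rightarrow> real^'n \<Rightarrow> (nat \<Rightarrow> real) \<Rightarrow> bool" where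
  "principal_curvatures \<Omega> z \<kappa> \<longleftrightarrow>
     (\<exists>U \<psi> grad \<nu> d\<nu> e.
        local_defining_function \<Omega> z U \<psi> grad \<and>
        (\<forall>y\<in>U. \<nu> y = grad y /\<^sub>R norm (grad y)) \<and>
        (\<nu> has_derivative d\<nu>) (at z) \<and>
        (\<forall>i\<in>{1..CARD('n) - 1}. \<forall>j\<in>{1..CARD('n) - 1}. e i \<bullet> e j = (if i = j then 1 else 0)) \<and>
        (\<forall>j\<in>{1..CARD('n) - 1}. e j \<bullet> \<nu> z = 0) \<and>
        (\<forall>j\<in>{1..CARD('n) - 1}. - d\<nu> (e j) = \<kappa> j *\<^sub>R e j))"


section \<open>Viscosity solutions\<close>

text \<open>Viscosity sub- and supersolutions of \<open>F(u, D\<^sup>2u) = 0\<close>, for \<open>F\<close> nonincreasing in the Hessian.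
  Shrinking \<open>U\<close> shows that the extrema below are arbitrary local ones.\<close>

definition viscosity_subsolution ::
  "(real \<Rightarrow> real^'n^'n \<Rightarrow> real) \<Rightarrow> (real^'n) set \<Rightarrow> (real^'n \<Rightarrow> real) \<Rightarrow> bool"
where
  "viscosity_subsolution F \<Omega> u \<longleftrightarrow>
     (\<forall>y\<in>\<Omega>. \<forall>U \<phi> grad hess. y \<in> U \<longrightarrow> U \<subseteq> \<Omega> \<longrightarrow> C2_with U \<phi> grad hess \<longrightarrow>
        (\<forall>w\<in>U. u w - \<phi> w \<le> u y - \<phi> y) \<longrightarrow> F (u y) (hess y) \<le> 0)"

definition viscosity_supersolution ::
  "(real \<Rightarrow> real^'n^'n \<Rightarrow> real) \<Rightarrow> (real^'n) set \<Rightarrow> (real^'n \<Rightarrow> real) \<Rightarrow> bool"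
where
  "viscosity_supersolution F \<Omega> u \<longleftrightarrow>
     (\<forall>y\<in>\<Omega>. \<forall>U \<phi> grad hess. y \<in> U \<longrightarrow> U \<subseteq> \<Omega> \<longrightarrow> C2_with U \<phi> grad hess \<longrightarrow>
        (\<forall>w\<in>U. u w - \<phi> w \<ge> u y - \<phi> y) \<longrightarrow> F (u y) (hess y) \<ge> 0)"

definition viscosity_solution ::
  "(real \<Rightarrow> real^'n^'n \<Rightarrow> real) \<Rightarrow> (real^'n) set \<Rightarrow> (real^'n \<Rightarrow> real) \<Rightarrow> bool"
where
  "viscosity_solution F \<Omega> u \<longleftrightarrow> viscosity_subsolution F \<Omega> u \<and> viscosity_supersolution F \<Omega> u"

definition dirichlet_solution ::
  "(real^'n^'n \<Rightarrow> real) \<Rightarrow> real \<Rightarrow> (real^'n) set \<Rightarrow> (real^'n \<Rightarrow> real) \<Rightarrow> bool"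
where
  \<comment> \<open>\<open>- \<epsilon>\<^sup>2 M(D\<^sup>2u) + u = 0\<close> in the domain, \<open>u = 1\<close> on its boundary\<close>
  "dirichlet_solution M \<epsilon> \<Omega> u \<longleftrightarrow>
     continuous_on (closure \<Omega>) u \<and>
     viscosity_solution (\<lambda>r X. - (\<epsilon>\<^sup>2) * M X + r) \<Omega> u \<and>
     (\<forall>y\<in>frontier \<Omega>. u y = 1) \<and>
     (\<not> bounded \<Omega> \<longrightarrow> bounded (u ` \<Omega>))"


section \<open>The \<open>q\<close>-means\<close>

text \<open>Meaningful for \<open>1 \<le> q \<le> \<infinity>\<close> and bounded measurable \<open>f\<close> on a bounded Borel set \<open>B\<close>.\<close>

definition Lq_norm :: "ereal \<Rightarrow> (real^'n) set \<Rightarrow> (real^'n \<Rightarrow> real) \<Rightarrow> ereal" where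
  "Lq_norm q B f =
     (if q = \<infinity> then esssup (restrict_space lborel B) (\<lambda>y. ereal \<bar>f y\<bar>)
      else ereal ((LINT y:B|lborel. \<bar>f y\<bar> powr real_of_ereal q) powr (1 / real_of_ereal q)))"

definition q_mean :: "ereal \<Rightarrow> (real^'n) set \<Rightarrow> (real^'n \<Rightarrow> real) \<Rightarrow> real" where
  "q_mean q B u =
     (THE m. \<forall>m'. Lq_norm q B (\<lambda>y. u y - m) \<le> Lq_norm q B (\<lambda>y. u y - m'))"

definition q_mean_const :: "nat \<Rightarrow> real \<Rightarrow> real" where
  "q_mean_const N q =
     (2 powr (- ((real N + 1) / 2)) * fact N /
       ((q - 1) powr ((real N + 1) / 2) * Gamma ((real N + 1) / 2))) powr (1 / (q - 1))"

end

(*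
  Near the touching point z we blow up anisotropically: y = z + stretch eps eta scales the normal
  direction by eps and the tangential ones by sqrt eps.  In these coordinates the ball becomes the
  paraboloid |eta'|^2 < 2 R eta_k, and u(y) converges to exp (- tau eta / sqrt theta), where
  tau eta = eta_k - (sum of kap_i eta_i^2) / 2 is the rescaled distance to the boundary and theta is the
  ellipticity constant acting on positive eigenvalues.  The limit comes from comparing u, in a ball of
  radius eps^(3/4) around y, with exponentials of affine functions: on that scale the boundary deviates
  from a hyperplane by O(eps^(3/2)) = o(eps).  The barriers are sums of functions of one orthonormal
  coordinate each, so that their Hessians are diagonal in that basis and the Pucci operators are
  explicit.  Because kap_i < 1/R, u also decays exponentially in eta_k on the whole ball, so the
  rescaled integrals of (u - m)_+^(q-1) converge by dominated convergence to a Gaussian integral.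
  The q-mean m balances this integral against that of (m - u)_+^(q-1), which is asymptotically
  m^(q-1) |B_R|.  For q = infinity the q-mean is the midrange, and the range of u tends to [0, 1].
*)

theory Submission
  imports Defs "HOL-Probability.Distributions"
begin

section \<open>Pucci operators on diagonalised matrices\<close>

text \<open>The comparison radius \<rho> = eps^(3/4) meets two opposite demands. The curvature error
  \<rho>^2 must be o(eps), while \<rho>/eps must tend to infinity: the values of u on the sphere of
  radius \<rho> are unknown, and their influence at the centre is damped only by a factor exp(-c
  \<rho>/eps). Only one ellipticity constant survives because the exponential profile is convex in
  the normal direction and constant in all others; the second constant enters only the rate of that
  damping. The power of eps in the result is a Jacobian. One direction scaled by eps and N-1 scaled
  by sqrt eps give eps^((N+1)/2), and equating this order with m^(q-1) yields m of order
  eps^((N+1)/(2(q-1))). The curvature product comes from the Gaussian integrals over the tangential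
  directions. The volume of the ball brings in Gamma(N/2+1), which Legendre's duplication formula
  trades for N! and Gamma((N+1)/2).\<close>

definition orthonormal_family :: "('n \<Rightarrow> real^'n) \<Rightarrow> bool" where
  "orthonormal_family e \<longleftrightarrow> (\<forall>i j. e i \<bullet> e j = (if i = j then 1 else 0))"

text \<open>The spectral form E^T diag(d) E, where the vectors \<open>e i\<close> are the rows of E.
  Every Hessian of a barrier is given in this form.\<close>

definition diag_in :: "('n \<Rightarrow> real^'n) \<Rightarrow> ('n \<Rightarrow> real) \<Rightarrow> real^'n^'n" where
  "diag_in e d = (\<chi> a b. \<Sum>i\<in>UNIV. d i * e i $ a * e i $ b)"

text \<open>Covers both extremal operators: \<open>tp\<close> and \<open>tn\<close> weigh the positive and the negative
  eigenvalues, and only \<open>tp\<close> survives in the limit.\<close>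

definition pucci :: "real \<Rightarrow> real \<Rightarrow> real^'n^'n \<Rightarrow> real" where
  "pucci tp tn X = tn * neg_eigenvalue_sum X + tp * pos_eigenvalue_sum X"

lemma pucci_minus_eq: "pucci_minus lam Lam = pucci lam Lam"
  by (simp add: fun_eq_iff pucci_minus_def pucci_def)

lemma pucci_plus_eq: "pucci_plus lam Lam = pucci Lam lam"
  by (simp add: fun_eq_iff pucci_plus_def pucci_def)

lemma poly_det: "poly (det A) t = det (\<chi> i j. poly (A $ i $ j) t)"
  by (simp add: det_def poly_sum poly_prod)

text \<open>The family is indexed by the coordinate type itself, so E is square and a right inverse
  is a left inverse. The second identity is the completeness relation behind the expansions
  below.\<close>

lemma orthonormal_family_rows:
  assumes "orthonormal_family e"
  defines "E \<equiv> (\<chi> i a. e i $ a)"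
  shows "E ** transpose E = mat 1" "transpose E ** E = mat 1"
proof -
  show "E ** transpose E = mat 1"
    using assms by (simp add: vec_eq_iff matrix_matrix_mult_def transpose_def mat_def
        orthonormal_family_def inner_vec_def)
  then show "transpose E ** E = mat 1"
    by (simp add: matrix_left_right_inverse)
qed

lemma orthonormal_family_completeness:
  assumes "orthonormal_family e"
  shows "(\<Sum>i\<in>UNIV. e i $ a * e i $ b) = (if a = b then 1 else 0)"
  using orthonormal_family_rows(2)[OF assms]
  by (simp add: vec_eq_iff matrix_matrix_mult_def transpose_def mat_def)

lemma orthonormal_family_expansion:
  assumes "orthonormal_family e"
  shows "(\<Sum>i\<in>UNIV. (v \<bullet> e i) *\<^sub>R e i) = v"
proof -
  have "(\<Sum>i\<in>UNIV. (v \<bullet> e i) * e i $ b) = v $ b" for b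
  proof -
    have "(\<Sum>i\<in>UNIV. (v \<bullet> e i) * e i $ b) = (\<Sum>i\<in>UNIV. \<Sum>a\<in>UNIV. v $ a * (e i $ a * e i $ b))"
      by (simp add: inner_vec_def sum_distrib_right mult.assoc)
    also have "\<dots> = (\<Sum>a\<in>UNIV. v $ a * (\<Sum>i\<in>UNIV. e i $ a * e i $ b))"
      by (subst sum.swap) (simp add: sum_distrib_left)
    also have "\<dots> = v $ b"
      by (simp add: orthonormal_family_completeness[OF assms] if_distrib cong: if_cong)
    finally show ?thesis .
  qed
  then show ?thesis
    by (simp add: vec_eq_iff sum_component)
qed

lemma orthonormal_family_norm:
  assumes "orthonormal_family e"
  shows "(norm v)\<^sup>2 = (\<Sum>i\<in>UNIV. (v \<bullet> e i)\<^sup>2)"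
proof -
  have "(norm v)\<^sup>2 = v \<bullet> (\<Sum>i\<in>UNIV. (v \<bullet> e i) *\<^sub>R e i)"
    by (simp add: orthonormal_family_expansion[OF assms] power2_norm_eq_inner)
  also have "\<dots> = (\<Sum>i\<in>UNIV. (v \<bullet> e i)\<^sup>2)"
    by (simp add: inner_sum_right power2_eq_square)
  finally show ?thesis .
qed

text \<open>At each real t the matrix t I - X equals E^T diag(t - d) E, and det E^T det E = 1
  cancels. Polynomials that agree at every real number are equal.\<close>

lemma charpoly_diag_in:
  assumes e: "orthonormal_family e"
  shows "charpoly (diag_in e d) = (\<Prod>i\<in>UNIV. [:- d i, 1:])"
proof -
  define E where "E = (\<chi> i a. e i $ a)"
  have E: "transpose E ** E = mat 1"
    unfolding E_def by (rule orthonormal_family_rows(2)[OF e])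
  then have dE: "det (transpose E) * det E = 1"
    by (metis det_I det_mul)
  have "poly (charpoly (diag_in e d)) t = poly (\<Prod>i\<in>UNIV. [:- d i, 1:]) t" for t
  proof -
    define \<Delta> :: "real^'a^'a" where "\<Delta> = (\<chi> i j. if i = j then t - d i else 0)"
    have "(\<Sum>i\<in>UNIV. (t - d i) * e i $ a * e i $ b) =
        t * (\<Sum>i\<in>UNIV. e i $ a * e i $ b) - (\<Sum>i\<in>UNIV. d i * e i $ a * e i $ b)" for a b
      by (simp add: sum_distrib_left sum_subtractf algebra_simps)
    then have *: "(\<Sum>i\<in>UNIV. (t - d i) * e i $ a * e i $ b) =
        (if a = b then t else 0) - diag_in e d $ a $ b" for a b
      by (simp add: orthonormal_family_completeness[OF e] diag_in_def)
    have "(\<Delta> ** E) $ i $ b = (t - d i) * e i $ b" for i b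
      by (simp add: matrix_matrix_mult_def \<Delta>_def E_def if_distrib if_distribR cong: if_cong)
    then have "(transpose E ** (\<Delta> ** E)) $ a $ b = (\<Sum>i\<in>UNIV. (t - d i) * e i $ a * e i $ b)" for a b
      by (subst matrix_matrix_mult_def) (simp add: transpose_def E_def ac_simps)
    then have "(\<chi> a b. poly ((\<chi> i j. (if i = j then [:0, 1:] else 0) - [:diag_in e d $ i $ j:]) $ a $ b) t)
        = transpose E ** (\<Delta> ** E)"
      by (simp add: vec_eq_iff *)
    then have "poly (charpoly (diag_in e d)) t = det (transpose E ** (\<Delta> ** E))"
      by (simp only: charpoly_def poly_det)
    also have "\<dots> = det \<Delta>"
      using dE by (simp add: det_mul)
    also have "\<dots> = (\<Prod>i\<in>UNIV. t - d i)"
      by (subst det_diagonal) (simp_all add: \<Delta>_def)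
    finally show ?thesis
      by (simp add: poly_prod)
  qed
  then show ?thesis
    by (simp add: poly_eq_poly_eq_iff[symmetric] fun_eq_iff)
qed

lemma order_prod_linear:
  fixes d :: "'a \<Rightarrow> real"
  assumes "finite A"
  shows "order l (\<Prod>i\<in>A. [:- d i, 1:]) = card {i\<in>A. d i = l}"
  using assms
proof (induction A)
  case (insert j A)
  have *: "{i \<in> insert j A. d i = l} = (if d j = l then insert j {i\<in>A. d i = l} else {i\<in>A. d i = l})"
    by auto
  have "[:- d j, 1:] * (\<Prod>i\<in>A. [:- d i, 1:]) \<noteq> 0"
    using insert.hyps by (subst mult_eq_0_iff) (simp add: prod_zero_iff)
  from order_mult[OF this] have "order l (\<Prod>i\<in>insert j A. [:- d i, 1:]) =
      order l [:- d j, 1:] + card {i\<in>A. d i = l}"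
    using insert.hyps by (simp only: prod.insert insert.IH not_False_eq_True)
  also have "order l [:- d j, 1:] = (if d j = l then 1 else 0)"
  proof (cases "d j = l")
    case True
    then show ?thesis
      using order_power_n_n[of l 1] by simp
  next
    case False
    then show ?thesis
      by (simp add: order_0I)
  qed
  finally show ?case
    unfolding * using insert.hyps by (simp del: prod.insert)
qed (simp add: order_0I)

text \<open>The sum over indices is grouped by the value of \<open>d\<close>: the fibre over l has
  as many elements as l has multiplicity. \<open>P\<close> stands for either sign condition.\<close>

lemma eigenvalue_sum_diag_in:
  fixes P :: "real \<Rightarrow> bool"
  assumes e: "orthonormal_family e"
  shows "(\<Sum>l \<in> {l. poly (charpoly (diag_in e d)) l = 0 \<and> P l}.
            real (order l (charpoly (diag_in e d))) * l) = (\<Sum>i\<in>{i. P (d i)}. d i)"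
proof -
  have roots: "{l. poly (charpoly (diag_in e d)) l = 0 \<and> P l} = d ` {i. P (d i)}"
    by (auto simp: charpoly_diag_in[OF e] poly_prod)
  have "(\<Sum>i\<in>{i. P (d i)}. d i) = (\<Sum>l\<in>d ` {i. P (d i)}. \<Sum>i\<in>{i\<in>{i. P (d i)}. d i = l}. d i)"
    by (rule sum.image_gen) simp
  also have "\<dots> = (\<Sum>l\<in>d ` {i. P (d i)}. real (card {i. d i = l}) * l)"
  proof (rule sum.cong)
    fix l assume "l \<in> d ` {i. P (d i)}"
    then have "{i\<in>{i. P (d i)}. d i = l} = {i. d i = l}" by auto
    then show "(\<Sum>i\<in>{i\<in>{i. P (d i)}. d i = l}. d i) = real (card {i. d i = l}) * l" by simp
  qed simp
  finally show ?thesis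
    unfolding roots by (simp add: charpoly_diag_in[OF e] order_prod_linear)
qed

text \<open>The Pucci operator of a 1x1 matrix; on diagonal Hessians the full operator is a sum of
  such terms.\<close>

definition pucci1 :: "real \<Rightarrow> real \<Rightarrow> real \<Rightarrow> real" where
  "pucci1 tp tn s = tp * max s 0 + tn * min s 0"

lemma pucci_diag_in:
  assumes "orthonormal_family e"
  shows "pucci tp tn (diag_in e d) = (\<Sum>i\<in>UNIV. pucci1 tp tn (d i))"
proof -
  have "(\<Sum>i\<in>{i. d i < 0}. d i) = (\<Sum>i\<in>UNIV. min (d i) 0)"
    by (rule sum.mono_neutral_cong_left) (auto simp: min_def)
  moreover have "(\<Sum>i\<in>{i. d i > 0}. d i) = (\<Sum>i\<in>UNIV. max (d i) 0)"
    by (rule sum.mono_neutral_cong_left) (auto simp: max_def)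
  ultimately show ?thesis
    unfolding pucci_def neg_eigenvalue_sum_def pos_eigenvalue_sum_def pucci1_def
    by (simp add: eigenvalue_sum_diag_in[OF assms, where P="\<lambda>l. l < 0"]
        eigenvalue_sum_diag_in[OF assms, where P="\<lambda>l. 0 < l"] sum.distrib sum_distrib_left)
qed

section \<open>Comparison with separable barriers\<close>

definition separable :: "('n \<Rightarrow> real^'n) \<Rightarrow> real^'n \<Rightarrow> ('n \<Rightarrow> real \<Rightarrow> real) \<Rightarrow> real^'n \<Rightarrow> real" where
  "separable e y g v = (\<Sum>i\<in>UNIV. g i ((v - y) \<bullet> e i))"

lemma C2_with_separable:
  assumes "\<And>i s. (g i has_real_derivative g' i s) (at s)"
    and "\<And>i s. (g' i has_real_derivative g'' i s) (at s)"
    and "\<And>i. continuous_on UNIV (g'' i)" and "open D"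
  shows "C2_with D (separable e y g) (\<lambda>v. \<Sum>i\<in>UNIV. g' i ((v - y) \<bullet> e i) *\<^sub>R e i)
           (\<lambda>v. diag_in e (\<lambda>i. g'' i ((v - y) \<bullet> e i)))"
  unfolding C2_with_def
proof (intro conjI ballI)
  fix v
  have d: "((\<lambda>v. g i ((v - y) \<bullet> e i)) has_derivative (\<lambda>w. (w \<bullet> e i) * g' i ((v - y) \<bullet> e i))) (at v)" for i
    by (rule has_derivative_compose[OF _ assms(1)[unfolded has_field_derivative_def], THEN has_derivative_eq_rhs])
      (auto intro!: derivative_eq_intros simp: mult.commute)
  have d': "((\<lambda>v. g' i ((v - y) \<bullet> e i)) has_derivative (\<lambda>w. (w \<bullet> e i) * g'' i ((v - y) \<bullet> e i))) (at v)" for i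
    by (rule has_derivative_compose[OF _ assms(2)[unfolded has_field_derivative_def], THEN has_derivative_eq_rhs])
      (auto intro!: derivative_eq_intros simp: mult.commute)
  show "(separable e y g has_derivative (\<bullet>) (\<Sum>i\<in>UNIV. g' i ((v - y) \<bullet> e i) *\<^sub>R e i)) (at v)"
    unfolding separable_def
    by (rule has_derivative_sum[OF d, THEN has_derivative_eq_rhs])
      (simp add: fun_eq_iff inner_sum_left inner_sum_right inner_commute mult.commute)
  show "((\<lambda>v. \<Sum>i\<in>UNIV. g' i ((v - y) \<bullet> e i) *\<^sub>R e i) has_derivative
      (*v) (diag_in e (\<lambda>i. g'' i ((v - y) \<bullet> e i)))) (at v)"
  proof (rule has_derivative_sum[OF has_derivative_scaleR_left[OF d'], THEN has_derivative_eq_rhs], rule ext)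
    fix w
    have "(\<Sum>i\<in>UNIV. (w \<bullet> e i * g'' i ((v - y) \<bullet> e i)) * e i $ a) =
      (\<Sum>b\<in>UNIV. (\<Sum>i\<in>UNIV. g'' i ((v - y) \<bullet> e i) * e i $ a * e i $ b) * w $ b)" for a
      unfolding inner_vec_def[of w] sum_distrib_right
      by (subst sum.swap) (simp add: ac_simps)
    then show "(\<Sum>i\<in>UNIV. (w \<bullet> e i * g'' i ((v - y) \<bullet> e i)) *\<^sub>R e i) =
      diag_in e (\<lambda>i. g'' i ((v - y) \<bullet> e i)) *v w"
      by (simp add: vec_eq_iff diag_in_def matrix_vector_mult_def sum_component)
  qed
next
  show "continuous_on D (\<lambda>v. diag_in e (\<lambda>i. g'' i ((v - y) \<bullet> e i)))"
    unfolding diag_in_def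
    by (intro continuous_on_vec_lambda continuous_intros continuous_on_compose2[OF assms(3)]) auto
qed fact

lemma separable_continuous_on:
  assumes "\<And>i s. (g i has_real_derivative g' i s) (at s)"
  shows "continuous_on S (separable e y g)"
proof -
  have "continuous_on UNIV (g i)" for i
    using assms by (meson DERIV_continuous_on has_field_derivative_at_within)
  then have "continuous_on S (\<lambda>v. g i ((v - y) \<bullet> e i))" for i
    by (rule continuous_on_compose2) (auto intro!: continuous_intros)
  then show ?thesis
    unfolding separable_def by (rule continuous_on_sum)
qed

text \<open>Comparison is carried out on \<Omega> cut by a ball, which is bounded even if \<Omega>
  is not. On one part of its boundary u = 1; on the spherical part only global bounds on u are
  available.\<close>

lemma frontier_Int_ball:
  fixes \<Omega> :: "(real^'n) set"
  assumes "open \<Omega>" "v \<in> frontier (\<Omega> \<inter> ball y \<rho>)"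
  shows "dist y v \<le> \<rho>" "v \<in> frontier \<Omega> \<or> v \<in> \<Omega> \<and> dist y v = \<rho>"
proof -
  have op: "open (\<Omega> \<inter> ball y \<rho>)" using assms by auto
  then have *: "v \<in> closure (\<Omega> \<inter> ball y \<rho>)" "v \<notin> \<Omega> \<inter> ball y \<rho>"
    using assms by (auto simp: frontier_def interior_open)
  then have "v \<in> closure \<Omega>" "v \<in> closure (ball y \<rho>)"
    by (meson closure_mono in_mono inf_le1 inf_le2)+
  then show "dist y v \<le> \<rho>"
    using closure_minimal[OF ball_subset_cball closed_cball] by fastforce
  then show "v \<in> frontier \<Omega> \<or> v \<in> \<Omega> \<and> dist y v = \<rho>"
    using * \<open>v \<in> closure \<Omega>\<close> \<open>open \<Omega>\<close> by (auto simp: frontier_def interior_open)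
qed

locale pucci_dirichlet =
  fixes tp tn \<epsilon> :: real and \<Omega> :: "(real^'n) set" and u :: "real^'n \<Rightarrow> real"
  assumes tp_pos: "0 < tp" and tn_pos: "0 < tn" and eps_pos: "0 < \<epsilon>" and open_dom: "open \<Omega>"
    and solution: "dirichlet_solution (pucci tp tn) \<epsilon> \<Omega> u"
begin

lemma continuous_u: "continuous_on (closure \<Omega>) u"
  using solution by (simp add: dirichlet_solution_def)

lemma boundary_u: "v \<in> frontier \<Omega> \<Longrightarrow> u v = 1"
  using solution by (simp add: dirichlet_solution_def)

text \<open>The barrier is C2 and so serves itself as test function at an interior maximum of u
  minus the barrier. Thanks to the zero-order term u in the equation, the subsolution inequality
  there reads u \<le> \<epsilon>^2 M(Hessian) \<le> barrier, and no strict inequality has to be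
  arranged.\<close>

lemma comparison_upper:
  assumes e: "orthonormal_family e"
    and D: "open D" "bounded D" "D \<subseteq> \<Omega>"
    and g: "\<And>i s. (g i has_real_derivative g' i s) (at s)"
      "\<And>i s. (g' i has_real_derivative g'' i s) (at s)" "\<And>i. continuous_on UNIV (g'' i)"
    and pde: "\<And>v. v \<in> D \<Longrightarrow>
      \<epsilon>\<^sup>2 * (\<Sum>i\<in>UNIV. pucci1 tp tn (g'' i ((v - y) \<bullet> e i))) \<le> separable e y g v"
    and bdry: "\<And>v. v \<in> frontier D \<Longrightarrow> u v \<le> separable e y g v"
    and "w \<in> D"
  shows "u w \<le> separable e y g w"
proof -
  have "continuous_on (closure D) u"
    using continuous_u D(3) by (meson closure_mono continuous_on_subset)
  then have "continuous_on (closure D) (\<lambda>v. u v - separable e y g v)"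
    by (intro continuous_intros separable_continuous_on[OF g(1)])
  moreover have "compact (closure D)" "closure D \<noteq> {}"
    using D(2) \<open>w \<in> D\<close> by (auto simp: compact_closure)
  ultimately obtain m where m: "m \<in> closure D"
    "\<And>v. v \<in> closure D \<Longrightarrow> u v - separable e y g v \<le> u m - separable e y g m"
    using continuous_attains_sup[of "closure D" "\<lambda>v. u v - separable e y g v"] by blast
  have "u m \<le> separable e y g m"
  proof (cases "m \<in> D")
    case True
    have c2: "C2_with D (separable e y g) (\<lambda>v. \<Sum>i\<in>UNIV. g' i ((v - y) \<bullet> e i) *\<^sub>R e i)
        (\<lambda>v. diag_in e (\<lambda>i. g'' i ((v - y) \<bullet> e i)))"
      by (rule C2_with_separable[OF g D(1)])
    have visc: "viscosity_subsolution (\<lambda>r X. - (\<epsilon>\<^sup>2) * pucci tp tn X + r) \<Omega> u"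
      using solution by (simp add: dirichlet_solution_def viscosity_solution_def)
    have "u v - separable e y g v \<le> u m - separable e y g m" if "v \<in> D" for v
      using m(2) that closure_subset by blast
    then have "- (\<epsilon>\<^sup>2) * pucci tp tn (diag_in e (\<lambda>i. g'' i ((m - y) \<bullet> e i))) + u m \<le> 0"
      using visc[unfolded viscosity_subsolution_def, rule_format, OF subsetD[OF D(3) True] True D(3) c2] by blast
    then show ?thesis
      using pde[OF True] by (simp add: pucci_diag_in[OF e])
  next
    case False
    then have "m \<in> frontier D"
      using m(1) D(1) by (simp add: frontier_def interior_open)
    then show ?thesis by (rule bdry)
  qed
  moreover have "w \<in> closure D"
    using \<open>w \<in> D\<close> closure_subset by blast
  ultimately show ?thesis
    using m(2)[of w] by linarith
qed

lemma comparison_lower: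
  assumes e: "orthonormal_family e"
    and D: "open D" "bounded D" "D \<subseteq> \<Omega>"
    and g: "\<And>i s. (g i has_real_derivative g' i s) (at s)"
      "\<And>i s. (g' i has_real_derivative g'' i s) (at s)" "\<And>i. continuous_on UNIV (g'' i)"
    and pde: "\<And>v. v \<in> D \<Longrightarrow>
      separable e y g v \<le> \<epsilon>\<^sup>2 * (\<Sum>i\<in>UNIV. pucci1 tp tn (g'' i ((v - y) \<bullet> e i)))"
    and bdry: "\<And>v. v \<in> frontier D \<Longrightarrow> separable e y g v \<le> u v"
    and "w \<in> D"
  shows "separable e y g w \<le> u w"
proof -
  have "continuous_on (closure D) u"
    using continuous_u D(3) by (meson closure_mono continuous_on_subset)
  then have "continuous_on (closure D) (\<lambda>v. u v - separable e y g v)"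
    by (intro continuous_intros separable_continuous_on[OF g(1)])
  moreover have "compact (closure D)" "closure D \<noteq> {}"
    using D(2) \<open>w \<in> D\<close> by (auto simp: compact_closure)
  ultimately obtain m where m: "m \<in> closure D"
    "\<And>v. v \<in> closure D \<Longrightarrow> u m - separable e y g m \<le> u v - separable e y g v"
    using continuous_attains_inf[of "closure D" "\<lambda>v. u v - separable e y g v"] by blast
  have "separable e y g m \<le> u m"
  proof (cases "m \<in> D")
    case True
    have c2: "C2_with D (separable e y g) (\<lambda>v. \<Sum>i\<in>UNIV. g' i ((v - y) \<bullet> e i) *\<^sub>R e i)
        (\<lambda>v. diag_in e (\<lambda>i. g'' i ((v - y) \<bullet> e i)))"
      by (rule C2_with_separable[OF g D(1)])
    have visc: "viscosity_supersolution (\<lambda>r X. - (\<epsilon>\<^sup>2) * pucci tp tn X + r) \<Omega> u"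
      using solution by (simp add: dirichlet_solution_def viscosity_solution_def)
    have "u m - separable e y g m \<le> u v - separable e y g v" if "v \<in> D" for v
      using m(2) that closure_subset by blast
    then have "- (\<epsilon>\<^sup>2) * pucci tp tn (diag_in e (\<lambda>i. g'' i ((m - y) \<bullet> e i))) + u m \<ge> 0"
      using visc[unfolded viscosity_supersolution_def, rule_format, OF subsetD[OF D(3) True] True D(3) c2] by blast
    then show ?thesis
      using pde[OF True] by (simp add: pucci_diag_in[OF e])
  next
    case False
    then have "m \<in> frontier D"
      using m(1) D(1) by (simp add: frontier_def interior_open)
    then show ?thesis by (rule bdry)
  qed
  moreover have "w \<in> closure D"
    using \<open>w \<in> D\<close> closure_subset by blast
  ultimately show ?thesis
    using m(2)[of w] by linarith
qed

end

section \<open>Global bounds on u and exponential barriers\<close>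

lemma orthonormal_family_axis: "orthonormal_family (\<lambda>i::'n::finite. axis i 1)"
  by (simp add: orthonormal_family_def inner_axis_axis)

lemma ex_orthonormal_family:
  fixes n :: "real^'n"
  assumes "norm n = 1"
  shows "\<exists>e. orthonormal_family e \<and> e k = n"
proof -
  have "norm (axis k 1 :: real^'n) = 1" by (simp add: norm_Basis)
  then obtain f :: "real^'n \<Rightarrow> real^'n" where f: "orthogonal_transformation f" "f (axis k 1) = n"
    using assms by (rule orthogonal_transformation_exists_1)
  have "orthonormal_family (\<lambda>i. f (axis i 1))"
    using f(1) by (simp add: orthonormal_family_def orthogonal_transformation_def inner_axis_axis)
  with f(2) show ?thesis by blast
qed

text \<open>A paraboloid is separable in every orthonormal basis once its constant is shared equally
  among the coordinates.\<close>

lemma separable_sum_squares: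
  assumes "orthonormal_family e"
  shows "separable e y (\<lambda>i s. a / CARD('n) + \<delta> * s\<^sup>2) (v :: real^'n) = a + \<delta> * (norm (v - y))\<^sup>2"
  unfolding separable_def orthonormal_family_norm[OF assms]
  by (simp add: sum.distrib sum_distrib_left)

lemma pucci1_nonneg: "0 \<le> s \<Longrightarrow> pucci1 tp tn s = tp * s"
  by (simp add: pucci1_def)

lemma pucci1_nonpos: "s \<le> 0 \<Longrightarrow> pucci1 tp tn s = tn * s"
  by (simp add: pucci1_def)

text \<open>Subtracting \<open>r\<close> may flip the sign and thus the weight; charging
  \<open>max tp tn\<close> for it covers both cases. This serves the lower barrier, where the
  lateral term enters with a minus sign.\<close>

lemma pucci1_diff_ge:
  assumes "0 \<le> p" "0 \<le> r" "0 < tp" "0 < tn"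
  shows "tp * p - max tp tn * r \<le> pucci1 tp tn (p - r)"
proof (cases "r \<le> p")
  case True
  then show ?thesis
    using assms mult_right_mono[of tp "max tp tn" r] by (simp add: pucci1_nonneg algebra_simps)
next
  case False
  then have "tp * p \<le> max tp tn * p" "tn * (r - p) \<le> max tp tn * (r - p)"
    using assms by (auto intro: mult_right_mono)
  then show ?thesis
    using False by (simp add: pucci1_nonpos algebra_simps)
qed

text \<open>Two losses meet here. The profile cosh(s / (sqrt m \<epsilon>)) with m = max tp tn works
  for both weights, and a point at distance \<rho> from the centre is only known to have some
  coordinate of size \<rho> / sqrt N.\<close>

definition decay_rate :: "real \<Rightarrow> real \<Rightarrow> nat \<Rightarrow> real" where
  "decay_rate tp tn N = 1 / (sqrt (max tp tn) * sqrt (real N))"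

lemma deriv_sinh:
  assumes "c \<noteq> 0" "H \<noteq> 0"
  shows "((\<lambda>s. sinh (s / c) / c / H) has_real_derivative cosh (s / c) / H / (c * c)) (at s)"
  using assms by (auto intro!: derivative_eq_intros simp: divide_simps)

context pucci_dirichlet
begin

text \<open>A purely qualitative bound: K may depend on \<epsilon>. It starts the argument that
  gives the uniform bounds 0 and 1.\<close>

lemma bounded_u: "\<exists>K\<ge>0. \<forall>v\<in>closure \<Omega>. \<bar>u v\<bar> \<le> K"
proof -
  have "bounded (u ` closure \<Omega>)"
  proof (cases "bounded \<Omega>")
    case True
    then show ?thesis
      using continuous_u by (intro compact_imp_bounded compact_continuous_image) (auto simp: compact_closure)
  next
    case False
    then have "bounded (u ` \<Omega>)"
      using solution by (simp add: dirichlet_solution_def)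
    moreover have "u ` closure \<Omega> \<subseteq> closure (u ` \<Omega>)"
      by (intro image_closure_subset continuous_u closed_closure closure_subset)
    ultimately show ?thesis
      by (rule bounded_subset[OF bounded_closure])
  qed
  then obtain K where K: "\<And>v. v \<in> closure \<Omega> \<Longrightarrow> \<bar>u v\<bar> \<le> K"
    unfolding bounded_iff by auto
  have "\<bar>u v\<bar> \<le> max K 0" if "v \<in> closure \<Omega>" for v
    using K[OF that] by linarith
  then show ?thesis
    by (intro exI[of _ "max K 0"]) auto
qed

text \<open>A maximum principle that survives unbounded domains: compare with 1 plus a flat convex
  paraboloid centred at the very point y, where the barrier takes the value 1.\<close>

lemma u_le_1:
  assumes "y \<in> \<Omega>"
  shows "u y \<le> 1"
proof -
  obtain K where K: "K \<ge> 0" "\<And>v. v \<in> closure \<Omega> \<Longrightarrow> \<bar>u v\<bar> \<le> K"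
    using bounded_u by blast
  define C where "C = \<epsilon>\<^sup>2 * (CARD('n) * (tp * (2 * K)))"
  \<comment> \<open>From \<rho> \<ge> 1 follows C \<le> \<rho>^2, which makes the paraboloid flat
    enough for the equation. The \<open>\<delta>\<close> below lets it reach 1 + K on the sphere of
    radius \<rho>.\<close>
  define \<rho> where "\<rho> = 1 + C"
  define \<delta> where "\<delta> = K / \<rho>\<^sup>2"
  have C: "C \<ge> 0" using K(1) tp_pos by (simp add: C_def)
  then have \<rho>: "\<rho> \<ge> 1" by (simp add: \<rho>_def)
  then have "C \<le> \<rho>\<^sup>2"
    using self_le_power[OF \<rho>, of 2] by (simp add: \<rho>_def)
  then have C1: "\<epsilon>\<^sup>2 * (CARD('n) * (tp * (2 * \<delta>))) \<le> 1"
    using \<rho> by (simp add: \<delta>_def C_def field_simps)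
  have \<delta>0: "\<delta> \<ge> 0" using K by (simp add: \<delta>_def)
  let ?e = "\<lambda>i::'n. axis i 1 :: real^'n"
  let ?g = "\<lambda>(i::'n) s. 1 / CARD('n) + \<delta> * s\<^sup>2"
  note sep = separable_sum_squares[OF orthonormal_family_axis, of y 1 \<delta>]
  have "u y \<le> separable ?e y ?g y"
  proof (rule comparison_upper[OF orthonormal_family_axis, where D="\<Omega> \<inter> ball y \<rho>"
        and g'="\<lambda>i s. 2 * \<delta> * s" and g''="\<lambda>i s. 2 * \<delta>"])
    fix v assume "v \<in> \<Omega> \<inter> ball y \<rho>"
    have "\<epsilon>\<^sup>2 * (\<Sum>i\<in>(UNIV::'n set). pucci1 tp tn (2 * \<delta>)) \<le> 1"
      using C1 \<delta>0 by (simp add: pucci1_nonneg)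
    also have "1 \<le> separable ?e y ?g v"
      using \<delta>0 by (simp add: sep)
    finally show "\<epsilon>\<^sup>2 * (\<Sum>i\<in>(UNIV::'n set). pucci1 tp tn (2 * \<delta>)) \<le> separable ?e y ?g v" .
  next
    fix v assume v: "v \<in> frontier (\<Omega> \<inter> ball y \<rho>)"
    show "u v \<le> separable ?e y ?g v"
    proof (cases "v \<in> frontier \<Omega>")
      case True
      then show ?thesis using \<delta>0 by (simp add: sep boundary_u)
    next
      case False
      then have v': "v \<in> \<Omega>" "norm (v - y) = \<rho>"
        using frontier_Int_ball[OF open_dom v] by (auto simp: dist_norm norm_minus_commute)
      then have "\<bar>u v\<bar> \<le> K" using K(2) closure_subset by blast
      moreover have "1 + \<delta> * (norm (v - y))\<^sup>2 = 1 + K"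
        using \<rho> v' by (simp add: \<delta>_def)
      ultimately show ?thesis
        unfolding sep by linarith
    qed
  qed (use open_dom \<rho> assms in \<open>auto intro!: derivative_eq_intros continuous_intros\<close>)
  then show ?thesis by (simp add: sep)
qed

text \<open>For the upper bound the constant 1 absorbed the second-order term. At level 0 there is
  no such slack, so the concave paraboloid is lowered by exactly that term, \<open>a\<close>.
  Choosing \<rho> with C \<le> t \<rho>^2 makes \<open>a\<close> at most t, and t is
  arbitrary.\<close>

lemma u_nonneg:
  assumes "y \<in> \<Omega>"
  shows "0 \<le> u y"
proof (rule field_le_epsilon)
  fix t :: real assume t: "t > 0"
  obtain K where K: "K \<ge> 0" "\<And>v. v \<in> closure \<Omega> \<Longrightarrow> \<bar>u v\<bar> \<le> K"
    using bounded_u by blast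
  define C where "C = \<epsilon>\<^sup>2 * (CARD('n) * (tn * (2 * K)))"
  define \<rho> where "\<rho> = 1 + C / t"
  define \<delta> where "\<delta> = K / \<rho>\<^sup>2"
  define a where "a = \<epsilon>\<^sup>2 * (CARD('n) * (tn * (2 * \<delta>)))"
  have C: "C \<ge> 0" using K(1) tn_pos by (simp add: C_def)
  then have \<rho>: "\<rho> \<ge> 1" using t by (simp add: \<rho>_def)
  have "C \<le> t * \<rho>"
    using t by (simp add: \<rho>_def field_simps)
  also have "\<dots> \<le> t * \<rho>\<^sup>2"
    using self_le_power[OF \<rho>, of 2] t by (intro mult_left_mono) auto
  finally have "C \<le> t * \<rho>\<^sup>2" .
  then have a: "a \<le> t" "a \<ge> 0"
    using \<rho> K tn_pos by (simp_all add: a_def \<delta>_def C_def field_simps)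
  have \<delta>0: "\<delta> \<ge> 0" using K by (simp add: \<delta>_def)
  let ?e = "\<lambda>i::'n. axis i 1 :: real^'n"
  let ?g = "\<lambda>(i::'n) s. - a / CARD('n) + - \<delta> * s\<^sup>2"
  note sep = separable_sum_squares[OF orthonormal_family_axis, of y "- a" "- \<delta>"]
  have "separable ?e y ?g y \<le> u y"
  proof (rule comparison_lower[OF orthonormal_family_axis, where D="\<Omega> \<inter> ball y \<rho>"
        and g'="\<lambda>i s. - 2 * \<delta> * s" and g''="\<lambda>i s. - 2 * \<delta>"])
    fix v assume "v \<in> \<Omega> \<inter> ball y \<rho>"
    have "separable ?e y ?g v \<le> - a"
      using \<delta>0 by (simp only: sep) simp
    also have "- a = \<epsilon>\<^sup>2 * (\<Sum>i\<in>(UNIV::'n set). pucci1 tp tn (- 2 * \<delta>))"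
      using \<delta>0 by (simp add: pucci1_nonpos a_def)
    finally show "separable ?e y ?g v \<le> \<epsilon>\<^sup>2 * (\<Sum>i\<in>(UNIV::'n set). pucci1 tp tn (- 2 * \<delta>))" .
  next
    fix v assume v: "v \<in> frontier (\<Omega> \<inter> ball y \<rho>)"
    show "separable ?e y ?g v \<le> u v"
    proof (cases "v \<in> frontier \<Omega>")
      case True
      have "0 \<le> \<delta> * (norm (v - y))\<^sup>2" using \<delta>0 by simp
      then show ?thesis unfolding sep boundary_u[OF True] using a by linarith
    next
      case False
      then have v': "v \<in> \<Omega>" "norm (v - y) = \<rho>"
        using frontier_Int_ball[OF open_dom v] by (auto simp: dist_norm norm_minus_commute)
      then have "\<bar>u v\<bar> \<le> K" using K(2) closure_subset by blast
      moreover have "- a + - \<delta> * (norm (v - y))\<^sup>2 = - a - K"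
        using \<rho> v' by (simp add: \<delta>_def)
      ultimately show ?thesis
        unfolding sep using a by linarith
    qed
  qed (use open_dom \<rho> assms in \<open>auto intro!: derivative_eq_intros continuous_intros\<close>)
  then show "0 \<le> u y + t" using a by (simp only: sep) simp
qed

text \<open>Summed over an orthonormal basis this is at least 1 on the sphere of radius \<open>\<rho>\<close>, and it is a
  supersolution that is exponentially small at the centre.  Adding it to, or subtracting it from, a
  barrier makes the values of the solution on that sphere irrelevant.\<close>

definition lateral :: "real \<Rightarrow> real \<Rightarrow> real" where
  "lateral \<rho> s = cosh (s / (sqrt (max tp tn) * \<epsilon>)) / cosh (decay_rate tp tn CARD('n) * \<rho> / \<epsilon>)"

definition lateral' :: "real \<Rightarrow> real \<Rightarrow> real" where
  "lateral' \<rho> s = sinh (s / (sqrt (max tp tn) * \<epsilon>)) / (sqrt (max tp tn) * \<epsilon>) / cosh (decay_rate tp tn CARD('n) * \<rho> / \<epsilon>)"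

lemma decay_rate_pos: "0 < decay_rate tp tn CARD('n)"
  using tp_pos by (auto simp: decay_rate_def less_max_iff_disj)

lemma lateral_nonneg: "0 \<le> lateral \<rho> s"
  by (simp add: lateral_def)

lemma lateral_deriv:
  "(lateral \<rho> has_real_derivative lateral' \<rho> s) (at s)"
  "(lateral' \<rho> has_real_derivative lateral \<rho> s / (max tp tn * \<epsilon>\<^sup>2)) (at s)"
proof -
  define m where "m = max tp tn"
  have "m > 0" using tp_pos by (auto simp: m_def less_max_iff_disj)
  have "max tp tn \<noteq> 0" "\<epsilon> \<noteq> 0" using \<open>m > 0\<close> eps_pos by (auto simp: m_def)
  moreover have H: "cosh (decay_rate tp tn CARD('n) * \<rho> / \<epsilon>) \<noteq> 0" using cosh_real_pos[of "decay_rate tp tn CARD('n) * \<rho> / \<epsilon>"] by linarith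
  ultimately show "(lateral \<rho> has_real_derivative lateral' \<rho> s) (at s)"
    unfolding lateral_def[abs_def] lateral'_def
    by (auto intro!: derivative_eq_intros simp: divide_simps)
  have eq: "m * \<epsilon>\<^sup>2 = (sqrt m * \<epsilon>) * (sqrt m * \<epsilon>)"
    using \<open>m > 0\<close> by (simp add: power2_eq_square)
  show "(lateral' \<rho> has_real_derivative lateral \<rho> s / (max tp tn * \<epsilon>\<^sup>2)) (at s)"
    unfolding lateral'_def[abs_def] lateral_def m_def[symmetric] eq
    using \<open>m > 0\<close> eps_pos H
    by (intro deriv_sinh) auto
qed

lemma lateral_continuous: "continuous_on S (\<lambda>s. lateral \<rho> s)"
  unfolding lateral_def using cosh_real_pos[of "decay_rate tp tn CARD('n) * \<rho> / \<epsilon>"] tp_pos eps_pos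
    less_max_iff_disj[of 0 tp tn]
  by (intro continuous_intros) auto

text \<open>Pigeonhole: the squares of the N coordinates add up to \<rho>^2, so one coordinate has
  modulus at least \<rho> / sqrt N, and there cosh alone reaches the normalising
  denominator.\<close>

lemma lateral_sum_ge_1:
  fixes v y :: "real^'n"
  assumes e: "orthonormal_family e" and v: "dist y v = \<rho>"
  shows "1 \<le> (\<Sum>i\<in>UNIV. lateral \<rho> ((v - y) \<bullet> e i))"
proof -
  have "\<exists>i. \<rho>\<^sup>2 / CARD('n) \<le> ((v - y) \<bullet> e i)\<^sup>2"
  proof (rule ccontr)
    assume "\<not> ?thesis"
    then have "((v - y) \<bullet> e i)\<^sup>2 < \<rho>\<^sup>2 / CARD('n)" for i
      by (simp add: not_le)
    then have "(\<Sum>i\<in>UNIV. ((v - y) \<bullet> e i)\<^sup>2) < (\<Sum>i\<in>(UNIV::'n set). \<rho>\<^sup>2 / CARD('n))"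
      by (intro sum_strict_mono) auto
    then show False
      using v by (simp add: orthonormal_family_norm[OF e, symmetric] dist_norm norm_minus_commute)
  qed
  then obtain i where i: "\<rho>\<^sup>2 / CARD('n) \<le> ((v - y) \<bullet> e i)\<^sup>2" ..
  have \<rho>: "0 \<le> \<rho>" using v by auto
  have "\<rho> / sqrt CARD('n) \<le> \<bar>(v - y) \<bullet> e i\<bar>"
    using real_sqrt_le_mono[OF i] \<rho> by (simp add: real_sqrt_divide)
  define m where "m = max tp tn"
  have "m > 0" using tp_pos by (auto simp: m_def less_max_iff_disj)
  have "decay_rate tp tn CARD('n) * \<rho> / \<epsilon> = \<rho> / sqrt CARD('n) / (sqrt m * \<epsilon>)"
    by (simp add: decay_rate_def m_def)
  also have "\<dots> \<le> \<bar>(v - y) \<bullet> e i\<bar> / (sqrt m * \<epsilon>)"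
    using \<open>\<rho> / sqrt CARD('n) \<le> _\<close> \<open>m > 0\<close> eps_pos by (intro divide_right_mono) auto
  also have "\<dots> = \<bar>((v - y) \<bullet> e i) / (sqrt m * \<epsilon>)\<bar>"
    using \<open>m > 0\<close> eps_pos by simp
  finally have "cosh (decay_rate tp tn CARD('n) * \<rho> / \<epsilon>) \<le> cosh \<bar>((v - y) \<bullet> e i) / (sqrt m * \<epsilon>)\<bar>"
    using \<rho> decay_rate_pos eps_pos by (subst cosh_real_nonneg_le_iff) auto
  then have "1 \<le> lateral \<rho> ((v - y) \<bullet> e i)"
    unfolding cosh_real_abs by (simp add: lateral_def m_def)
  also have "\<dots> \<le> (\<Sum>i\<in>UNIV. lateral \<rho> ((v - y) \<bullet> e i))"
    by (rule member_le_sum) (auto simp: lateral_nonneg)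
  finally show ?thesis .
qed

lemma lateral_0: "(\<Sum>i\<in>(UNIV::'n set). lateral \<rho> 0) = CARD('n) / cosh (decay_rate tp tn CARD('n) * \<rho> / \<epsilon>)"
  by (simp add: lateral_def)

text \<open>The exponential depends on one coordinate and is convex in it, so it solves the equation
  exactly with weight \<open>tp\<close>; the lateral term dominates u on the sphere. The factor
  \<open>a\<close> is kept so that a = 0 can serve points whose ball does not meet the
  frontier.\<close>

lemma upper_barrier:
  fixes n :: "real^'n"
  assumes "y \<in> \<Omega>" "0 < \<rho>" "norm n = 1" "0 \<le> a"
    and bd: "\<And>v. v \<in> frontier \<Omega> \<Longrightarrow> dist y v < \<rho> \<Longrightarrow> 1 \<le> a * exp (b - ((v - y) \<bullet> n) / (\<epsilon> * sqrt tp))"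
  shows "u y \<le> a * exp b + CARD('n) / cosh (decay_rate tp tn CARD('n) * \<rho> / \<epsilon>)"
proof -
  \<comment> \<open>An arbitrary slot of the basis for the direction \<open>n\<close>.\<close>
  define k :: 'n where "k = undefined"
  obtain e where e: "orthonormal_family e" and ek: "e k = n"
    using ex_orthonormal_family[OF assms(3)] by blast
  define f where "f i s = (if i = k then a * exp (b - s / (\<epsilon> * sqrt tp)) else 0)" for i s
  define g where "g i s = f i s + lateral \<rho> s" for i s
  define g' where "g' i s = - f i s / (\<epsilon> * sqrt tp) + lateral' \<rho> s" for i s
  define g'' where "g'' i s = f i s / (\<epsilon>\<^sup>2 * tp) + lateral \<rho> s / (max tp tn * \<epsilon>\<^sup>2)" for i s
  have f0: "f i s \<ge> 0" for i s using assms by (simp add: f_def)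
  have df: "(f i has_real_derivative - f i s / (\<epsilon> * sqrt tp)) (at s)" for i s
    unfolding f_def using eps_pos tp_pos by (auto intro!: derivative_eq_intros)
  have cf: "continuous_on UNIV (f i)" for i
    unfolding f_def using eps_pos tp_pos by (cases "i = k") (auto intro!: continuous_intros)
  have eq: "\<epsilon>\<^sup>2 * tp = (\<epsilon> * sqrt tp) * (\<epsilon> * sqrt tp)"
    using tp_pos by (simp add: power2_eq_square)
  have dg: "(g i has_real_derivative g' i s) (at s)" for i s
    unfolding g_def g'_def by (intro DERIV_add df lateral_deriv)
  have dg': "(g' i has_real_derivative g'' i s) (at s)" for i s
    unfolding g'_def g''_def eq
    by (intro DERIV_add lateral_deriv)
      (rule DERIV_cong[OF DERIV_cdivide[OF DERIV_minus[OF df]]], simp)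
  have cg: "continuous_on UNIV (g'' i)" for i
    unfolding g''_def using eps_pos tp_pos
    by (intro continuous_intros cf lateral_continuous) (auto simp: max_def)
  have sep: "separable e y g v = a * exp (b - ((v - y) \<bullet> n) / (\<epsilon> * sqrt tp)) +
      (\<Sum>i\<in>UNIV. lateral \<rho> ((v - y) \<bullet> e i))" for v
    by (simp add: separable_def g_def sum.distrib f_def ek)
  have "u y \<le> separable e y g y"
  proof (rule comparison_upper[OF e _ _ _ dg dg' cg, where D="\<Omega> \<inter> ball y \<rho>"])
    fix v
    have m: "max tp tn > 0" using tp_pos by (simp add: less_max_iff_disj)
    have "\<epsilon>\<^sup>2 * pucci1 tp tn (g'' i s) \<le> g i s" for i s
    proof -
      have "g'' i s \<ge> 0" using f0[of i s] lateral_nonneg[of \<rho> s] tp_pos m by (simp add: g''_def)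
      then have "\<epsilon>\<^sup>2 * pucci1 tp tn (g'' i s) = f i s + (tp / max tp tn) * lateral \<rho> s"
        using eps_pos tp_pos m by (simp add: pucci1_nonneg g''_def field_simps)
      also have "(tp / max tp tn) * lateral \<rho> s \<le> 1 * lateral \<rho> s"
        using m by (intro mult_right_mono lateral_nonneg) auto
      finally show ?thesis by (simp add: g_def)
    qed
    then show "\<epsilon>\<^sup>2 * (\<Sum>i\<in>UNIV. pucci1 tp tn (g'' i ((v - y) \<bullet> e i))) \<le> separable e y g v"
      unfolding separable_def sum_distrib_left by (intro sum_mono)
  next
    fix v assume v: "v \<in> frontier (\<Omega> \<inter> ball y \<rho>)"
    note fr = frontier_Int_ball[OF open_dom v]
    have "u v \<le> 1"
      using fr boundary_u u_le_1 by fastforce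
    moreover have "1 \<le> separable e y g v"
    proof (cases "dist y v = \<rho>")
      case True
      then show ?thesis using lateral_sum_ge_1[OF e True] assms unfolding sep
        by (simp add: add_increasing)
    next
      case False
      then have "v \<in> frontier \<Omega>" "dist y v < \<rho>" using fr by auto
      from bd[OF this] show ?thesis unfolding sep
        by (simp add: add_increasing2 sum_nonneg lateral_nonneg)
    qed
    ultimately show "u v \<le> separable e y g v" by linarith
  qed (use open_dom assms in auto)
  then show ?thesis
    unfolding sep using lateral_0[of \<rho>] by simp
qed

text \<open>The exponential has to stay below 1 on the sphere as well as on the frontier: on the
  sphere the lateral sum subtracts at least 1, which brings the barrier below 0 and hence below
  u.\<close>

lemma lower_barrier:
  fixes n :: "real^'n"
  assumes "y \<in> \<Omega>" "0 < \<rho>" "norm n = 1"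
    and bd: "\<And>v. v \<in> closure \<Omega> \<Longrightarrow> dist y v \<le> \<rho> \<Longrightarrow> exp (b - ((v - y) \<bullet> n) / (\<epsilon> * sqrt tp)) \<le> 1"
  shows "exp b - CARD('n) / cosh (decay_rate tp tn CARD('n) * \<rho> / \<epsilon>) \<le> u y"
proof -
  define k :: 'n where "k = undefined"
  obtain e where e: "orthonormal_family e" and ek: "e k = n"
    using ex_orthonormal_family[OF assms(3)] by blast
  define f where "f i s = (if i = k then exp (b - s / (\<epsilon> * sqrt tp)) else 0)" for i s
  define g where "g i s = f i s - lateral \<rho> s" for i s
  define g' where "g' i s = - f i s / (\<epsilon> * sqrt tp) - lateral' \<rho> s" for i s
  define g'' where "g'' i s = f i s / (\<epsilon>\<^sup>2 * tp) - lateral \<rho> s / (max tp tn * \<epsilon>\<^sup>2)" for i s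
  have f0: "f i s \<ge> 0" for i s by (simp add: f_def)
  have df: "(f i has_real_derivative - f i s / (\<epsilon> * sqrt tp)) (at s)" for i s
    unfolding f_def using eps_pos tp_pos by (auto intro!: derivative_eq_intros)
  have cf: "continuous_on UNIV (f i)" for i
    unfolding f_def using eps_pos tp_pos by (cases "i = k") (auto intro!: continuous_intros)
  have eq: "\<epsilon>\<^sup>2 * tp = (\<epsilon> * sqrt tp) * (\<epsilon> * sqrt tp)"
    using tp_pos by (simp add: power2_eq_square)
  have dg: "(g i has_real_derivative g' i s) (at s)" for i s
    unfolding g_def g'_def by (intro DERIV_diff df lateral_deriv)
  have dg': "(g' i has_real_derivative g'' i s) (at s)" for i s
    unfolding g'_def g''_def eq
    by (intro DERIV_diff lateral_deriv)
      (rule DERIV_cong[OF DERIV_cdivide[OF DERIV_minus[OF df]]], simp)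
  have cg: "continuous_on UNIV (g'' i)" for i
    unfolding g''_def using eps_pos tp_pos
    by (intro continuous_intros cf lateral_continuous) (auto simp: max_def)
  have sep: "separable e y g v = exp (b - ((v - y) \<bullet> n) / (\<epsilon> * sqrt tp)) -
      (\<Sum>i\<in>UNIV. lateral \<rho> ((v - y) \<bullet> e i))" for v
    by (simp add: separable_def g_def sum_subtractf f_def ek)
  have "separable e y g y \<le> u y"
  proof (rule comparison_lower[OF e _ _ _ dg dg' cg, where D="\<Omega> \<inter> ball y \<rho>"])
    fix v
    have m: "max tp tn > 0" using tp_pos by (simp add: less_max_iff_disj)
    have "g i s \<le> \<epsilon>\<^sup>2 * pucci1 tp tn (g'' i s)" for i s
    proof -
      \<comment> \<open>An identity: the exponential solves the equation with weight
        \<open>tp\<close>, and the lateral profile solves it with weight \<open>max tp tn\<close>,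
        the one that \<open>pucci1_diff_ge\<close> charges.\<close>
      have "g i s = \<epsilon>\<^sup>2 * (tp * (f i s / (\<epsilon>\<^sup>2 * tp)) - max tp tn * (lateral \<rho> s / (max tp tn * \<epsilon>\<^sup>2)))"
        using eps_pos tp_pos m by (simp add: g_def field_simps)
      also have "\<dots> \<le> \<epsilon>\<^sup>2 * pucci1 tp tn (g'' i s)"
        unfolding g''_def using f0[of i s] lateral_nonneg[of \<rho> s] tp_pos tn_pos m
        by (intro mult_left_mono pucci1_diff_ge) auto
      finally show ?thesis .
    qed
    then show "separable e y g v \<le> \<epsilon>\<^sup>2 * (\<Sum>i\<in>UNIV. pucci1 tp tn (g'' i ((v - y) \<bullet> e i)))"
      unfolding separable_def sum_distrib_left by (intro sum_mono)
  next
    fix v assume v: "v \<in> frontier (\<Omega> \<inter> ball y \<rho>)"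
    note fr = frontier_Int_ball[OF open_dom v]
    then have "v \<in> closure \<Omega>" using closure_subset by (auto simp: frontier_def)
    from bd[OF this fr(1)] have ex: "exp (b - ((v - y) \<bullet> n) / (\<epsilon> * sqrt tp)) \<le> 1" .
    show "separable e y g v \<le> u v"
    proof (cases "v \<in> frontier \<Omega>")
      case True
      have "0 \<le> (\<Sum>i\<in>UNIV. lateral \<rho> ((v - y) \<bullet> e i))" by (simp add: sum_nonneg lateral_nonneg)
      then show ?thesis unfolding sep boundary_u[OF True] using ex by linarith
    next
      case False
      then have "v \<in> \<Omega>" "dist y v = \<rho>" using fr by auto
      then show ?thesis
        using lateral_sum_ge_1[OF e \<open>dist y v = \<rho>\<close>] ex u_nonneg[of v] unfolding sep by linarith
    qed
  qed (use open_dom assms in auto)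
  then show ?thesis
    unfolding sep using lateral_0[of \<rho>] by simp
qed

text \<open>With a = 0 only the lateral barrier is left. The factor 2 comes from cosh t \<ge> exp t
  / 2.\<close>

lemma u_decay:
  assumes "0 < d" "ball y d \<subseteq> \<Omega>"
  shows "u y \<le> 2 * CARD('n) * exp (- (decay_rate tp tn CARD('n) * d / \<epsilon>))"
proof -
  have "y \<in> \<Omega>" using assms by (auto simp: subset_iff)
  have "v \<notin> frontier \<Omega>" if "dist y v < d" for v
    using that assms open_dom by (auto simp: frontier_def interior_open subset_iff)
  then have "u y \<le> 0 * exp 0 + CARD('n) / cosh (decay_rate tp tn CARD('n) * d / \<epsilon>)"
    using upper_barrier[OF \<open>y \<in> \<Omega>\<close> assms(1), of "axis undefined 1" 0 0] by (auto simp: norm_Basis)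
  also have "0 * exp 0 + CARD('n) / cosh (decay_rate tp tn CARD('n) * d / \<epsilon>) \<le> CARD('n) / (exp (decay_rate tp tn CARD('n) * d / \<epsilon>) / 2)"
    unfolding cosh_def by (simp, intro frac_le) auto
  finally show ?thesis by (simp add: exp_minus field_simps)
qed

end

section \<open>Geometry near the touching point\<close>

text \<open>The remainder is uniform in the base point y because the barriers will be centred at
  points that move with \<epsilon>. The gradient is Lipschitz on a compact ball, with constant N^2
  times a bound for the Hessian entries.\<close>

lemma C2_taylor_ball:
  fixes \<psi> :: "real^'n \<Rightarrow> real"
  assumes C2: "C2_with U \<psi> grad hess" and "z \<in> U"
  obtains r C where "r > 0" "C \<ge> 0" "cball z r \<subseteq> U"
    "\<And>v y. v \<in> cball z r \<Longrightarrow> y \<in> cball z r \<Longrightarrow> \<bar>\<psi> v - \<psi> y - grad y \<bullet> (v - y)\<bar> \<le> C * (norm (v - y))\<^sup>2"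
proof -
  have U: "open U" and d\<psi>: "\<And>y. y \<in> U \<Longrightarrow> (\<psi> has_derivative (\<lambda>v. grad y \<bullet> v)) (at y)"
    and dg: "\<And>y. y \<in> U \<Longrightarrow> (grad has_derivative (\<lambda>v. hess y *v v)) (at y)"
    and ch: "continuous_on U hess"
    using C2 by (auto simp: C2_with_def)
  obtain r where r: "r > 0" "cball z r \<subseteq> U"
    using U \<open>z \<in> U\<close> open_contains_cball by blast
  have "compact (hess ` cball z r)"
    by (intro compact_continuous_image continuous_on_subset[OF ch] r compact_cball)
  then obtain K where K: "\<And>y. y \<in> cball z r \<Longrightarrow> norm (hess y) \<le> K"
    using compact_imp_bounded[of "hess ` cball z r"] unfolding bounded_iff by (metis imageI)
  have K0: "K \<ge> 0" using order_trans[OF norm_ge_zero K[of z]] r by auto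
  define C where "C = K * real CARD('n) * real CARD('n)"
  have C: "C \<ge> 0" using K0 by (simp add: C_def)
  have onorm: "onorm (\<lambda>v. hess y *v v) \<le> C" if "y \<in> cball z r" for y
    unfolding C_def
  proof (rule order_trans[OF onorm_le_matrix_component])
    fix i j
    show "\<bar>hess y $ i $ j\<bar> \<le> K"
      using K[OF that] Finite_Cartesian_Product.norm_nth_le[of "hess y" i] Finite_Cartesian_Product.norm_nth_le[of "hess y $ i" j] by simp
  qed simp
  have lip: "norm (grad v - grad y) \<le> C * norm (v - y)" if "v \<in> cball z r" "y \<in> cball z r" for v y
    using that by (intro differentiable_bound[of "cball z r" grad "\<lambda>y v. hess y *v v"])
      (auto intro!: has_derivative_at_withinI[OF dg] onorm simp: subset_iff r(2)[THEN subsetD])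
  have "\<bar>\<psi> v - \<psi> y - grad y \<bullet> (v - y)\<bar> \<le> C * (norm (v - y))\<^sup>2" if vy: "v \<in> cball z r" "y \<in> cball z r" for v y
  proof -
    have seg: "closed_segment y v \<subseteq> cball z r"
      using vy by (intro closed_segment_subset) auto
    \<comment> \<open>Once the linear function is subtracted, the derivative at w is grad w - grad
      y, of norm at most C |v - y| along the segment.\<close>
    have "norm ((\<psi> v - grad y \<bullet> v) - (\<psi> y - grad y \<bullet> y)) \<le> (C * norm (v - y)) * norm (v - y)"
    proof (rule differentiable_bound[of "closed_segment y v" _ "\<lambda>w h. grad w \<bullet> h - grad y \<bullet> h"])
      fix w assume w: "w \<in> closed_segment y v"
      then have "w \<in> U" using seg r by auto
      show "((\<lambda>v. \<psi> v - grad y \<bullet> v) has_derivative (\<lambda>h. grad w \<bullet> h - grad y \<bullet> h)) (at w within closed_segment y v)"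
        by (intro has_derivative_diff has_derivative_at_withinI[OF d\<psi>] \<open>w \<in> U\<close> has_derivative_inner_right has_derivative_ident)
      have "norm (w - y) \<le> norm (v - y)"
        using segment_bound(1)[OF w] by simp
      then have "norm (grad w - grad y) \<le> C * norm (v - y)"
        using lip[of w y] w seg vy C by (meson in_mono mult_left_mono order_trans)
      then show "onorm (\<lambda>h. grad w \<bullet> h - grad y \<bullet> h) \<le> C * norm (v - y)"
        unfolding inner_diff_left[symmetric] using onorm_inner_right[of "\<lambda>h. h" "grad w - grad y"]
        by (intro onorm_le) (metis Cauchy_Schwarz_ineq2 mult_right_mono norm_ge_zero order_trans real_norm_def)
    qed auto
    then show ?thesis
      by (simp add: inner_diff_right power2_eq_square algebra_simps)
  qed
  with r C show thesis by (rule_tac that[of r C]) auto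
qed

text \<open>The mean value theorem along the ray t h. The derivative of the remainder is the
  differentiability error of the gradient at z, paired with h.\<close>

lemma C2_taylor_second:
  fixes \<psi> :: "real^'n \<Rightarrow> real"
  assumes C2: "C2_with U \<psi> grad hess" and "z \<in> U" and "\<delta> > 0"
  obtains r where "r > 0"
    "\<And>h. norm h < r \<Longrightarrow>
      \<bar>\<psi> (z + h) - \<psi> z - grad z \<bullet> h - (h \<bullet> (hess z *v h)) / 2\<bar> \<le> \<delta> * (norm h)\<^sup>2"
proof -
  have U: "open U" and d\<psi>: "\<And>y. y \<in> U \<Longrightarrow> (\<psi> has_derivative (\<lambda>v. grad y \<bullet> v)) (at y)"
    and dg: "(grad has_derivative (\<lambda>v. hess z *v v)) (at z)"
    using C2 \<open>z \<in> U\<close> by (auto simp: C2_with_def)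
  obtain r1 where r1: "r1 > 0" "ball z r1 \<subseteq> U"
    using U \<open>z \<in> U\<close> open_contains_ball by blast
  obtain r2 where r2: "r2 > 0" "\<And>y. norm (y - z) < r2 \<Longrightarrow>
      norm (grad y - grad z - hess z *v (y - z)) \<le> \<delta> * norm (y - z)"
    using dg \<open>\<delta> > 0\<close> unfolding has_derivative_at_alt by blast
  have "\<bar>\<psi> (z + h) - \<psi> z - grad z \<bullet> h - (h \<bullet> (hess z *v h)) / 2\<bar> \<le> \<delta> * (norm h)\<^sup>2"
    if h: "norm h < min r1 r2" for h
  proof -
    define k where "k t = \<psi> (z + t *\<^sub>R h) - t * (grad z \<bullet> h) - t\<^sup>2 * (h \<bullet> (hess z *v h)) / 2" for t
    define k' where "k' t = (grad (z + t *\<^sub>R h) - grad z - hess z *v (t *\<^sub>R h)) \<bullet> h" for t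
    have tn: "norm (t *\<^sub>R h) \<le> norm h" if "t \<in> {0..1}" for t
      using that mult_right_mono[of t 1 "norm h"] by simp
    have "norm (k 1 - k 0) \<le> (\<delta> * (norm h)\<^sup>2) * norm (1 - 0 :: real)"
    proof (rule differentiable_bound[of "{0..1}" k "\<lambda>t s. s * k' t"])
      fix t :: real assume t: "t \<in> {0..1}"
      have zU: "z + t *\<^sub>R h \<in> U"
        using tn[OF t] h r1(2) by (auto simp: dist_norm)
      have "((\<lambda>t. z + t *\<^sub>R h) has_derivative (\<lambda>s. s *\<^sub>R h)) (at t within {0..1})"
        by (auto intro!: derivative_eq_intros)
      from has_derivative_compose[OF this d\<psi>[OF zU]]
      have "((\<lambda>t. \<psi> (z + t *\<^sub>R h)) has_derivative (\<lambda>s. grad (z + t *\<^sub>R h) \<bullet> (s *\<^sub>R h))) (at t within {0..1})" .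
      then show "(k has_derivative (\<lambda>s. s * k' t)) (at t within {0..1})"
        unfolding k_def k'_def
        by (auto intro!: derivative_eq_intros simp: fun_eq_iff algebra_simps inner_diff_left
            matrix_vector_mult_scaleR inner_commute)
      have "\<bar>k' t\<bar> \<le> norm (grad (z + t *\<^sub>R h) - grad z - hess z *v (t *\<^sub>R h)) * norm h"
        unfolding k'_def by (rule Cauchy_Schwarz_ineq2)
      also have "\<dots> \<le> (\<delta> * norm (t *\<^sub>R h)) * norm h"
        using r2(2)[of "z + t *\<^sub>R h"] tn[OF t] h by (intro mult_right_mono) auto
      also have "\<dots> \<le> (\<delta> * norm h) * norm h"
        using tn[OF t] \<open>\<delta> > 0\<close> by (intro mult_right_mono mult_left_mono) auto
      finally have "\<bar>k' t\<bar> \<le> \<delta> * (norm h)\<^sup>2" by (simp add: power2_eq_square)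
      then show "onorm (\<lambda>s. s * k' t) \<le> \<delta> * (norm h)\<^sup>2"
        by (intro onorm_le) (simp add: abs_mult mult.commute mult_left_mono)
    qed auto
    then show ?thesis by (simp add: k_def algebra_simps)
  qed
  then show thesis using r1 r2 by (rule_tac that[of "min r1 r2"]) auto
qed

text \<open>Along sqrt \<epsilon> a + \<epsilon> b the term of order sqrt \<epsilon> vanishes since
  a is tangential. At order \<epsilon> the linear part of \<psi> sees only b and the quadratic part
  only a.\<close>

lemma C2_parabolic_limit:
  fixes \<psi> :: "real^'n \<Rightarrow> real"
  assumes C2: "C2_with U \<psi> grad hess" and "z \<in> U" and "\<psi> z = 0" and a: "grad z \<bullet> a = 0"
  shows "((\<lambda>\<epsilon>. \<psi> (z + (sqrt \<epsilon> *\<^sub>R a + \<epsilon> *\<^sub>R b)) / \<epsilon>) \<longlongrightarrow> grad z \<bullet> b + (a \<bullet> (hess z *v a)) / 2) (at_right 0)"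
proof -
  define H where "H = hess z"
  define h where "h \<epsilon> = sqrt \<epsilon> *\<^sub>R a + \<epsilon> *\<^sub>R b" for \<epsilon>
  \<comment> \<open>This is h / sqrt \<epsilon>. It converges to a, so everything quadratic in h is
    \<epsilon> times a convergent quantity.\<close>
  define g where "g \<epsilon> = a + sqrt \<epsilon> *\<^sub>R b" for \<epsilon>
  have hg: "h \<epsilon> = sqrt \<epsilon> *\<^sub>R g \<epsilon>" if "\<epsilon> > 0" for \<epsilon>
    using that by (simp add: h_def g_def scaleR_add_right)
  define r where "r \<epsilon> = \<psi> (z + h \<epsilon>) - \<psi> z - grad z \<bullet> h \<epsilon> - (h \<epsilon> \<bullet> (H *v h \<epsilon>)) / 2" for \<epsilon>
  have sq: "((\<lambda>\<epsilon>. sqrt \<epsilon>) \<longlongrightarrow> 0) (at_right 0)"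
    using tendsto_real_sqrt[OF tendsto_ident_at, of 0 "{0<..}"] by simp
  have g: "(g \<longlongrightarrow> a) (at_right 0)"
    unfolding g_def by (rule tendsto_eq_intros sq refl)+ simp
  have h0: "(h \<longlongrightarrow> 0) (at_right 0)"
    unfolding h_def by (rule tendsto_eq_intros sq refl)+ simp
  have r0: "((\<lambda>\<epsilon>. r \<epsilon> / \<epsilon>) \<longlongrightarrow> 0) (at_right 0)"
  proof (rule tendstoI)
    fix e :: real assume e: "e > 0"
    \<comment> \<open>Eventually |g \<epsilon>|^2 < A, so the Taylor error divided by \<epsilon> is
      at most \<delta> A = e / 2.\<close>
    define A where "A = (norm a)\<^sup>2 + 1"
    define \<delta> where "\<delta> = e / (2 * A)"
    have a1: "A > 0" by (simp add: A_def add_nonneg_pos)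
    then have \<delta>: "\<delta> > 0" using e by (simp add: \<delta>_def)
    obtain q where q: "q > 0" "\<And>h. norm h < q \<Longrightarrow>
        \<bar>\<psi> (z + h) - \<psi> z - grad z \<bullet> h - (h \<bullet> (H *v h)) / 2\<bar> \<le> \<delta> * (norm h)\<^sup>2"
      using C2_taylor_second[OF C2 \<open>z \<in> U\<close> \<delta>] unfolding H_def by blast
    have "((\<lambda>\<epsilon>. (norm (g \<epsilon>))\<^sup>2) \<longlongrightarrow> (norm a)\<^sup>2) (at_right 0)"
      by (intro tendsto_intros g)
    then have "\<forall>\<^sub>F \<epsilon> in at_right 0. (norm (g \<epsilon>))\<^sup>2 < A"
      by (rule order_tendstoD) (simp add: A_def)
    moreover have "\<forall>\<^sub>F \<epsilon> in at_right 0. norm (h \<epsilon>) < q"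
      using order_tendstoD(2)[OF tendsto_norm_zero[OF h0] q(1)] .
    ultimately show "\<forall>\<^sub>F \<epsilon> in at_right 0. dist (r \<epsilon> / \<epsilon>) 0 < e"
      using eventually_at_right_less[of "0::real"]
    proof eventually_elim
      case (elim \<epsilon>)
      then have "\<bar>r \<epsilon>\<bar> \<le> \<delta> * (norm (h \<epsilon>))\<^sup>2" using q(2) by (simp add: r_def)
      also have "(norm (h \<epsilon>))\<^sup>2 = \<epsilon> * (norm (g \<epsilon>))\<^sup>2"
        using elim by (simp add: hg power_mult_distrib)
      finally have "\<bar>r \<epsilon> / \<epsilon>\<bar> \<le> \<delta> * (norm (g \<epsilon>))\<^sup>2"
        using elim by (simp add: field_simps)
      also have "\<dots> \<le> \<delta> * A" using elim \<delta> by (intro mult_left_mono) auto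
      also have "\<dots> = e / 2" using a1 by (simp add: \<delta>_def)
      finally have "\<bar>r \<epsilon> / \<epsilon>\<bar> \<le> e / 2" .
      then show ?case using e by (simp only: dist_real_def diff_0_right)
    qed
  qed
  have "((\<lambda>\<epsilon>. grad z \<bullet> b + (g \<epsilon> \<bullet> (H *v g \<epsilon>)) / 2 + r \<epsilon> / \<epsilon>) \<longlongrightarrow>
      grad z \<bullet> b + (a \<bullet> (H *v a)) / 2 + 0) (at_right 0)"
    by (intro tendsto_intros r0 g bounded_linear.tendsto[OF matrix_vector_mul_bounded_linear]) simp
  moreover have "\<forall>\<^sub>F \<epsilon> in at_right 0. grad z \<bullet> b + (g \<epsilon> \<bullet> (H *v g \<epsilon>)) / 2 + r \<epsilon> / \<epsilon> =
      \<psi> (z + h \<epsilon>) / \<epsilon>"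
    using eventually_at_right_less[of "0::real"]
  proof eventually_elim
    case (elim \<epsilon>)
    have "h \<epsilon> \<bullet> (H *v h \<epsilon>) = \<epsilon> * (g \<epsilon> \<bullet> (H *v g \<epsilon>))"
      using elim by (simp add: hg matrix_vector_mult_scaleR)
    moreover have "grad z \<bullet> h \<epsilon> = \<epsilon> * (grad z \<bullet> b)"
      using a by (simp add: h_def inner_add_right)
    ultimately show ?case
      using elim \<open>\<psi> z = 0\<close> by (simp add: r_def field_simps)
  qed
  ultimately show ?thesis
    unfolding h_def H_def by (simp add: tendsto_cong)
qed

text \<open>The curvatures are indexed by the coordinate type with one distinguished index
  \<open>k\<close> for the inward normal, so sums and products over \<open>-{k}\<close> run over the
  principal directions. Curvature enters through the tangential block of the Hessian of \<psi>,
  which is diagonal in this basis.\<close>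

locale touching_ball =
  fixes \<Omega> U :: "(real^'n) set" and x z :: "real^'n" and R :: real
    and \<psi> :: "real^'n \<Rightarrow> real" and grad :: "real^'n \<Rightarrow> real^'n" and hess :: "real^'n \<Rightarrow> real^'n^'n"
    and e :: "'n \<Rightarrow> real^'n" and k :: 'n and kap :: "'n \<Rightarrow> real"
  assumes open_dom: "open \<Omega>" and R_pos: "0 < R" and ball_sub: "ball x R \<subseteq> \<Omega>"
    and touch: "cball x R \<inter> (UNIV - \<Omega>) = {z}" and z_frontier: "z \<in> frontier \<Omega>"
    and zU: "z \<in> U" and C2: "C2_with U \<psi> grad hess" and grad_nz: "\<And>y. y \<in> U \<Longrightarrow> grad y \<noteq> 0"
    and psi_pos: "\<Omega> \<inter> U = {y\<in>U. \<psi> y > 0}" and psi_zero: "frontier \<Omega> \<inter> U = {y\<in>U. \<psi> y = 0}"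
    and e: "orthonormal_family e" and ek: "e k = grad z /\<^sub>R norm (grad z)"
    and weingarten: "\<And>i j. i \<noteq> k \<Longrightarrow> j \<noteq> k \<Longrightarrow>
      e j \<bullet> (hess z *v e i) = (if i = j then - (norm (grad z) * kap i) else 0)"
    and curvature: "\<And>i. i \<noteq> k \<Longrightarrow> kap i < 1 / R"
begin

lemma psi_z: "\<psi> z = 0"
  using psi_zero z_frontier zU by blast

lemma grad_z: "norm (grad z) > 0"
  using grad_nz[OF zU] by simp

lemma norm_e: "norm (e i) = 1"
  using e by (simp add: orthonormal_family_def norm_eq_1)

lemma grad_z_eq: "grad z = norm (grad z) *\<^sub>R e k"
  using grad_z by (simp add: ek)

lemma local_bounds:
  obtains r C where "r > 0" "C \<ge> 0" "cball z r \<subseteq> U"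
    "\<And>v y. v \<in> cball z r \<Longrightarrow> y \<in> cball z r \<Longrightarrow> \<bar>\<psi> v - \<psi> y - grad y \<bullet> (v - y)\<bar> \<le> C * (norm (v - y))\<^sup>2"
    "\<And>y. y \<in> cball z r \<Longrightarrow> norm (grad z) / 2 \<le> norm (grad y) \<and> norm (grad y) \<le> 2 * norm (grad z)"
proof -
  obtain r1 C where r1: "r1 > 0" "C \<ge> 0" "cball z r1 \<subseteq> U"
    and T: "\<And>v y. v \<in> cball z r1 \<Longrightarrow> y \<in> cball z r1 \<Longrightarrow> \<bar>\<psi> v - \<psi> y - grad y \<bullet> (v - y)\<bar> \<le> C * (norm (v - y))\<^sup>2"
    using C2_taylor_ball[OF C2 zU] by blast
  have "(grad has_derivative (\<lambda>v. hess z *v v)) (at z)"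
    using C2 zU by (auto simp: C2_with_def)
  then have "isCont grad z"
    by (rule has_derivative_continuous)
  then obtain r2 where r2: "r2 > 0" "\<And>y. dist y z < r2 \<Longrightarrow> dist (grad y) (grad z) < norm (grad z) / 2"
    using grad_z unfolding continuous_at_eps_delta by (meson half_gt_zero)
  define r where "r = min r1 (r2 / 2)"
  have r: "r > 0" "cball z r \<subseteq> cball z r1" using r1 r2 by (auto simp: r_def)
  have "norm (grad z) / 2 \<le> norm (grad y) \<and> norm (grad y) \<le> 2 * norm (grad z)" if "y \<in> cball z r" for y
  proof -
    have "dist y z < r2" using that r2 by (auto simp: r_def dist_commute)
    from r2(2)[OF this] show ?thesis
      using norm_triangle_ineq2[of "grad y" "grad z"] norm_triangle_ineq2[of "grad z" "grad y"]
      by (simp add: dist_norm norm_minus_commute)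
  qed
  with r r1 T show thesis
    by (intro that[of r C]) blast+
qed

lemma norm_xz: "norm (x - z) = R"
proof -
  have "z \<in> cball x R" "z \<notin> \<Omega>" using touch by auto
  moreover have "\<not> dist x z < R"
    using \<open>z \<notin> \<Omega>\<close> ball_sub mem_ball by blast
  ultimately have "dist x z = R" by simp
  then show ?thesis by (simp add: dist_norm)
qed

text \<open>A small step from z along v with v \<bullet> w > 0 enters the ball, where \<psi> > 0, so
  \<psi> cannot decrease to first order along v. Hence the open half space of w = x - z lies in the
  closed half space of grad z, which forces the two vectors to be parallel.\<close>

lemma x_eq: "x = z + R *\<^sub>R e k"
proof -
  define w where "w = x - z"
  define g where "g = grad z"
  have w: "norm w = R" "w \<noteq> 0" using norm_xz R_pos by (auto simp: w_def)
  have g: "g \<noteq> 0" "norm g > 0" using grad_z by (auto simp: g_def)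
  obtain r C where r: "r > 0" "C \<ge> 0" "cball z r \<subseteq> U"
    and T: "\<And>v y. v \<in> cball z r \<Longrightarrow> y \<in> cball z r \<Longrightarrow> \<bar>\<psi> v - \<psi> y - grad y \<bullet> (v - y)\<bar> \<le> C * (norm (v - y))\<^sup>2"
    using local_bounds by metis
  have key: "0 \<le> g \<bullet> v" if vw: "v \<bullet> w > 0" for v
  proof (rule ccontr)
    assume "\<not> 0 \<le> g \<bullet> v"
    then have gv: "0 < - (g \<bullet> v)" by simp
    have "((\<lambda>t. t * norm v) \<longlongrightarrow> 0) (at_right 0)" "((\<lambda>t. t * (norm v)\<^sup>2) \<longlongrightarrow> 0) (at_right 0)"
      "((\<lambda>t. C * (t * (norm v)\<^sup>2)) \<longlongrightarrow> 0) (at_right 0)"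
      by (rule tendsto_eq_intros refl | simp)+
    then have "\<forall>\<^sub>F t in at_right 0. t * norm v < r" "\<forall>\<^sub>F t in at_right 0. t * (norm v)\<^sup>2 < 2 * (v \<bullet> w)"
      "\<forall>\<^sub>F t in at_right 0. C * (t * (norm v)\<^sup>2) < - (g \<bullet> v)"
      using r vw gv by (auto intro: order_tendstoD(2))
    then have "\<forall>\<^sub>F t in at_right (0::real). False"
      using eventually_at_right_less[of "0::real"]
    proof eventually_elim
      case (elim t)
      have zt: "z + t *\<^sub>R v \<in> cball z r" using elim r by (simp add: dist_norm)
      have "(norm (x - (z + t *\<^sub>R v)))\<^sup>2 = (norm (w - t *\<^sub>R v))\<^sup>2" by (simp add: w_def algebra_simps)
      also have "\<dots> = R\<^sup>2 - t * (2 * (v \<bullet> w) - t * (norm v)\<^sup>2)"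
        unfolding w(1)[symmetric] by (simp add: power2_norm_eq_inner inner_diff_left inner_diff_right inner_commute algebra_simps)
      also have "\<dots> < R\<^sup>2" using elim by simp
      finally have "norm (x - (z + t *\<^sub>R v)) < R" using R_pos power_less_imp_less_base[of _ 2 R] by auto
      then have "z + t *\<^sub>R v \<in> \<Omega>" using ball_sub by (auto simp: dist_norm)
      then have "\<psi> (z + t *\<^sub>R v) > 0" using psi_pos zt r by auto
      moreover have "\<psi> (z + t *\<^sub>R v) \<le> t * (g \<bullet> v) + C * (t * norm v)\<^sup>2"
        using T[OF zt, of z] r elim by (simp add: psi_z g_def)
      moreover have "t * (g \<bullet> v) + C * (t * norm v)\<^sup>2 = t * (g \<bullet> v + C * (t * (norm v)\<^sup>2))"
        by (simp add: power2_eq_square algebra_simps)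
      moreover have "t * (g \<bullet> v + C * (t * (norm v)\<^sup>2)) < 0"
        using elim by (intro mult_pos_neg) auto
      ultimately show ?case by linarith
    qed
    then show False by simp
  qed
  have "g \<bullet> w = norm g * norm w"
  proof (rule ccontr)
    assume "\<not> ?thesis"
    then have lt: "g \<bullet> w < norm g * norm w"
      using norm_cauchy_schwarz[of g w] by linarith
    \<comment> \<open>The difference of the two unit vectors: if the Cauchy-Schwarz inequality were
      strict, v would point into the ball and yet make \<psi> decrease.\<close>
    define v where "v = w /\<^sub>R norm w - g /\<^sub>R norm g"
    have ww: "w \<bullet> w = norm w * norm w" and gg: "g \<bullet> g = norm g * norm g"
      by (simp_all add: dot_square_norm power2_eq_square)
    have "v \<bullet> w = (w \<bullet> w) / norm w - (g \<bullet> w) / norm g"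
      by (simp add: v_def inner_diff_left divide_inverse mult.commute)
    then have "v \<bullet> w = norm w - (g \<bullet> w) / norm g"
      using w by (simp add: ww)
    moreover have "(g \<bullet> w) / norm g < norm w" using lt g by (simp add: divide_less_eq mult.commute)
    ultimately have "v \<bullet> w > 0" by linarith
    have "g \<bullet> v = (g \<bullet> w) / norm w - (g \<bullet> g) / norm g"
      by (simp add: v_def inner_diff_right divide_inverse mult.commute)
    then have "g \<bullet> v = (g \<bullet> w) / norm w - norm g"
      using g by (simp add: gg)
    moreover have "(g \<bullet> w) / norm w < norm g" using lt w R_pos by (simp add: divide_less_eq)
    ultimately have "g \<bullet> v < 0" by linarith
    with key[OF \<open>v \<bullet> w > 0\<close>] show False by linarith
  qed
  then have "norm g *\<^sub>R w = norm w *\<^sub>R g"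
    by (simp add: norm_cauchy_schwarz_eq)
  then have "inverse (norm g) *\<^sub>R (norm g *\<^sub>R w) = inverse (norm g) *\<^sub>R (R *\<^sub>R g)"
    by (simp add: w)
  then have "w = R *\<^sub>R e k"
    using g by (simp add: ek g_def mult.commute)
  then show ?thesis by (simp add: w_def algebra_simps)
qed

lemma inner_e: "e i \<bullet> e j = (if i = j then 1 else 0)"
  using e by (simp add: orthonormal_family_def)

lemma mem_ball_iff: "y \<in> ball x R \<longleftrightarrow> (norm (y - z))\<^sup>2 < 2 * R * ((y - z) \<bullet> e k)"
proof -
  have "(norm (x - y))\<^sup>2 = (norm ((y - z) - R *\<^sub>R e k))\<^sup>2"
    by (subst x_eq) (simp add: norm_minus_commute algebra_simps)
  also have "\<dots> = (norm h)\<^sup>2 - 2 * R * (h \<bullet> e k) + R\<^sup>2" if "h = y - z" for h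
    unfolding that[symmetric] power2_norm_eq_inner inner_diff_left inner_diff_right
    by (simp add: inner_e inner_commute power2_eq_square)
  finally have eq: "(norm (x - y))\<^sup>2 = (norm (y - z))\<^sup>2 - 2 * R * ((y - z) \<bullet> e k) + R\<^sup>2"
    by simp
  have "y \<in> ball x R \<longleftrightarrow> (norm (x - y))\<^sup>2 < R\<^sup>2"
    using R_pos by (auto simp: dist_norm power_strict_mono intro: power_less_imp_less_base)
  then show ?thesis by (simp add: eq)
qed

lemma hess_tangential:
  fixes c :: "'n \<Rightarrow> real"
  defines "a \<equiv> \<Sum>i\<in>-{k}. c i *\<^sub>R e i"
  shows "a \<bullet> (hess z *v a) = - norm (grad z) * (\<Sum>i\<in>-{k}. kap i * (c i)\<^sup>2)"
proof -
  have Ha: "hess z *v a = (\<Sum>i\<in>-{k}. c i *\<^sub>R (hess z *v e i))"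
    unfolding a_def by (simp add: linear_sum[OF matrix_vector_mul_linear] matrix_vector_mult_scaleR)
  have aw: "a \<bullet> w = (\<Sum>j\<in>-{k}. c j * (e j \<bullet> w))" for w
    by (simp add: a_def inner_sum_left)
  have "a \<bullet> (hess z *v a) = (\<Sum>j\<in>-{k}. \<Sum>i\<in>-{k}. c j * (c i * (e j \<bullet> (hess z *v e i))))"
    unfolding aw Ha by (simp add: inner_sum_right sum_distrib_left)
  also have "\<dots> = (\<Sum>j\<in>-{k}. \<Sum>i\<in>-{k}. if i = j then - (norm (grad z) * (kap j * (c j)\<^sup>2)) else 0)"
    by (intro sum.cong refl) (simp add: weingarten power2_eq_square)
  also have "\<dots> = (\<Sum>j\<in>-{k}. - (norm (grad z) * (kap j * (c j)\<^sup>2)))"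
    by (intro sum.cong refl) (simp add: sum.delta)
  finally show ?thesis by (simp add: sum_distrib_left sum_negf)
qed

text \<open>The distance to the boundary at \<open>z + stretch \<epsilon> \<eta>\<close> is \<open>\<epsilon> * tau \<eta>\<close> up to \<open>o(\<epsilon>)\<close>.\<close>

definition tau :: "real^'n \<Rightarrow> real" where
  "tau \<eta> = \<eta> $ k - (\<Sum>i\<in>-{k}. kap i * (\<eta> $ i)\<^sup>2) / 2"

definition stretch :: "real \<Rightarrow> real^'n \<Rightarrow> real^'n" where
  "stretch \<epsilon> \<eta> = (\<Sum>i\<in>UNIV. ((if i = k then \<epsilon> else sqrt \<epsilon>) * \<eta> $ i) *\<^sub>R e i)"

lemma stretch_split:
  "stretch \<epsilon> \<eta> = sqrt \<epsilon> *\<^sub>R (\<Sum>i\<in>-{k}. \<eta> $ i *\<^sub>R e i) + \<epsilon> *\<^sub>R (\<eta> $ k *\<^sub>R e k)"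
proof -
  have "stretch \<epsilon> \<eta> = (\<epsilon> * \<eta> $ k) *\<^sub>R e k + (\<Sum>i\<in>UNIV - {k}. ((if i = k then \<epsilon> else sqrt \<epsilon>) * \<eta> $ i) *\<^sub>R e i)"
    unfolding stretch_def by (subst sum.remove[of UNIV k]) auto
  also have "(\<Sum>i\<in>UNIV - {k}. ((if i = k then \<epsilon> else sqrt \<epsilon>) * \<eta> $ i) *\<^sub>R e i) =
      (\<Sum>i\<in>-{k}. (sqrt \<epsilon> * \<eta> $ i) *\<^sub>R e i)"
    by (intro sum.cong) auto
  finally show ?thesis by (simp add: scaleR_sum_right add.commute)
qed

lemma stretch_inner: "stretch \<epsilon> \<eta> \<bullet> e i = (if i = k then \<epsilon> else sqrt \<epsilon>) * \<eta> $ i"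
  unfolding stretch_def inner_sum_left
  by (simp add: inner_e if_distrib[of "\<lambda>t. _ * t"] cong: if_cong)

lemma tangential_inner_k: "e k \<bullet> (\<Sum>i\<in>-{k}. c i *\<^sub>R e i) = 0"
  by (auto simp: inner_sum_right inner_e intro!: sum.neutral)

lemma psi_limit: "((\<lambda>\<epsilon>. \<psi> (z + stretch \<epsilon> \<eta>) / \<epsilon>) \<longlongrightarrow> norm (grad z) * tau \<eta>) (at_right 0)"
proof -
  have "grad z \<bullet> (\<Sum>i\<in>-{k}. \<eta> $ i *\<^sub>R e i) = 0"
    by (subst grad_z_eq) (simp add: tangential_inner_k)
  from C2_parabolic_limit[OF C2 zU psi_z this, of "\<eta> $ k *\<^sub>R e k"]
  have "((\<lambda>\<epsilon>. \<psi> (z + stretch \<epsilon> \<eta>) / \<epsilon>) \<longlongrightarrow> grad z \<bullet> (\<eta> $ k *\<^sub>R e k) +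
      (- norm (grad z) * (\<Sum>i\<in>-{k}. kap i * (\<eta> $ i)\<^sup>2)) / 2) (at_right 0)"
    unfolding stretch_split hess_tangential .
  moreover have g: "grad z \<bullet> (\<eta> $ k *\<^sub>R e k) = norm (grad z) * \<eta> $ k"
    by (subst grad_z_eq) (simp add: inner_e)
  have "grad z \<bullet> (\<eta> $ k *\<^sub>R e k) + (- norm (grad z) * (\<Sum>i\<in>-{k}. kap i * (\<eta> $ i)\<^sup>2)) / 2 =
      norm (grad z) * tau \<eta>"
    unfolding g by (simp add: tau_def right_diff_distrib)
  ultimately show ?thesis by simp
qed

lemma curvature_gap: obtains \<gamma> where "0 < \<gamma>" "\<gamma> \<le> 1" "\<And>i. i \<noteq> k \<Longrightarrow> kap i \<le> (1 - \<gamma>) / R"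
proof -
  \<comment> \<open>The inserted 1 keeps the set nonempty and gives \<gamma> \<le> 1, so that 1 -
    \<gamma> is nonnegative where inequalities are multiplied by it.\<close>
  define \<gamma> where "\<gamma> = Min (insert 1 ((\<lambda>i. 1 - R * kap i) ` (-{k})))"
  have fin: "finite (insert 1 ((\<lambda>i. 1 - R * kap i) ` (-{k})))" by simp
  have "0 < \<gamma>" unfolding \<gamma>_def
    using curvature R_pos by (subst Min_gr_iff[OF fin]) (auto simp: field_simps)
  moreover have "\<gamma> \<le> 1" unfolding \<gamma>_def by (rule Min_le[OF fin]) simp
  moreover have "kap i \<le> (1 - \<gamma>) / R" if "i \<noteq> k" for i
  proof -
    have "\<gamma> \<le> 1 - R * kap i" unfolding \<gamma>_def by (rule Min_le[OF fin]) (use that in auto)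
    then show ?thesis using R_pos by (simp add: field_simps)
  qed
  ultimately show thesis by (rule that)
qed

text \<open>Let t be the height over the tangent plane and G = |grad z|. In the ball |y - z|^2 < 2 R
  t, so the tangential Hessian term is at least -(1 - \<gamma>) G t, while the linear term is G t.
  The curvature gap leaves \<gamma> G t; the mixed Hessian terms and the Taylor remainder take at
  most a quarter of G \<gamma> t each. This linear bound is what makes decay in the normal
  coordinate possible on the whole ball.\<close>

lemma psi_lower_bound:
  obtains c r where "c > 0" "r > 0"
    "\<And>y. y \<in> ball x R \<Longrightarrow> norm (y - z) < r \<Longrightarrow> c * ((y - z) \<bullet> e k) \<le> \<psi> y"
proof -
  obtain \<gamma> where \<gamma>: "0 < \<gamma>" "\<gamma> \<le> 1" "\<And>i. i \<noteq> k \<Longrightarrow> kap i \<le> (1 - \<gamma>) / R"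
    using curvature_gap by blast
  define G where "G = norm (grad z)"
  have G: "G > 0" using grad_z by (simp add: G_def)
  define H where "H = hess z"
  obtain M where M: "M > 0" "\<And>v. norm (H *v v) \<le> norm v * M"
    using bounded_linear.pos_bounded[OF matrix_vector_mul_bounded_linear[of H]] by blast
  \<comment> \<open>Together with |h|^2 < 2 R t this makes the remainder at most G \<gamma> t /
    4.\<close>
  define \<delta> where "\<delta> = G * \<gamma> / (8 * R)"
  have \<delta>: "\<delta> > 0" using G \<gamma> R_pos by (simp add: \<delta>_def)
  obtain r1 where r1: "r1 > 0" "\<And>h. norm h < r1 \<Longrightarrow>
      \<bar>\<psi> (z + h) - \<psi> z - grad z \<bullet> h - (h \<bullet> (H *v h)) / 2\<bar> \<le> \<delta> * (norm h)\<^sup>2"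
    using C2_taylor_second[OF C2 zU \<delta>] unfolding H_def by blast
  \<comment> \<open>Makes |h| M at most G \<gamma> / 6, below the G \<gamma> / 4 allowed for each of
    the two mixed terms.\<close>
  define r where "r = min r1 (G * \<gamma> / (6 * M))"
  have r: "r > 0" using r1 G \<gamma> M by (simp add: r_def)
  have "(G * \<gamma> / 2) * ((y - z) \<bullet> e k) \<le> \<psi> y" if y: "y \<in> ball x R" "norm (y - z) < r" for y
  proof -
    define h where "h = y - z"
    define t where "t = h \<bullet> e k"
    define a where "a = (\<Sum>i\<in>-{k}. (h \<bullet> e i) *\<^sub>R e i)"
    have hr: "norm h < r" and hR: "(norm h)\<^sup>2 < 2 * R * t"
      using y mem_ball_iff by (auto simp: h_def t_def)
    have t: "t > 0"
      using hR R_pos by (smt (verit) zero_le_power2 zero_less_mult_iff)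
    have ha: "h = a + t *\<^sub>R e k"
      using orthonormal_family_expansion[OF e, of h] sum.remove[of UNIV k "\<lambda>i. (h \<bullet> e i) *\<^sub>R e i"]
      by (simp add: a_def t_def Compl_eq_Diff_UNIV add.commute)
    have nh: "(norm h)\<^sup>2 = t\<^sup>2 + (\<Sum>i\<in>-{k}. (h \<bullet> e i)\<^sup>2)"
      unfolding orthonormal_family_norm[OF e] using sum.remove[of UNIV k "\<lambda>i. (h \<bullet> e i)\<^sup>2"]
      by (simp add: t_def Compl_eq_Diff_UNIV)
    have aHa: "a \<bullet> (H *v a) = - G * (\<Sum>i\<in>-{k}. kap i * (h \<bullet> e i)\<^sup>2)"
      unfolding a_def H_def G_def by (rule hess_tangential)
    have "(\<Sum>i\<in>-{k}. kap i * (h \<bullet> e i)\<^sup>2) \<le> (\<Sum>i\<in>-{k}. (1 - \<gamma>) / R * (h \<bullet> e i)\<^sup>2)"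
      by (intro sum_mono mult_right_mono \<gamma>) auto
    also have "\<dots> \<le> (1 - \<gamma>) / R * (2 * R * t)"
      unfolding sum_distrib_left[symmetric] using hR \<gamma> R_pos
      using nh zero_le_power2[of t] by (intro mult_left_mono) (linarith | simp)+
    also have "\<dots> = 2 * (1 - \<gamma>) * t" using R_pos by simp
    finally have 1: "a \<bullet> (H *v a) \<ge> - G * (2 * (1 - \<gamma>) * t)"
      unfolding aHa using G by simp
    have "H *v h = H *v a + t *\<^sub>R (H *v e k)"
      by (subst ha) (simp add: matrix_vector_right_distrib matrix_vector_mult_scaleR)
    then have "a \<bullet> (H *v h) = a \<bullet> (H *v a) + t * (a \<bullet> (H *v e k))"
      by (simp add: inner_add_right)
    moreover have "h \<bullet> w = a \<bullet> w + t * (e k \<bullet> w)" for w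
      by (subst ha) (simp add: inner_add_left)
    \<comment> \<open>Both terms by which the quadratic form differs from its tangential part carry
      a factor t, so they are small compared with t itself as h tends to 0.\<close>
    ultimately have hHh: "h \<bullet> (H *v h) - a \<bullet> (H *v a) = t * (e k \<bullet> (H *v h)) + t * (a \<bullet> (H *v e k))"
      by simp
    have ekH: "\<bar>e k \<bullet> (H *v h)\<bar> \<le> norm h * M"
      using Cauchy_Schwarz_ineq2[of "e k" "H *v h"] M(2)[of h] by (simp add: norm_e)
    have "a = h - t *\<^sub>R e k" by (simp add: ha)
    then have "a \<bullet> a = h \<bullet> h - t * t"
      by (simp add: inner_diff_left inner_diff_right inner_e t_def inner_commute)
    then have na: "norm a \<le> norm h"
      by (simp add: norm_le)
    have "\<bar>a \<bullet> (H *v e k)\<bar> \<le> norm a * norm (H *v e k)"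
      by (rule Cauchy_Schwarz_ineq2)
    also have "\<dots> \<le> norm h * M"
      using na M(2)[of "e k"] by (intro mult_mono) (auto simp: norm_e)
    finally have "\<bar>a \<bullet> (H *v e k)\<bar> \<le> norm h * M" .
    then have "t * (- (norm h * M)) + t * (- (norm h * M)) \<le> h \<bullet> (H *v h) - a \<bullet> (H *v a)"
      unfolding hHh using t ekH by (intro add_mono mult_left_mono) auto
    moreover have "norm h * M \<le> G * \<gamma> / 4"
    proof -
      have "norm h * M \<le> (G * \<gamma> / (6 * M)) * M"
        using hr M by (intro mult_right_mono) (auto simp: r_def)
      also have "\<dots> \<le> G * \<gamma> / 4" using G \<gamma> M by simp
      finally show ?thesis .
    qed
    then have "t * (norm h * M) \<le> t * (G * \<gamma> / 4)" using t by (intro mult_left_mono) auto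
    ultimately have 2: "h \<bullet> (H *v h) \<ge> - G * (2 * (1 - \<gamma>) * t) - t * (G * \<gamma> / 2)"
      using 1 by (simp add: algebra_simps)
    have 3: "\<delta> * (norm h)\<^sup>2 \<le> t * (G * \<gamma> / 4)"
    proof -
      have "\<delta> * (norm h)\<^sup>2 \<le> \<delta> * (2 * R * t)" using hR \<delta> by (intro mult_left_mono) auto
      also have "\<dots> = t * (G * \<gamma> / 4)" using R_pos by (simp add: \<delta>_def)
      finally show ?thesis .
    qed
    have "grad z \<bullet> h = G * t"
      by (subst grad_z_eq) (simp add: G_def t_def inner_commute)
    then have "\<psi> y \<ge> G * t + (h \<bullet> (H *v h)) / 2 - \<delta> * (norm h)\<^sup>2"
      using r1(2)[of h] hr by (simp add: r_def psi_z h_def)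
    then show ?thesis
      using 2 3 unfolding h_def[symmetric] t_def[symmetric] by (simp add: algebra_simps)
  qed
  then show thesis using that[of "G * \<gamma> / 2" r] G \<gamma> r by auto
qed

text \<open>Near z, \<psi> is at least c0 t at y and changes by at most L |v - y|, so it stays
  positive on a ball of radius comparable to t. Away from z, the closed ball without a neighbourhood
  of the touching point is a compact subset of \<Omega> and has a uniform distance from the
  complement.\<close>

lemma ball_subset_dom:
  obtains c where "c > 0" "\<And>y. y \<in> ball x R \<Longrightarrow> ball y (c * ((y - z) \<bullet> e k)) \<subseteq> \<Omega>"
proof -
  obtain c0 r0 where c0: "c0 > 0" "r0 > 0"
    "\<And>y. y \<in> ball x R \<Longrightarrow> norm (y - z) < r0 \<Longrightarrow> c0 * ((y - z) \<bullet> e k) \<le> \<psi> y"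
    using psi_lower_bound by blast
  obtain r C where r: "r > 0" "C \<ge> 0" "cball z r \<subseteq> U"
    and T: "\<And>v y. v \<in> cball z r \<Longrightarrow> y \<in> cball z r \<Longrightarrow> \<bar>\<psi> v - \<psi> y - grad y \<bullet> (v - y)\<bar> \<le> C * (norm (v - y))\<^sup>2"
    and gr: "\<And>y. y \<in> cball z r \<Longrightarrow> norm (grad z) / 2 \<le> norm (grad y) \<and> norm (grad y) \<le> 2 * norm (grad z)"
    using local_bounds by metis
  define r2 where "r2 = min r0 (r / 2)"
  have r2: "r2 > 0" using c0 r by (simp add: r2_def)
  have "compact (cball x R - ball z r2)" by (intro compact_diff) auto
  moreover have "cball x R - ball z r2 \<subseteq> \<Omega>"
  proof
    fix y assume y: "y \<in> cball x R - ball z r2"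
    then have "y \<noteq> z" using r2 by auto
    then have "y \<notin> cball x R \<inter> (UNIV - \<Omega>)" unfolding touch by simp
    with y show "y \<in> \<Omega>" by blast
  qed
  ultimately obtain d where d: "d > 0" "(\<Union>y\<in>cball x R - ball z r2. ball y d) \<subseteq> \<Omega>"
    using compact_subset_open_imp_ball_epsilon_subset[OF _ open_dom, of "cball x R - ball z r2"] by blast
  define L where "L = 2 * norm (grad z) + C * r"
  have L: "L > 0" using grad_z r by (simp add: L_def add_pos_nonneg)
  \<comment> \<open>The bound 1 keeps v inside the chart, c0 / L keeps \<psi> v positive, and d / (2
    R) suits the far case because t \<le> 2 R.\<close>
  define c where "c = min 1 (min (c0 / L) (d / (2 * R)))"
  have c: "c > 0" "c \<le> 1" "c \<le> c0 / L" "c \<le> d / (2 * R)"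
    using L c0 d R_pos by (auto simp: c_def)
  have "ball y (c * ((y - z) \<bullet> e k)) \<subseteq> \<Omega>" if y: "y \<in> ball x R" for y
  proof -
    define t where "t = (y - z) \<bullet> e k"
    have t: "t > 0"
      using y[unfolded mem_ball_iff] R_pos unfolding t_def by (smt (verit) zero_le_power2 zero_less_mult_iff)
    have th: "t \<le> norm (y - z)"
      using norm_cauchy_schwarz[of "y - z" "e k"] by (simp add: t_def norm_e)
    show ?thesis
    proof (cases "norm (y - z) < r2")
      case True
      show ?thesis
      proof
        fix v assume v: "v \<in> ball y (c * ((y - z) \<bullet> e k))"
        then have vy: "norm (v - y) < c * t" by (simp add: dist_norm norm_minus_commute t_def)
        also have "\<dots> \<le> 1 * norm (y - z)" using c t th by (intro mult_mono) auto
        finally have "norm (v - y) < norm (y - z)" by simp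
        moreover have "norm (y - z) < r / 2" using True by (simp add: r2_def)
        moreover have "norm (v - z) \<le> norm (v - y) + norm (y - z)"
          using norm_triangle_ineq[of "v - y" "y - z"] by simp
        ultimately have n: "norm (v - y) \<le> r" "norm (v - z) \<le> r" "norm (y - z) \<le> r"
          using norm_ge_zero[of "y - z"] by linarith+
        then have vc: "v \<in> cball z r" "y \<in> cball z r" by (auto simp: dist_norm norm_minus_commute)
        have "\<psi> v \<ge> \<psi> y + grad y \<bullet> (v - y) - C * (norm (v - y))\<^sup>2" using T[OF vc] by linarith
        moreover have "\<bar>grad y \<bullet> (v - y)\<bar> \<le> (2 * norm (grad z)) * norm (v - y)"
          using Cauchy_Schwarz_ineq2[of "grad y" "v - y"] gr[OF vc(2)]
          by (meson mult_right_mono norm_ge_zero order_trans)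
        moreover have "C * (norm (v - y))\<^sup>2 \<le> C * r * norm (v - y)"
          unfolding power2_eq_square mult.assoc using n r by (intro mult_left_mono mult_right_mono) auto
        ultimately have "\<psi> v \<ge> \<psi> y - L * norm (v - y)" by (simp add: L_def algebra_simps)
        moreover have "L * norm (v - y) < L * (c * t)" using vy L by simp
        moreover have "L * (c * t) \<le> L * ((c0 / L) * t)" using c L t by (intro mult_left_mono mult_right_mono) auto
        moreover have "c0 * t \<le> \<psi> y" using c0(3)[OF y] True by (simp add: r2_def t_def)
        moreover have "L * ((c0 / L) * t) = c0 * t" using L by simp
        ultimately have "\<psi> v > 0" by linarith
        then show "v \<in> \<Omega>" using psi_pos vc r by auto
      qed
    next
      case False
      then have "y \<in> cball x R - ball z r2" using y by (simp add: dist_norm norm_minus_commute)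
      then have "ball y d \<subseteq> \<Omega>" using d(2) by blast
      moreover have "norm (y - z) \<le> 2 * R"
        using y norm_xz norm_triangle_ineq[of "y - x" "x - z"] by (simp add: dist_norm norm_minus_commute)
      then have "c * t \<le> (d / (2 * R)) * (2 * R)"
        using c th t d R_pos by (intro mult_mono) auto
      then have "c * t \<le> d" using R_pos by simp
      ultimately show ?thesis unfolding t_def[symmetric] by (meson order_trans subset_ball)
    qed
  qed
  with c show thesis by (intro that[of c]) auto
qed

end

section \<open>Blow-up limit of the solutions\<close>

context touching_ball
begin

lemma closure_psi_nonneg:
  assumes "v \<in> closure \<Omega>" "v \<in> U"
  shows "0 \<le> \<psi> v"
proof (cases "v \<in> \<Omega>")
  case True
  then show ?thesis using psi_pos assms by (metis (mono_tags, lifting) IntI less_imp_le mem_Collect_eq)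
next
  case False
  then have "v \<in> frontier \<Omega>" using assms open_dom by (simp add: frontier_def interior_open)
  then show ?thesis using psi_zero assms by (metis (mono_tags, lifting) IntI order_refl mem_Collect_eq)
qed

text \<open>The quotient \<psi> / |grad \<psi>| stands for the distance to the boundary: dividing by
  |grad y| turns the Taylor estimate into one about a hyperplane with unit normal, with error C
  \<rho>^2. The radius \<rho> stays free until it is coupled to \<epsilon>.\<close>

lemma solution_bounds:
  obtains r C where "0 < r" "0 \<le> C" "cball z r \<subseteq> U"
    "\<And>tp tn \<epsilon> u y \<rho>. pucci_dirichlet tp tn \<epsilon> \<Omega> u \<Longrightarrow> y \<in> \<Omega> \<Longrightarrow> norm (y - z) \<le> r \<Longrightarrow> 0 < \<rho> \<Longrightarrow> \<rho> \<le> r \<Longrightarrow>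
      exp (- (\<psi> y / norm (grad y) + C * \<rho>\<^sup>2) / (\<epsilon> * sqrt tp)) - CARD('n) / cosh (decay_rate tp tn CARD('n) * \<rho> / \<epsilon>) \<le> u y \<and>
      u y \<le> exp (- (\<psi> y / norm (grad y) - C * \<rho>\<^sup>2) / (\<epsilon> * sqrt tp)) + CARD('n) / cosh (decay_rate tp tn CARD('n) * \<rho> / \<epsilon>)"
proof -
  obtain r C where r: "r > 0" "C \<ge> 0" "cball z r \<subseteq> U"
    and T: "\<And>v y. v \<in> cball z r \<Longrightarrow> y \<in> cball z r \<Longrightarrow> \<bar>\<psi> v - \<psi> y - grad y \<bullet> (v - y)\<bar> \<le> C * (norm (v - y))\<^sup>2"
    and gr: "\<And>y. y \<in> cball z r \<Longrightarrow> norm (grad z) / 2 \<le> norm (grad y) \<and> norm (grad y) \<le> 2 * norm (grad z)"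
    using local_bounds by metis
  \<comment> \<open>The Taylor error gets divided by |grad y|, which is at least half of |grad
    z|.\<close>
  define C' where "C' = C / (norm (grad z) / 2)"
  have C': "C' \<ge> 0" using r grad_z by (simp add: C'_def)
  \<comment> \<open>With y within r / 2 of z and \<rho> \<le> r / 2, all points within \<rho> of y
    stay in the region where the Taylor bound holds. The exported radius is therefore r / 2.\<close>
  have main: "exp (- (\<psi> y / norm (grad y) + C' * \<rho>\<^sup>2) / (\<epsilon> * sqrt tp)) - CARD('n) / cosh (decay_rate tp tn CARD('n) * \<rho> / \<epsilon>) \<le> u y \<and>
      u y \<le> exp (- (\<psi> y / norm (grad y) - C' * \<rho>\<^sup>2) / (\<epsilon> * sqrt tp)) + CARD('n) / cosh (decay_rate tp tn CARD('n) * \<rho> / \<epsilon>)"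
    if P: "pucci_dirichlet tp tn \<epsilon> \<Omega> u" and y: "y \<in> \<Omega>" "norm (y - z) \<le> r / 2" and \<rho>: "0 < \<rho>" "\<rho> \<le> r / 2"
    for tp tn \<epsilon> u y \<rho>
  proof -
    interpret pucci_dirichlet tp tn \<epsilon> \<Omega> u by (rule P)
    define G where "G = norm (grad y)"
    define n where "n = grad y /\<^sub>R G"
    define s where "s = \<psi> y / G"
    define q where "q = C' * \<rho>\<^sup>2"
    have yr: "y \<in> cball z r" using y(2) r(1) by (simp add: dist_norm norm_minus_commute)
    have G: "G \<ge> norm (grad z) / 2" "G > 0"
      using gr[OF yr] grad_z by (auto simp: G_def)
    then have n: "norm n = 1" by (simp add: n_def G_def)
    have den: "\<epsilon> * sqrt tp > 0" using eps_pos tp_pos by simp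
    have near: "v \<in> cball z r" if "dist y v \<le> \<rho>" for v
    proof -
      have "norm (v - z) \<le> norm (v - y) + norm (y - z)"
        using norm_triangle_ineq[of "v - y" "y - z"] by simp
      also have "\<dots> \<le> r / 2 + r / 2"
        using that y \<rho> by (intro add_mono) (auto simp: dist_norm norm_minus_commute)
      finally show ?thesis by (simp add: dist_norm norm_minus_commute)
    qed
    have taylor: "\<bar>\<psi> v / G - s - (v - y) \<bullet> n\<bar> \<le> q" if "dist y v \<le> \<rho>" for v
    proof -
      have "\<bar>\<psi> v / G - s - (v - y) \<bullet> n\<bar> = \<bar>\<psi> v - \<psi> y - grad y \<bullet> (v - y)\<bar> / G"
      proof -
        have "\<psi> v / G - s - (v - y) \<bullet> n = (\<psi> v - \<psi> y - grad y \<bullet> (v - y)) / G"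
          by (simp add: s_def n_def inner_commute diff_divide_distrib) (simp add: divide_inverse mult.commute)
        then show ?thesis using G by simp
      qed
      also have "\<dots> \<le> (C * \<rho>\<^sup>2) / (norm (grad z) / 2)"
      proof (rule frac_le)
        have "\<bar>\<psi> v - \<psi> y - grad y \<bullet> (v - y)\<bar> \<le> C * (norm (v - y))\<^sup>2"
          by (rule T[OF near[OF that] yr])
        also have "\<dots> \<le> C * \<rho>\<^sup>2"
          using that r by (intro mult_left_mono power_mono) (auto simp: dist_norm norm_minus_commute)
        finally show "\<bar>\<psi> v - \<psi> y - grad y \<bullet> (v - y)\<bar> \<le> C * \<rho>\<^sup>2" .
      qed (use G grad_z r in auto)
      also have "\<dots> = q" by (simp add: q_def C'_def)
      finally show ?thesis .
    qed
    have "u y \<le> 1 * exp (- (s - q) / (\<epsilon> * sqrt tp)) + CARD('n) / cosh (decay_rate tp tn CARD('n) * \<rho> / \<epsilon>)"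
    proof (rule upper_barrier[OF y(1) \<rho>(1) n])
      fix v assume v: "v \<in> frontier \<Omega>" "dist y v < \<rho>"
      have "v \<in> U" using near[of v] v r by auto
      then have "\<psi> v = 0" using psi_zero v by blast
      then have "(v - y) \<bullet> n \<le> q - s" using taylor[of v] v by auto
      then have "0 \<le> - (s - q) / (\<epsilon> * sqrt tp) - ((v - y) \<bullet> n) / (\<epsilon> * sqrt tp)"
        using den by (simp add: diff_divide_distrib[symmetric])
      then show "1 \<le> 1 * exp (- (s - q) / (\<epsilon> * sqrt tp) - ((v - y) \<bullet> n) / (\<epsilon> * sqrt tp))"
        by simp
    qed simp
    moreover have "exp (- (s + q) / (\<epsilon> * sqrt tp)) - CARD('n) / cosh (decay_rate tp tn CARD('n) * \<rho> / \<epsilon>) \<le> u y"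
    proof (rule lower_barrier[OF y(1) \<rho>(1) n])
      fix v assume v: "v \<in> closure \<Omega>" "dist y v \<le> \<rho>"
      have "v \<in> U" using near[of v] v r by auto
      then have "\<psi> v / G \<ge> 0" using closure_psi_nonneg v G by simp
      then have "- ((v - y) \<bullet> n) \<le> s + q" using taylor[OF v(2)] by linarith
      then have "- (s + q) / (\<epsilon> * sqrt tp) - ((v - y) \<bullet> n) / (\<epsilon> * sqrt tp) \<le> 0"
        using den by (simp add: diff_divide_distrib[symmetric] divide_nonpos_pos)
      then show "exp (- (s + q) / (\<epsilon> * sqrt tp) - ((v - y) \<bullet> n) / (\<epsilon> * sqrt tp)) \<le> 1"
        by simp
    qed
    ultimately show ?thesis by (simp add: s_def q_def G_def)
  qed
  show thesis
  proof (rule that[of "r / 2" C'])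
    show "cball z (r / 2) \<subseteq> U" using r subset_cball[of "r / 2" r z] by (intro order_trans[OF _ r(3)]) auto
    show "0 < r / 2" using r by simp
  qed (rule C' main; assumption)+
qed

text \<open>The only trace of \<epsilon> is the nonnegative term \<epsilon> \<eta>_k^2: the rescaled
  balls all lie in the paraboloid and fill it as \<epsilon> tends to 0.\<close>

lemma mem_ball_stretch:
  assumes "\<epsilon> > 0"
  shows "z + stretch \<epsilon> \<eta> \<in> ball x R \<longleftrightarrow> \<epsilon> * (\<eta> $ k)\<^sup>2 + (\<Sum>i\<in>-{k}. (\<eta> $ i)\<^sup>2) < 2 * R * \<eta> $ k"
proof -
  have "(norm (stretch \<epsilon> \<eta>))\<^sup>2 = (\<Sum>i\<in>UNIV. (if i = k then \<epsilon>\<^sup>2 else \<epsilon>) * (\<eta> $ i)\<^sup>2)"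
    unfolding orthonormal_family_norm[OF e] stretch_inner
    using assms by (intro sum.cong) (auto simp: power_mult_distrib)
  also have "\<dots> = \<epsilon>\<^sup>2 * (\<eta> $ k)\<^sup>2 + (\<Sum>i\<in>UNIV - {k}. (if i = k then \<epsilon>\<^sup>2 else \<epsilon>) * (\<eta> $ i)\<^sup>2)"
    by (subst sum.remove[of UNIV k]) auto
  also have "(\<Sum>i\<in>UNIV - {k}. (if i = k then \<epsilon>\<^sup>2 else \<epsilon>) * (\<eta> $ i)\<^sup>2) = \<epsilon> * (\<Sum>i\<in>-{k}. (\<eta> $ i)\<^sup>2)"
    unfolding sum_distrib_left by (intro sum.cong) auto
  finally have "(norm (stretch \<epsilon> \<eta>))\<^sup>2 = \<epsilon> * (\<epsilon> * (\<eta> $ k)\<^sup>2 + (\<Sum>i\<in>-{k}. (\<eta> $ i)\<^sup>2))"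
    by (simp add: power2_eq_square algebra_simps)
  moreover have "2 * R * (stretch \<epsilon> \<eta> \<bullet> e k) = \<epsilon> * (2 * R * \<eta> $ k)"
    by (simp add: stretch_inner)
  ultimately show ?thesis
    using assms by (simp only: mem_ball_iff add_diff_cancel_left' mult_less_cancel_left_pos)
qed

lemma eventually_stretch_in_ball:
  assumes "(\<Sum>i\<in>-{k}. (\<eta> $ i)\<^sup>2) < 2 * R * \<eta> $ k"
  shows "\<forall>\<^sub>F \<epsilon> in at_right 0. z + stretch \<epsilon> \<eta> \<in> ball x R"
proof -
  have "((\<lambda>\<epsilon>. \<epsilon> * (\<eta> $ k)\<^sup>2 + (\<Sum>i\<in>-{k}. (\<eta> $ i)\<^sup>2)) \<longlongrightarrow> 0 * (\<eta> $ k)\<^sup>2 + (\<Sum>i\<in>-{k}. (\<eta> $ i)\<^sup>2)) (at_right 0)"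
    by (intro tendsto_intros)
  then have "\<forall>\<^sub>F \<epsilon> in at_right 0. \<epsilon> * (\<eta> $ k)\<^sup>2 + (\<Sum>i\<in>-{k}. (\<eta> $ i)\<^sup>2) < 2 * R * \<eta> $ k"
    using assms by (intro order_tendstoD(2)) auto
  then show ?thesis
    using eventually_at_right_less[of "0::real"] by eventually_elim (subst mem_ball_stretch)
qed

lemma stretch_tendsto_0: "((\<lambda>\<epsilon>. stretch \<epsilon> \<eta>) \<longlongrightarrow> 0) (at_right 0)"
proof -
  have sq: "((\<lambda>\<epsilon>. sqrt \<epsilon>) \<longlongrightarrow> 0) (at_right 0)"
    using tendsto_real_sqrt[OF tendsto_ident_at, of 0 "{0<..}"] by simp
  show ?thesis
    unfolding stretch_split by (rule tendsto_eq_intros sq refl)+ simp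
qed

lemma solution_limit:
  assumes sol: "\<And>\<epsilon>. \<epsilon> > 0 \<Longrightarrow> pucci_dirichlet tp tn \<epsilon> \<Omega> (u \<epsilon>)"
    and \<eta>: "(\<Sum>i\<in>-{k}. (\<eta> $ i)\<^sup>2) < 2 * R * \<eta> $ k"
  shows "((\<lambda>\<epsilon>. u \<epsilon> (z + stretch \<epsilon> \<eta>)) \<longlongrightarrow> exp (- tau \<eta> / sqrt tp)) (at_right 0)"
proof -
  \<comment> \<open>The instance \<epsilon> = 1 serves to read off the positivity of constants that
    do not depend on \<epsilon>.\<close>
  interpret s1: pucci_dirichlet tp tn 1 \<Omega> "u 1" by (rule sol) simp
  have tp: "tp > 0" by (rule s1.tp_pos)
  define \<delta> where "\<delta> = decay_rate tp tn CARD('n)"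
  have \<delta>: "\<delta> > 0" unfolding \<delta>_def by (rule s1.decay_rate_pos)
  obtain r C where r: "0 < r" "0 \<le> C" "cball z r \<subseteq> U"
    and B: "\<And>\<epsilon> y \<rho>. \<epsilon> > 0 \<Longrightarrow> y \<in> \<Omega> \<Longrightarrow> norm (y - z) \<le> r \<Longrightarrow> 0 < \<rho> \<Longrightarrow> \<rho> \<le> r \<Longrightarrow>
      exp (- (\<psi> y / norm (grad y) + C * \<rho>\<^sup>2) / (\<epsilon> * sqrt tp)) - CARD('n) / cosh (\<delta> * \<rho> / \<epsilon>) \<le> u \<epsilon> y \<and>
      u \<epsilon> y \<le> exp (- (\<psi> y / norm (grad y) - C * \<rho>\<^sup>2) / (\<epsilon> * sqrt tp)) + CARD('n) / cosh (\<delta> * \<rho> / \<epsilon>)"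
    using solution_bounds sol unfolding \<delta>_def by metis
  define Y where "Y \<epsilon> = z + stretch \<epsilon> \<eta>" for \<epsilon>
  define s where "s \<epsilon> = \<psi> (Y \<epsilon>) / \<epsilon> / norm (grad (Y \<epsilon>))" for \<epsilon>
  \<comment> \<open>The power \<epsilon>^(3/4): \<rho>^2 / \<epsilon> = sqrt \<epsilon> removes the
    boundary curvature from the exponent, and \<rho> / \<epsilon> = \<epsilon>^(-1/4) sends the
    lateral term to 0.\<close>
  define \<rho> where "\<rho> \<epsilon> = sqrt \<epsilon> * sqrt (sqrt \<epsilon>)" for \<epsilon> :: real
  have Y: "(Y \<longlongrightarrow> z) (at_right 0)"
    unfolding Y_def using tendsto_add[OF tendsto_const stretch_tendsto_0, of z] by simp
  have "(grad has_derivative (\<lambda>v. hess z *v v)) (at z)"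
    using C2 zU by (auto simp: C2_with_def)
  from isCont_tendsto_compose[OF has_derivative_continuous[OF this] Y]
  have nY: "((\<lambda>\<epsilon>. norm (grad (Y \<epsilon>))) \<longlongrightarrow> norm (grad z)) (at_right 0)"
    by (rule tendsto_norm)
  have "(s \<longlongrightarrow> norm (grad z) * tau \<eta> / norm (grad z)) (at_right 0)"
    unfolding s_def using grad_z by (intro tendsto_divide psi_limit[of \<eta>, folded Y_def] nY) auto
  then have s: "(s \<longlongrightarrow> tau \<eta>) (at_right 0)"
    using grad_z by simp
  have sq: "((\<lambda>\<epsilon>. sqrt \<epsilon>) \<longlongrightarrow> 0) (at_right 0)"
    using tendsto_real_sqrt[OF tendsto_ident_at, of 0 "{0<..}"] by simp
  have sq2: "((\<lambda>\<epsilon>. sqrt (sqrt \<epsilon>)) \<longlongrightarrow> 0) (at_right 0)"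
    using tendsto_real_sqrt[OF sq] by simp
  have \<rho>_sq: "(\<rho> \<epsilon>)\<^sup>2 / \<epsilon> = sqrt \<epsilon>" "\<rho> \<epsilon> / \<epsilon> = inverse (sqrt (sqrt \<epsilon>))" if "\<epsilon> > 0" for \<epsilon>
  proof -
    \<comment> \<open>In terms of the fourth root q the identities are monomial: \<epsilon> = q^4
      and \<rho> = q^3.\<close>
    define q where "q = sqrt (sqrt \<epsilon>)"
    have q: "q > 0" using that by (simp add: q_def)
    have 1: "sqrt \<epsilon> = q * q" using that by (simp add: q_def)
    have "\<epsilon> = sqrt \<epsilon> * sqrt \<epsilon>" using that by simp
    then have 2: "\<epsilon> = (q * q) * (q * q)" unfolding 1 .
    have "\<rho> \<epsilon> = sqrt \<epsilon> * q" by (simp add: \<rho>_def q_def)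
    then have 3: "\<rho> \<epsilon> = q * q * q" unfolding 1 .
    have "(\<rho> \<epsilon>)\<^sup>2 / \<epsilon> = (q * q * q)\<^sup>2 / ((q * q) * (q * q))"
      unfolding 3 by (rule arg_cong[where f="\<lambda>t. _ / t", OF 2])
    also have "\<dots> = q * q" using q by (simp add: power2_eq_square)
    finally show "(\<rho> \<epsilon>)\<^sup>2 / \<epsilon> = sqrt \<epsilon>" unfolding 1 .
    have "\<rho> \<epsilon> / \<epsilon> = (q * q * q) / ((q * q) * (q * q))"
      unfolding 3 by (rule arg_cong[where f="\<lambda>t. _ / t", OF 2])
    also have "\<dots> = inverse q" using q by (simp add: field_simps)
    finally show "\<rho> \<epsilon> / \<epsilon> = inverse (sqrt (sqrt \<epsilon>))" unfolding q_def .
  qed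
  have "((\<lambda>\<epsilon>. C * sqrt \<epsilon>) \<longlongrightarrow> C * 0) (at_right 0)"
    by (intro tendsto_intros sq)
  moreover have "\<forall>\<^sub>F \<epsilon> in at_right 0. C * sqrt \<epsilon> = C * (\<rho> \<epsilon>)\<^sup>2 / \<epsilon>"
    using eventually_at_right_less[of "0::real"]
    by eventually_elim (simp only: times_divide_eq_right[symmetric] \<rho>_sq)
  ultimately have \<rho>1: "((\<lambda>\<epsilon>. C * (\<rho> \<epsilon>)\<^sup>2 / \<epsilon>) \<longlongrightarrow> 0) (at_right 0)"
    by (simp add: tendsto_cong)
  have \<rho>0: "(\<rho> \<longlongrightarrow> 0) (at_right 0)"
    unfolding \<rho>_def using tendsto_mult[OF sq sq2] by simp
  have "\<forall>\<^sub>F \<epsilon> in at_right 0. 0 < sqrt (sqrt \<epsilon>)"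
    using eventually_at_right_less[of "0::real"] by eventually_elim simp
  then have "filterlim (\<lambda>\<epsilon>. sqrt (sqrt \<epsilon>)) (at_right 0) (at_right 0)"
    unfolding filterlim_at by (intro conjI sq2) (erule eventually_mono, simp)
  then have "filterlim (\<lambda>\<epsilon>. \<delta> * inverse (sqrt (sqrt \<epsilon>))) at_top (at_right 0)"
    by (intro filterlim_tendsto_pos_mult_at_top[OF tendsto_const \<delta>] filterlim_compose[OF filterlim_inverse_at_top_right])
  moreover have "\<forall>\<^sub>F \<epsilon> in at_right 0. \<delta> * inverse (sqrt (sqrt \<epsilon>)) = \<delta> * \<rho> \<epsilon> / \<epsilon>"
    using eventually_at_right_less[of "0::real"]
    by eventually_elim (simp only: times_divide_eq_right[symmetric] \<rho>_sq)
  ultimately have "filterlim (\<lambda>\<epsilon>. \<delta> * \<rho> \<epsilon> / \<epsilon>) at_top (at_right 0)"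
    by (simp add: filterlim_cong)
  then have ch: "((\<lambda>\<epsilon>. CARD('n) / cosh (\<delta> * \<rho> \<epsilon> / \<epsilon>)) \<longlongrightarrow> 0) (at_right 0)"
    by (intro real_tendsto_divide_at_top[OF tendsto_const] filterlim_compose[OF cosh_real_at_top])
  have lo: "((\<lambda>\<epsilon>. exp (- (s \<epsilon> + C * (\<rho> \<epsilon>)\<^sup>2 / \<epsilon>) / sqrt tp) - CARD('n) / cosh (\<delta> * \<rho> \<epsilon> / \<epsilon>)) \<longlongrightarrow>
      exp (- (tau \<eta> + 0) / sqrt tp) - 0) (at_right 0)"
    using tp by (intro tendsto_intros s \<rho>1 ch) auto
  have hi: "((\<lambda>\<epsilon>. exp (- (s \<epsilon> - C * (\<rho> \<epsilon>)\<^sup>2 / \<epsilon>) / sqrt tp) + CARD('n) / cosh (\<delta> * \<rho> \<epsilon> / \<epsilon>)) \<longlongrightarrow>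
      exp (- (tau \<eta> - 0) / sqrt tp) + 0) (at_right 0)"
    using tp by (intro tendsto_intros s \<rho>1 ch) auto
  have "\<forall>\<^sub>F \<epsilon> in at_right 0. norm (stretch \<epsilon> \<eta>) < r"
    using order_tendstoD(2)[OF tendsto_norm_zero[OF stretch_tendsto_0] r(1)] .
  moreover have "\<forall>\<^sub>F \<epsilon> in at_right 0. \<rho> \<epsilon> < r"
    using order_tendstoD(2)[OF \<rho>0 r(1)] .
  ultimately have ev: "\<forall>\<^sub>F \<epsilon> in at_right 0.
      exp (- (s \<epsilon> + C * (\<rho> \<epsilon>)\<^sup>2 / \<epsilon>) / sqrt tp) - CARD('n) / cosh (\<delta> * \<rho> \<epsilon> / \<epsilon>) \<le> u \<epsilon> (Y \<epsilon>) \<and>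
      u \<epsilon> (Y \<epsilon>) \<le> exp (- (s \<epsilon> - C * (\<rho> \<epsilon>)\<^sup>2 / \<epsilon>) / sqrt tp) + CARD('n) / cosh (\<delta> * \<rho> \<epsilon> / \<epsilon>)"
    using eventually_at_right_less[of "0::real"] eventually_stretch_in_ball[OF \<eta>]
  proof eventually_elim
    case (elim \<epsilon>)
    have "Y \<epsilon> \<in> \<Omega>" "norm (Y \<epsilon> - z) \<le> r" "0 < \<rho> \<epsilon>" "\<rho> \<epsilon> \<le> r"
      using elim ball_sub by (auto simp: Y_def \<rho>_def)
    note b = B[OF elim(3) this]
    have "(\<psi> (Y \<epsilon>) / norm (grad (Y \<epsilon>)) + C * (\<rho> \<epsilon>)\<^sup>2) / \<epsilon> = s \<epsilon> + C * (\<rho> \<epsilon>)\<^sup>2 / \<epsilon>"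
      "(\<psi> (Y \<epsilon>) / norm (grad (Y \<epsilon>)) - C * (\<rho> \<epsilon>)\<^sup>2) / \<epsilon> = s \<epsilon> - C * (\<rho> \<epsilon>)\<^sup>2 / \<epsilon>"
      by (simp_all add: s_def add_divide_distrib diff_divide_distrib mult.commute)
    then have "- (\<psi> (Y \<epsilon>) / norm (grad (Y \<epsilon>)) + C * (\<rho> \<epsilon>)\<^sup>2) / (\<epsilon> * sqrt tp) = - (s \<epsilon> + C * (\<rho> \<epsilon>)\<^sup>2 / \<epsilon>) / sqrt tp"
      "- (\<psi> (Y \<epsilon>) / norm (grad (Y \<epsilon>)) - C * (\<rho> \<epsilon>)\<^sup>2) / (\<epsilon> * sqrt tp) = - (s \<epsilon> - C * (\<rho> \<epsilon>)\<^sup>2 / \<epsilon>) / sqrt tp"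
      by (simp_all only: divide_divide_eq_left[symmetric] minus_divide_left[symmetric])
    then show ?case using b by simp
  qed
  show ?thesis
    unfolding Y_def[symmetric]
    by (rule tendsto_sandwich[OF _ _ lo[unfolded add_0_right diff_0_right] hi[unfolded add_0_right diff_0_right]])
      (use ev in \<open>eventually_elim, simp\<close>)+
qed

text \<open>The ball inside \<Omega> has radius c \<epsilon> \<eta>_k, so \<epsilon> cancels in the
  exponent of \<open>u_decay\<close>. The bound is the same for all \<epsilon> and can act as a
  dominating function.\<close>

lemma solution_decay:
  obtains c where "c > 0"
    "\<And>tp tn \<epsilon> u \<eta>. pucci_dirichlet tp tn \<epsilon> \<Omega> u \<Longrightarrow> z + stretch \<epsilon> \<eta> \<in> ball x R \<Longrightarrow>
       u (z + stretch \<epsilon> \<eta>) \<le> 2 * CARD('n) * exp (- (decay_rate tp tn CARD('n) * c * \<eta> $ k))"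
proof -
  obtain c where c: "c > 0" "\<And>y. y \<in> ball x R \<Longrightarrow> ball y (c * ((y - z) \<bullet> e k)) \<subseteq> \<Omega>"
    using ball_subset_dom by blast
  have "u (z + stretch \<epsilon> \<eta>) \<le> 2 * CARD('n) * exp (- (decay_rate tp tn CARD('n) * c * \<eta> $ k))"
    if P: "pucci_dirichlet tp tn \<epsilon> \<Omega> u" and B: "z + stretch \<epsilon> \<eta> \<in> ball x R" for tp tn \<epsilon> u \<eta>
  proof -
    interpret pucci_dirichlet tp tn \<epsilon> \<Omega> u by (rule P)
    have "0 \<le> \<epsilon> * (\<eta> $ k)\<^sup>2 + (\<Sum>i\<in>-{k}. (\<eta> $ i)\<^sup>2)"
      using eps_pos by (intro add_nonneg_nonneg sum_nonneg) auto
    also have "\<dots> < 2 * R * \<eta> $ k"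
      using B mem_ball_stretch[OF eps_pos] by simp
    finally have "\<eta> $ k > 0" using R_pos by (simp add: zero_less_mult_iff)
    then show ?thesis
      using u_decay[OF _ c(2)[OF B]] c(1) eps_pos by (simp add: stretch_inner mult.assoc)
  qed
  with c show thesis using that by blast
qed

end

section \<open>Integrals\<close>

lemma integral_dominated_convergence_at_right:
  fixes s :: "real \<Rightarrow> 'a \<Rightarrow> real"
  assumes "f \<in> borel_measurable M" "\<And>\<epsilon>. 0 < \<epsilon> \<Longrightarrow> s \<epsilon> \<in> borel_measurable M" "integrable M w"
    and "\<And>x. ((\<lambda>\<epsilon>. s \<epsilon> x) \<longlongrightarrow> f x) (at_right 0)"
    and "\<And>\<epsilon> x. 0 < \<epsilon> \<Longrightarrow> norm (s \<epsilon> x) \<le> w x"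
  shows "((\<lambda>\<epsilon>. integral\<^sup>L M (s \<epsilon>)) \<longlongrightarrow> integral\<^sup>L M f) (at_right 0)"
proof (rule tendsto_at_right_sequentially[of 0 1])
  fix S :: "nat \<Rightarrow> real"
  assume S: "\<And>n. 0 < S n" "S \<longlonglongrightarrow> 0"
  have "S n \<noteq> 0" for n
    using S(1)[of n] by simp
  then have "filterlim S (at_right 0) sequentially"
    using S by (simp add: filterlim_at)
  then show "(\<lambda>n. integral\<^sup>L M (s (S n))) \<longlonglongrightarrow> integral\<^sup>L M f"
    using S assms(5)
    by (intro integral_dominated_convergence[where w=w] assms AE_I2 filterlim_compose[OF assms(4)]) auto
qed simp

text \<open>Both the image measure and Lebesgue measure are translation invariant; Tonelli applied to
  \<open>(x, y) \<mapsto> 1\<^sub>A x * 1\<^sub>B (y - x)\<close>, with \<open>B\<close> the unit ball, shows that they agree up to the factor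
  given by the measures of \<open>B\<close>.\<close>

lemma lborel_distr_orthogonal:
  fixes f :: "'a::euclidean_space \<Rightarrow> 'a"
  assumes f: "orthogonal_transformation f"
  shows "distr lborel borel f = lborel"
proof -
  define \<nu> where "\<nu> = distr lborel borel f"
  have lin: "linear f" using f by (simp add: orthogonal_transformation_def)
  have mf[measurable]: "f \<in> borel_measurable borel"
    using lin by (simp add: linear_continuous_on linear_conv_bounded_linear borel_measurable_continuous_onI)
  have sets_\<nu>[measurable_cong]: "sets \<nu> = sets borel" by (simp add: \<nu>_def)
  have nn_\<nu>: "(\<integral>\<^sup>+ x. g x \<partial>\<nu>) = (\<integral>\<^sup>+ x. g (f x) \<partial>lborel)" if "g \<in> borel_measurable borel" for g
    using that by (simp add: \<nu>_def nn_integral_distr)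
  have nn_translate: "(\<integral>\<^sup>+ x. g (x + y) \<partial>lborel) = (\<integral>\<^sup>+ x. g x \<partial>lborel)"
    if [measurable]: "g \<in> borel_measurable borel" for g :: "'a \<Rightarrow> ennreal" and y
  proof -
    have "(\<integral>\<^sup>+ x. g x \<partial>lborel) = (\<integral>\<^sup>+ x. g x \<partial>distr lborel borel ((+) y))"
      by (simp add: lborel_distr_plus)
    also have "\<dots> = (\<integral>\<^sup>+ x. g (x + y) \<partial>lborel)"
      by (subst nn_integral_distr) (auto simp: add.commute)
    finally show ?thesis ..
  qed
  have surj: "surj f"
    using f by (rule orthogonal_transformation_surj)
  define B where "B = ball (0::'a) 1"
  have [measurable]: "B \<in> sets borel" by (simp add: B_def)
  have B: "0 < emeasure lborel B" "emeasure lborel B < \<infinity>"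
    unfolding B_def using emeasure_lborel_ball_finite[of "0::'a" 1] content_ball_pos[of 1 "0::'a"]
    by (auto simp: measure_def enn2real_positive_iff)
  have "emeasure lborel A = emeasure \<nu> A" if A[measurable]: "A \<in> sets borel" for A
  proof -
    have "emeasure \<nu> A * emeasure lborel B =
        (\<integral>\<^sup>+ x. (\<integral>\<^sup>+ y. indicator A (f x) * indicator B (y - f x) \<partial>lborel) \<partial>lborel)"
    proof -
      have "(\<integral>\<^sup>+ y. indicator A (f x) * indicator B (y - f x) \<partial>lborel) = indicator A (f x) * emeasure lborel B" for x
      proof -
        have "(\<integral>\<^sup>+ y. indicator A (f x) * indicator B (y - f x) \<partial>lborel) =
            indicator A (f x) * (\<integral>\<^sup>+ y. indicator B (y + - f x) \<partial>lborel)"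
          unfolding diff_conv_add_uminus by (rule nn_integral_cmult) measurable
        also have "(\<integral>\<^sup>+ y. indicator B (y + - f x) \<partial>lborel) = (\<integral>\<^sup>+ y. indicator B y \<partial>lborel)"
          by (rule nn_translate) measurable
        finally show ?thesis by simp
      qed
      moreover have "emeasure \<nu> A = (\<integral>\<^sup>+ x. indicator A x \<partial>\<nu>)"
        using A by (simp add: sets_\<nu>)
      moreover have "\<dots> = (\<integral>\<^sup>+ x. indicator A (f x) \<partial>lborel)"
        by (rule nn_\<nu>) measurable
      ultimately show ?thesis by (simp add: nn_integral_multc)
    qed
    also have "\<dots> = (\<integral>\<^sup>+ y. (\<integral>\<^sup>+ x. indicator A (f x) * indicator B (y - f x) \<partial>lborel) \<partial>lborel)"
      by (rule lborel_pair.Fubini') measurable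
    \<comment> \<open>Shifting x by a preimage of y under f removes y from the factor with B and
      puts it into the factor with A.\<close>
    also have "\<dots> = (\<integral>\<^sup>+ y. (\<integral>\<^sup>+ x. indicator A (f x + y) * indicator B (- f x) \<partial>lborel) \<partial>lborel)"
    proof (rule nn_integral_cong)
      fix y
      obtain w where w: "f w = y" using surj by (metis surj_def)
      have "(\<integral>\<^sup>+ x. indicator A (f (x + w)) * indicator B (y - f (x + w)) \<partial>lborel) =
          (\<integral>\<^sup>+ x. indicator A (f x) * indicator B (y - f x) \<partial>lborel)"
        by (rule nn_translate) measurable
      then show "(\<integral>\<^sup>+ x. indicator A (f x) * indicator B (y - f x) \<partial>lborel) =
          (\<integral>\<^sup>+ x. indicator A (f x + y) * indicator B (- f x) \<partial>lborel)"
        by (simp add: linear_add[OF lin] w)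
    qed
    also have "\<dots> = (\<integral>\<^sup>+ x. (\<integral>\<^sup>+ y. indicator A (f x + y) * indicator B (- f x) \<partial>lborel) \<partial>lborel)"
      by (rule lborel_pair.Fubini'[symmetric]) measurable
    also have "\<dots> = (\<integral>\<^sup>+ x. emeasure lborel A * indicator B x \<partial>lborel)"
    proof (rule nn_integral_cong)
      fix x
      have "(\<integral>\<^sup>+ y. indicator A (y + f x) \<partial>lborel) = (\<integral>\<^sup>+ y. indicator A y \<partial>lborel)"
        by (rule nn_translate) measurable
      then have "(\<integral>\<^sup>+ y. indicator A (f x + y) \<partial>lborel) = emeasure lborel A"
        by (simp add: add.commute)
      \<comment> \<open>The unit ball is invariant under f and under negation; this is where
        orthogonality enters.\<close>
      moreover have "indicator B (- f x) = (indicator B x :: ennreal)"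
        using f by (simp add: indicator_def B_def orthogonal_transformation_norm)
      ultimately show "(\<integral>\<^sup>+ y. indicator A (f x + y) * indicator B (- f x) \<partial>lborel) = emeasure lborel A * indicator B x"
        by (simp add: nn_integral_multc)
    qed
    also have "\<dots> = emeasure lborel A * emeasure lborel B"
      by (simp add: nn_integral_cmult)
    finally show ?thesis
      using B by (auto simp: mult.commute[of _ "emeasure lborel B"] ennreal_mult_cancel_left)
  qed
  then show ?thesis
    unfolding \<nu>_def[symmetric] by (intro measure_eqI) (auto simp: sets_\<nu>)
qed

text \<open>The substitution is a diagonal scaling D followed by the orthogonal map Q: the first
  contributes the product of the |d i|, the second preserves Lebesgue measure.\<close>

lemma lborel_integral_orthonormal_scaling:
  fixes e :: "'n \<Rightarrow> real^'n" and G :: "real^'n \<Rightarrow> real"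
  assumes e: "orthonormal_family e" and d: "\<And>i. d i \<noteq> 0" and G[measurable]: "G \<in> borel_measurable borel"
  shows "integral\<^sup>L lborel G = (\<Prod>i\<in>UNIV. \<bar>d i\<bar>) * (\<integral>x. G (\<Sum>i\<in>UNIV. (d i * x $ i) *\<^sub>R e i) \<partial>lborel)"
proof -
  define Q where "Q v = (\<Sum>i\<in>UNIV. v $ i *\<^sub>R e i)" for v :: "real^'n"
  have linQ: "linear Q"
    unfolding Q_def by (intro linearI) (simp_all add: scaleR_add_left sum.distrib scaleR_sum_right)
  have Q: "orthogonal_transformation Q"
    unfolding orthogonal_transformation_def
  proof (intro conjI allI linQ)
    fix v w
    have ee: "e i \<bullet> e j = (if i = j then 1 else 0)" for i j
      using e by (simp add: orthonormal_family_def)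
    have "Q v \<bullet> Q w = (\<Sum>i\<in>UNIV. \<Sum>j\<in>UNIV. v $ i * (w $ j * (e i \<bullet> e j)))"
      unfolding Q_def inner_sum_left by (simp add: inner_sum_right sum_distrib_left mult.left_commute)
    also have "\<dots> = (\<Sum>i\<in>UNIV. v $ i * w $ i)"
      by (simp add: ee if_distrib cong: if_cong)
    finally show "Q v \<bullet> Q w = v \<bullet> w" by (simp add: inner_vec_def)
  qed
  have mQ[measurable]: "Q \<in> borel_measurable borel"
    using linQ by (simp add: linear_continuous_on linear_conv_bounded_linear borel_measurable_continuous_onI)
  \<comment> \<open>The scaling law for Lebesgue measure indexes its factors by basis vectors, so
    \<open>d\<close> is transported along i \<mapsto> \<open>axis i 1\<close>.\<close>
  define c where "c b = d (THE i. b = axis i 1)" for b :: "real^'n"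
  have c: "c (axis i 1) = d i" for i
    unfolding c_def by (simp add: axis_eq_axis)
  define D where "D x = (\<Sum>b\<in>Basis. (c b * (x \<bullet> b)) *\<^sub>R b)" for x :: "real^'n"
  have inj: "inj (\<lambda>i::'n. axis i (1::real))" by (auto simp: inj_on_def axis_eq_axis)
  have Basis: "(Basis :: (real^'n) set) = (\<lambda>i. axis i 1) ` UNIV" by (auto simp: Basis_vec_def)
  have D: "D x $ i = d i * x $ i" for x i
  proof -
    have "D x \<bullet> axis i 1 = c (axis i 1) * (x \<bullet> axis i 1)"
      unfolding D_def by (rule inner_sum_left_Basis) auto
    then show ?thesis by (simp add: inner_axis c)
  qed
  have mD[measurable]: "D \<in> borel_measurable borel"
    unfolding D_def by measurable
  have aff: "lborel = density (distr lborel borel D) (\<lambda>_. ennreal (\<Prod>i\<in>UNIV. \<bar>d i\<bar>))"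
  proof -
    have "lborel = density (distr lborel borel (\<lambda>x. 0 + (\<Sum>b\<in>Basis. (c b * (x \<bullet> b)) *\<^sub>R b))) (\<lambda>_. ennreal (\<Prod>b\<in>Basis. \<bar>c b\<bar>))"
      by (rule lborel_affine_euclidean) (use d in \<open>auto simp: Basis c\<close>)
    moreover have "(\<Prod>b\<in>Basis. \<bar>c b\<bar>) = (\<Prod>i\<in>UNIV. \<bar>d i\<bar>)"
      unfolding Basis by (subst prod.reindex[OF inj]) (simp add: c)
    ultimately show ?thesis by (simp add: D_def[abs_def])
  qed
  have "integral\<^sup>L lborel G = integral\<^sup>L (distr lborel borel Q) G"
    by (simp add: lborel_distr_orthogonal[OF Q])
  also have "\<dots> = (\<integral>x. G (Q x) \<partial>lborel)"
    by (rule integral_distr) measurable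
  also have "\<dots> = (\<integral>x. G (Q x) \<partial>density (distr lborel borel D) (\<lambda>_. ennreal (\<Prod>i\<in>UNIV. \<bar>d i\<bar>)))"
    by (subst aff) (rule refl)
  also have "\<dots> = (\<Prod>i\<in>UNIV. \<bar>d i\<bar>) * (\<integral>x. G (Q (D x)) \<partial>lborel)"
    by (subst integral_density) (auto simp: integral_distr prod_nonneg)
  finally show ?thesis by (simp add: Q_def D)
qed

lemma lborel_integral_translate:
  fixes F :: "'a::euclidean_space \<Rightarrow> real"
  assumes "F \<in> borel_measurable borel"
  shows "(\<integral>x. F (z + x) \<partial>lborel) = integral\<^sup>L lborel F"
proof -
  have "integral\<^sup>L lborel F = integral\<^sup>L (distr lborel borel ((+) z)) F"
    by (simp add: lborel_distr_plus)
  also have "\<dots> = (\<integral>x. F (z + x) \<partial>lborel)"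
    by (rule integral_distr) (use assms in auto)
  finally show ?thesis ..
qed

section \<open>Exponential and Gaussian integrals over a paraboloid\<close>

lemma nn_integral_gaussian:
  assumes "0 < a"
  shows "(\<integral>\<^sup>+ x. ennreal (exp (- (a * x\<^sup>2))) \<partial>lborel) = ennreal (sqrt (pi / a))"
proof -
  define \<sigma> where "\<sigma> = sqrt (1 / (2 * a))"
  have \<sigma>: "\<sigma> > 0" "\<sigma>\<^sup>2 = 1 / (2 * a)" using assms by (simp_all add: \<sigma>_def)
  have nd: "exp (- (a * x\<^sup>2)) = sqrt (pi / a) * normal_density 0 \<sigma> x" for x
    unfolding normal_density_def \<sigma>(2) using assms by (simp add: real_sqrt_divide field_simps)
  have "(\<integral>\<^sup>+ x. ennreal (exp (- (a * x\<^sup>2))) \<partial>lborel) = ennreal (\<integral>x. exp (- (a * x\<^sup>2)) \<partial>lborel)"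
    unfolding nd using \<sigma> assms by (intro nn_integral_eq_integral) auto
  also have "(\<integral>x. exp (- (a * x\<^sup>2)) \<partial>lborel) = sqrt (pi / a)"
    unfolding nd using \<sigma> by simp
  finally show ?thesis .
qed

lemma nn_integral_exp_tail:
  assumes "0 < \<beta>" "0 < R"
  shows "(\<integral>\<^sup>+ y. ennreal (indicator {y. S < 2 * R * y} y * exp (- (\<beta> * y))) \<partial>lborel) =
    ennreal (exp (- (\<beta> * S / (2 * R))) / \<beta>)"
proof -
  define c where "c = S / (2 * R)"
  have c: "S < 2 * R * y \<longleftrightarrow> c < y" for y using assms by (simp add: c_def field_simps)
  have "(\<integral>\<^sup>+ y. ennreal (indicator {y. S < 2 * R * y} y * exp (- (\<beta> * y))) \<partial>lborel) =
      (\<integral>\<^sup>+ y. ennreal (exp (- (\<beta> * y))) * indicator {c..} y \<partial>lborel)"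
    \<comment> \<open>The open and the closed half line differ in a single point.\<close>
    by (rule nn_integral_cong_AE, rule AE_mp[OF AE_lborel_singleton[of c]], rule AE_I2)
      (auto simp: c indicator_def)
  also have "\<dots> = ennreal (0 - (- exp (- (\<beta> * c)) / \<beta>))"
  proof (rule nn_integral_FTC_atLeast[where F="\<lambda>y. - exp (- (\<beta> * y)) / \<beta>"])
    show "((\<lambda>y. - exp (- (\<beta> * y)) / \<beta>) \<longlongrightarrow> 0) at_top"
    proof -
      have "filterlim (\<lambda>y. \<beta> * y) at_top at_top"
        by (rule filterlim_tendsto_pos_mult_at_top[OF tendsto_const assms(1) filterlim_ident])
      then have "filterlim (\<lambda>y. - (\<beta> * y)) at_bot at_top"
        by (simp add: filterlim_uminus_at_bot)
      from filterlim_compose[OF exp_at_bot this]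
      have "((\<lambda>y. - exp (- (\<beta> * y)) / \<beta>) \<longlongrightarrow> - 0 / \<beta>) at_top"
        using assms(1) by (intro tendsto_intros) auto
      then show ?thesis by simp
    qed
  qed (use assms in \<open>auto intro!: derivative_eq_intros\<close>)
  finally show ?thesis by (simp add: c_def)
qed

text \<open>Integrating first along axis k over \<eta>_k > S / (2 R), with S the sum of the
  tangential squares, leaves exp(-\<beta> S / (2 R)) / \<beta>. The rest is a product of
  one-dimensional Gaussians with positive coefficients \<beta> / (2 R) - b i. The lemma serves
  twice: b i = \<beta> kap i / 2 gives the limit integral, b = 0 a dominating function.\<close>

lemma nn_integral_paraboloid:
  fixes k :: "'n::finite" and b :: "'n \<Rightarrow> real"
  assumes \<beta>: "0 < \<beta>" and R: "0 < R" and b: "\<And>i. i \<noteq> k \<Longrightarrow> b i < \<beta> / (2 * R)"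
  shows "(\<integral>\<^sup>+ \<eta>. ennreal (indicator {\<eta> :: real^'n. (\<Sum>i\<in>-{k}. (\<eta> $ i)\<^sup>2) < 2 * R * \<eta> $ k} \<eta> *
      exp (- (\<beta> * \<eta> $ k) + (\<Sum>i\<in>-{k}. b i * (\<eta> $ i)\<^sup>2))) \<partial>lborel) =
    ennreal ((\<Prod>i\<in>-{k}. sqrt (pi / (\<beta> / (2 * R) - b i))) / \<beta>)"
proof -
  interpret product_sigma_finite "\<lambda>_::real^'n. lborel :: real measure"
    by standard
  define f where "f \<eta> = ennreal (indicator {\<eta> :: real^'n. (\<Sum>i\<in>-{k}. (\<eta> $ i)\<^sup>2) < 2 * R * \<eta> $ k} \<eta> *
      exp (- (\<beta> * \<eta> $ k) + (\<Sum>i\<in>-{k}. b i * (\<eta> $ i)\<^sup>2)))" for \<eta>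
  have meas: "f \<in> borel_measurable borel"
    unfolding f_def by measurable
  define B0 :: "(real^'n) set" where "B0 = (\<lambda>i. axis i 1) ` (-{k})"
  have inj: "inj_on (\<lambda>i. axis i (1::real)) A" for A :: "'n set"
    by (auto simp: inj_on_def axis_eq_axis)
  have Basis: "(Basis :: (real^'n) set) = insert (axis k 1) B0" "axis k 1 \<notin> B0" "finite B0"
    by (auto simp: B0_def Basis_vec_def axis_eq_axis)
  define v where "v \<omega> = (\<Sum>b\<in>Basis. \<omega> b *\<^sub>R b)" for \<omega> :: "real^'n \<Rightarrow> real"
  have vc: "v \<omega> $ i = \<omega> (axis i 1)" for \<omega> i
  proof -
    have "v \<omega> \<bullet> axis i 1 = \<omega> (axis i 1)"
      unfolding v_def by (rule inner_sum_left_Basis) auto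
    then show ?thesis by (simp add: inner_axis)
  qed
  define a where "a i = \<beta> / (2 * R) - b i" for i
  have a: "0 < a i" if "i \<noteq> k" for i
    using b[OF that] by (simp add: a_def)
  define a' where "a' x = a (the_inv (\<lambda>i. axis i 1) x)" for x :: "real^'n"
  have a': "a' (axis i 1) = a i" for i
    unfolding a'_def by (simp add: the_inv_f_f[OF inj])
  have "(\<integral>\<^sup>+ \<eta>. f \<eta> \<partial>lborel) = (\<integral>\<^sup>+ \<omega>. f (v \<omega>) \<partial>(\<Pi>\<^sub>M b\<in>Basis. lborel))"
    unfolding v_def by (subst lborel_eq, subst nn_integral_distr) (use meas in auto)
  also have "\<dots> = (\<integral>\<^sup>+ \<omega>. (\<integral>\<^sup>+ y. f (v (fun_upd \<omega> (axis k 1) y)) \<partial>lborel) \<partial>(\<Pi>\<^sub>M b\<in>B0. lborel))"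
    unfolding Basis(1)
  proof (rule product_nn_integral_insert[OF Basis(3,2)])
    show "(\<lambda>\<omega>. f (v \<omega>)) \<in> borel_measurable (\<Pi>\<^sub>M b\<in>insert (axis k 1) B0. lborel)"
      unfolding Basis(1)[symmetric] v_def by (intro measurable_compose[OF _ meas]) measurable
  qed
  also have "\<dots> = (\<integral>\<^sup>+ \<omega>. ennreal (1 / \<beta>) * (\<Prod>x\<in>B0. ennreal (exp (- (a' x * (\<omega> x)\<^sup>2)))) \<partial>(\<Pi>\<^sub>M b\<in>B0. lborel))"
  proof (rule nn_integral_cong)
    fix \<omega> :: "real^'n \<Rightarrow> real"
    define S where "S = (\<Sum>i\<in>-{k}. (\<omega> (axis i 1))\<^sup>2)"
    define T where "T = (\<Sum>i\<in>-{k}. b i * (\<omega> (axis i 1))\<^sup>2)"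
    have "f (v (fun_upd \<omega> (axis k 1) y)) = ennreal (exp T) * ennreal (indicator {y. S < 2 * R * y} y * exp (- (\<beta> * y)))" for y
    proof -
      have "(\<Sum>i\<in>-{k}. c i * (fun_upd \<omega> (axis k 1) y (axis i 1))\<^sup>2) = (\<Sum>i\<in>-{k}. c i * (\<omega> (axis i 1))\<^sup>2)" for c
        by (intro sum.cong) (auto simp: axis_eq_axis)
      from this[of b] this[of "\<lambda>_. 1"] show ?thesis
        by (simp add: f_def vc S_def T_def ennreal_mult[symmetric] indicator_def exp_diff exp_minus divide_inverse)
    qed
    then have "(\<integral>\<^sup>+ y. f (v (fun_upd \<omega> (axis k 1) y)) \<partial>lborel) = ennreal (exp T) * ennreal (exp (- (\<beta> * S / (2 * R))) / \<beta>)"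
      by (simp add: nn_integral_cmult nn_integral_exp_tail[OF \<beta> R])
    also have "\<dots> = ennreal (1 / \<beta> * exp (- (\<Sum>i\<in>-{k}. a i * (\<omega> (axis i 1))\<^sup>2)))"
    proof -
      have "(\<Sum>i\<in>-{k}. a i * (\<omega> (axis i 1))\<^sup>2) = \<beta> * S / (2 * R) - T"
        by (simp add: a_def S_def T_def left_diff_distrib sum_subtractf sum_distrib_left sum_divide_distrib)
      then have eq: "\<beta> * S / (2 * R) = T + (\<Sum>i\<in>-{k}. a i * (\<omega> (axis i 1))\<^sup>2)"
        by simp
      show ?thesis
        unfolding eq using \<beta> by (simp add: ennreal_mult[symmetric] exp_diff exp_minus field_simps)
    qed
    also have "exp (- (\<Sum>i\<in>-{k}. a i * (\<omega> (axis i 1))\<^sup>2)) = (\<Prod>x\<in>B0. exp (- (a' x * (\<omega> x)\<^sup>2)))"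
      unfolding B0_def by (subst prod.reindex[OF inj]) (simp add: exp_sum sum_negf[symmetric] a')
    finally show "(\<integral>\<^sup>+ y. f (v (fun_upd \<omega> (axis k 1) y)) \<partial>lborel) =
        ennreal (1 / \<beta>) * (\<Prod>x\<in>B0. ennreal (exp (- (a' x * (\<omega> x)\<^sup>2))))"
      using \<beta> by (subst (asm) ennreal_mult) (auto simp: prod_ennreal prod_nonneg)
  qed
  also have "\<dots> = ennreal (1 / \<beta>) * (\<integral>\<^sup>+ \<omega>. (\<Prod>x\<in>B0. ennreal (exp (- (a' x * (\<omega> x)\<^sup>2)))) \<partial>(\<Pi>\<^sub>M b\<in>B0. lborel))"
    by (rule nn_integral_cmult) measurable
  also have "(\<integral>\<^sup>+ \<omega>. (\<Prod>x\<in>B0. ennreal (exp (- (a' x * (\<omega> x)\<^sup>2)))) \<partial>(\<Pi>\<^sub>M b\<in>B0. lborel)) =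
      (\<Prod>x\<in>B0. (\<integral>\<^sup>+ t. ennreal (exp (- (a' x * t\<^sup>2))) \<partial>lborel))"
    by (rule product_nn_integral_prod[OF Basis(3)]) measurable
  also have "\<dots> = (\<Prod>i\<in>-{k}. (\<integral>\<^sup>+ t. ennreal (exp (- (a i * t\<^sup>2))) \<partial>lborel))"
    unfolding B0_def by (subst prod.reindex[OF inj]) (simp add: a')
  also have "\<dots> = (\<Prod>i\<in>-{k}. ennreal (sqrt (pi / a i)))"
    by (intro prod.cong refl nn_integral_gaussian a) auto
  also have "\<dots> = ennreal (\<Prod>i\<in>-{k}. sqrt (pi / a i))"
    by (intro prod_ennreal) (auto simp: less_imp_le[OF a])
  also have "ennreal (1 / \<beta>) * \<dots> = ennreal ((\<Prod>i\<in>-{k}. sqrt (pi / a i)) / \<beta>)"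
  proof -
    have "0 \<le> (\<Prod>i\<in>-{k}. sqrt (pi / a i))"
      by (intro prod_nonneg) (auto simp: less_imp_le[OF a])
    then show ?thesis
      using \<beta> by (subst ennreal_mult[symmetric]) auto
  qed
  finally show ?thesis by (simp add: f_def a_def)
qed

section \<open>The \<open>q\<close>-means\<close>

text \<open>This is sign(s) |s|^p, the derivative of |s|^(p+1) / (p+1). It is split into its two
  parts because they have different asymptotics: one lives in the boundary layer, the other in the
  bulk of the ball.\<close>

definition signed_powr :: "real \<Rightarrow> real \<Rightarrow> real" where
  "signed_powr p s = max s 0 powr p - max (- s) 0 powr p"

lemma signed_powr_strict_mono:
  assumes "0 < p" "s < t"
  shows "signed_powr p s < signed_powr p t"
proof (cases "0 < t")
  case True
  have "max s 0 powr p < max t 0 powr p"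
    using assms True by (intro powr_less_mono2) auto
  moreover have "max (- t) 0 powr p \<le> max (- s) 0 powr p"
    using assms by (intro powr_mono2) auto
  ultimately show ?thesis by (simp add: signed_powr_def)
next
  case False
  have "max (- t) 0 powr p < max (- s) 0 powr p"
    using assms False by (intro powr_less_mono2) auto
  moreover have "max s 0 powr p \<le> max t 0 powr p"
    using assms by (intro powr_mono2) auto
  ultimately show ?thesis by (simp add: signed_powr_def)
qed

lemma has_real_derivative_abs_powr:
  fixes q s :: real
  assumes "1 < q"
  shows "((\<lambda>s. \<bar>s\<bar> powr q) has_real_derivative q * signed_powr (q - 1) s) (at s)"
proof -
  consider "s > 0" | "s < 0" | "s = 0" by linarith
  then show ?thesis
  proof cases
    case 1
    have "((\<lambda>s. s powr q) has_real_derivative q * s powr (q - 1)) (at s)"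
      using 1 by (rule has_real_derivative_powr)
    then have "((\<lambda>s. \<bar>s\<bar> powr q) has_real_derivative q * s powr (q - 1)) (at s)"
      by (rule has_field_derivative_transform_within_open[of _ _ _ "{0<..}"]) (use 1 in auto)
    then show ?thesis using 1 assms by (simp add: signed_powr_def max_def)
  next
    case 2
    have "((\<lambda>s. (- s) powr q) has_real_derivative (q * (- s) powr (q - 1)) * - 1) (at s)"
      by (rule DERIV_chain2[OF has_real_derivative_powr]) (use 2 in \<open>auto intro!: derivative_eq_intros\<close>)
    then have "((\<lambda>s. \<bar>s\<bar> powr q) has_real_derivative (q * (- s) powr (q - 1)) * - 1) (at s)"
      by (rule has_field_derivative_transform_within_open[of _ _ _ "{..<0}"]) (use 2 in auto)
    then show ?thesis using 2 assms by (simp add: signed_powr_def max_def)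
  next
    case 3
    have "((\<lambda>h. \<bar>h\<bar> powr (q - 1)) \<longlongrightarrow> \<bar>0\<bar> powr (q - 1)) (at (0::real))"
      using assms by (intro tendsto_powr2 tendsto_intros) auto
    then have 0: "((\<lambda>h. \<bar>h\<bar> powr (q - 1)) \<longlongrightarrow> 0) (at (0::real))"
      using assms by simp
    \<comment> \<open>At 0 the difference quotient has size |h|^(q-1), which vanishes because q >
      1.\<close>
    have "norm (\<bar>h\<bar> powr q / h) \<le> \<bar>h\<bar> powr (q - 1)" for h :: real
      using powr_diff[of "\<bar>h\<bar>" q 1] by (cases "h = 0") auto
    then have "\<forall>\<^sub>F h in at (0::real). norm (\<bar>h\<bar> powr q / h) \<le> \<bar>h\<bar> powr (q - 1)"
      by (intro always_eventually allI)
    then have "((\<lambda>h. \<bar>h\<bar> powr q / h) \<longlongrightarrow> 0) (at 0)"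
      by (rule Lim_null_comparison) (rule 0)
    then show ?thesis using 3 assms by (simp add: DERIV_def signed_powr_def)
  qed
qed

text \<open>The mean value theorem with a strictly increasing first derivative. A second-derivative
  argument would break down at 0 for q < 2.\<close>

lemma abs_powr_strictly_convex:
  assumes q: "1 < q" and "s \<noteq> (t::real)"
  shows "\<bar>s\<bar> powr q + q * signed_powr (q - 1) s * (t - s) < \<bar>t\<bar> powr q"
proof (cases "s < t")
  case True
  obtain \<xi> where \<xi>: "s < \<xi>" "\<xi> < t" "\<bar>t\<bar> powr q - \<bar>s\<bar> powr q = (t - s) * (q * signed_powr (q - 1) \<xi>)"
    using MVT2[OF True has_real_derivative_abs_powr[OF q]] by blast
  have "signed_powr (q - 1) s < signed_powr (q - 1) \<xi>"
    using q \<xi> by (intro signed_powr_strict_mono) auto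
  then have "q * (t - s) * signed_powr (q - 1) s < q * (t - s) * signed_powr (q - 1) \<xi>"
    using q True by (intro mult_strict_left_mono) auto
  then show ?thesis using \<xi>(3) by (simp add: algebra_simps)
next
  case False
  then have "t < s" using assms by simp
  obtain \<xi> where \<xi>: "t < \<xi>" "\<xi> < s" "\<bar>s\<bar> powr q - \<bar>t\<bar> powr q = (s - t) * (q * signed_powr (q - 1) \<xi>)"
    using MVT2[OF \<open>t < s\<close> has_real_derivative_abs_powr[OF q]] by blast
  have "signed_powr (q - 1) \<xi> < signed_powr (q - 1) s"
    using q \<xi> by (intro signed_powr_strict_mono) auto
  then have "q * (s - t) * signed_powr (q - 1) \<xi> < q * (s - t) * signed_powr (q - 1) s"
    using q \<open>t < s\<close> by (intro mult_strict_left_mono) auto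
  then show ?thesis using \<xi>(3) by (simp add: algebra_simps)
qed

section \<open>The q-mean as the zero of a monotone balance function\<close>

lemma set_integral_nonneg:
  fixes f :: "'a \<Rightarrow> real"
  assumes "\<And>y. y \<in> A \<Longrightarrow> 0 \<le> f y"
  shows "0 \<le> (LINT y:A|M. f y)"
  unfolding set_lebesgue_integral_def
  by (intro integral_nonneg_AE AE_I2) (use assms in \<open>auto simp: indicator_def\<close>)

lemma Lq_norm_real:
  "Lq_norm (ereal q) B f = ereal ((LINT y:B|lborel. \<bar>f y\<bar> powr q) powr (1 / q))"
  by (simp add: Lq_norm_def)

locale unit_function_on_ball =
  fixes x :: "real^'n" and R :: real and u :: "real^'n \<Rightarrow> real"
  assumes R_pos: "0 < R" and cont: "continuous_on (ball x R) u"
    and range: "\<And>y. y \<in> ball x R \<Longrightarrow> 0 \<le> u y \<and> u y \<le> 1"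
begin

lemma measurable_indicator_u: "(\<lambda>y. indicator (ball x R) y * u y) \<in> borel_measurable borel"
  using borel_measurable_continuous_on_indicator[OF _ cont] by simp

lemma measurable_compose_u:
  assumes [measurable]: "F \<in> borel_measurable (borel :: real measure)"
  shows "(\<lambda>y. indicator (ball x R) y * F (u y) :: real) \<in> borel_measurable borel"
proof -
  have [measurable]: "ball x R \<in> sets borel" by simp
  note measurable_indicator_u[measurable]
  \<comment> \<open>Nothing is known about u outside the ball, so it is cut off inside F as
    well.\<close>
  have "(\<lambda>y. indicator (ball x R) y * F (indicator (ball x R) y * u y)) \<in> borel_measurable borel"
    by measurable
  moreover have "(\<lambda>y. indicator (ball x R) y * F (indicator (ball x R) y * u y)) =
      (\<lambda>y. indicator (ball x R) y * F (u y))"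
    by (auto simp: indicator_def)
  ultimately show ?thesis by simp
qed

lemma integrable_indicator_ball: "integrable lborel (\<lambda>y. indicator (ball x R) y * (C::real))"
proof -
  have "emeasure lborel (ball x R) < \<infinity>" by (rule emeasure_lborel_ball_finite)
  then show ?thesis by (intro integrable_mult_left) (auto intro: integrable_real_indicator)
qed

lemma integrable_compose_u:
  fixes F :: "real \<Rightarrow> real"
  assumes F: "F \<in> borel_measurable (borel :: real measure)" and C: "\<And>t. 0 \<le> t \<Longrightarrow> t \<le> 1 \<Longrightarrow> \<bar>F t\<bar> \<le> C"
  shows "set_integrable lborel (ball x R) (\<lambda>y. F (u y))"
  unfolding set_integrable_def real_scaleR_def
proof (rule Bochner_Integration.integrable_bound[OF integrable_indicator_ball[of C]])
  show "(\<lambda>y. indicator (ball x R) y * F (u y)) \<in> borel_measurable lborel"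
    using measurable_compose_u[OF F] by simp
  show "AE y in lborel. norm (indicator (ball x R) y * F (u y)) \<le> norm (indicator (ball x R) y * C)"
  proof (rule AE_I2)
    fix y
    show "norm (indicator (ball x R) y * F (u y)) \<le> norm (indicator (ball x R) y * C)"
      using C[of "u y"] range[of y] by (cases "y \<in> ball x R") auto
  qed
qed

text \<open>Up to the factor \<open>- q\<close>, with \<open>p = q - 1\<close>, the derivative in \<open>m\<close> of the \<open>q\<close>-th power of
  the \<open>L\<^sup>q\<close> distance from \<open>u\<close> to \<open>m\<close>.\<close>

definition balance :: "real \<Rightarrow> real \<Rightarrow> real" where
  "balance p m = (LINT y:ball x R|lborel. max (u y - m) 0 powr p) - (LINT y:ball x R|lborel. max (m - u y) 0 powr p)"

lemma integrable_parts:
  assumes "0 < p"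
  shows "set_integrable lborel (ball x R) (\<lambda>y. max (u y - m) 0 powr p)"
    "set_integrable lborel (ball x R) (\<lambda>y. max (m - u y) 0 powr p)"
    "set_integrable lborel (ball x R) (\<lambda>y. \<bar>u y - m\<bar> powr p)"
  by (rule integrable_compose_u[where C="(1 + \<bar>m\<bar>) powr p"]; use assms in \<open>auto intro!: powr_mono2\<close>)+

lemma balance_eq:
  assumes "0 < p"
  shows "set_integrable lborel (ball x R) (\<lambda>y. signed_powr p (u y - m))"
    "balance p m = (LINT y:ball x R|lborel. signed_powr p (u y - m))"
  using integrable_parts(1,2)[OF assms, of m] unfolding balance_def signed_powr_def
  by (simp_all add: set_integral_diff)

lemma balance_antimono:
  assumes "0 < p" "m \<le> m'"
  shows "balance p m' \<le> balance p m"
proof -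
  have "signed_powr p (u y - m') \<le> signed_powr p (u y - m)" for y
    using signed_powr_strict_mono[OF assms(1), of "u y - m'" "u y - m"] assms(2) by (cases "m = m'") auto
  then show ?thesis
    unfolding balance_eq(2)[OF assms(1)] by (intro set_integral_mono balance_eq assms)
qed

lemma continuous_signed_powr:
  assumes "0 < p"
  shows "continuous_on UNIV (signed_powr p)"
  unfolding signed_powr_def using assms
  by (intro continuous_intros continuous_on_powr') auto

text \<open>Intermediate values on [0, 1]: because 0 \<le> u \<le> 1, one of the two integrals
  vanishes at each endpoint. Continuity in m is dominated convergence, the integrand being at most 1
  since |u - m| \<le> 1.\<close>

lemma ex_balance_0:
  assumes p: "0 < p"
  shows "\<exists>m. balance p m = 0"
proof -
  have "continuous_on {0..1} (balance p)"
  proof (clarsimp simp: continuous_on_sequentially)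
    fix X m assume X: "\<forall>n. 0 \<le> X n \<and> X n \<le> (1::real)" "X \<longlonglongrightarrow> m" and m: "0 \<le> m" "m \<le> 1"
    have sm: "signed_powr p \<in> borel_measurable borel"
      by (rule borel_measurable_continuous_onI[OF continuous_signed_powr[OF p]])
    have meas: "(\<lambda>y. indicator (ball x R) y * signed_powr p (u y - a)) \<in> borel_measurable lborel" for a
      using measurable_compose_u[of "\<lambda>t. signed_powr p (t - a)"] sm by simp
    have bd: "\<bar>signed_powr p t\<bar> \<le> 1" if "\<bar>t\<bar> \<le> 1" for t
    proof -
      have "max t 0 powr p \<le> 1 powr p" "max (- t) 0 powr p \<le> 1 powr p"
        using that p by (intro powr_mono2; simp)+
      moreover have "0 \<le> max t 0 powr p" "0 \<le> max (- t) 0 powr p" by simp_all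
      ultimately show ?thesis unfolding signed_powr_def powr_one_eq_one by linarith
    qed
    have "(\<lambda>n. \<integral>y. indicator (ball x R) y * signed_powr p (u y - X n) \<partial>lborel) \<longlonglongrightarrow>
        (\<integral>y. indicator (ball x R) y * signed_powr p (u y - m) \<partial>lborel)"
    proof (rule integral_dominated_convergence[OF meas meas integrable_indicator_ball[of 1]])
      show "AE y in lborel. (\<lambda>n. indicator (ball x R) y * signed_powr p (u y - X n)) \<longlonglongrightarrow>
          indicator (ball x R) y * signed_powr p (u y - m)"
      proof (rule AE_I2)
        fix y
        have "isCont (signed_powr p) (u y - m)"
          using continuous_signed_powr[OF p] by (simp add: continuous_on_eq_continuous_at)
        then have "(\<lambda>n. signed_powr p (u y - X n)) \<longlonglongrightarrow> signed_powr p (u y - m)"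
          by (rule isCont_tendsto_compose) (intro tendsto_intros X)
        then show "(\<lambda>n. indicator (ball x R) y * signed_powr p (u y - X n)) \<longlonglongrightarrow>
            indicator (ball x R) y * signed_powr p (u y - m)"
          by (rule tendsto_mult_left)
      qed
      fix n
      have "\<bar>u y - X n\<bar> \<le> 1" if "y \<in> ball x R" for y
        using range[OF that] X(1) by (auto simp: abs_le_iff) (smt (verit))+
      then show "AE y in lborel. norm (indicator (ball x R) y * signed_powr p (u y - X n)) \<le> indicator (ball x R) y * 1"
        by (intro AE_I2) (auto simp: indicator_def intro!: bd)
    qed
    then show "(balance p \<circ> X) \<longlonglongrightarrow> balance p m"
      by (simp add: o_def balance_eq(2)[OF p] set_lebesgue_integral_def)
  qed
  moreover have "balance p 1 \<le> 0"
  proof -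
    have "(LINT y:ball x R|lborel. max (u y - 1) 0 powr p) = (LINT y:ball x R|lborel. 0)"
      using range by (intro set_lebesgue_integral_cong) auto
    moreover have "0 \<le> (LINT y:ball x R|lborel. max (1 - u y) 0 powr p)"
      by (intro set_integral_nonneg) auto
    ultimately show ?thesis by (simp add: balance_def)
  qed
  moreover have "0 \<le> balance p 0"
  proof -
    have "(LINT y:ball x R|lborel. max (0 - u y) 0 powr p) = (LINT y:ball x R|lborel. 0)"
      using range by (intro set_lebesgue_integral_cong) auto
    moreover have "0 \<le> (LINT y:ball x R|lborel. max (u y - 0) 0 powr p)"
      by (intro set_integral_nonneg) auto
    ultimately show ?thesis by (simp add: balance_def)
  qed
  ultimately show ?thesis
    using IVT2'[of "balance p" 1 0 0] by auto
qed

text \<open>Integrate the strict tangent-line inequality for |s|^q. Its first-order term is a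
  multiple of \<open>balance (q - 1) m\<close> and vanishes, and strictness survives because the
  ball has positive measure.\<close>

lemma Lq_norm_less:
  assumes q: "1 < q" and m: "balance (q - 1) m = 0" and "m' \<noteq> m"
  shows "Lq_norm (ereal q) (ball x R) (\<lambda>y. u y - m) < Lq_norm (ereal q) (ball x R) (\<lambda>y. u y - m')"
proof -
  define f where "f y = \<bar>u y - m'\<bar> powr q - (\<bar>u y - m\<bar> powr q + (q * (m - m')) * signed_powr (q - 1) (u y - m))" for y
  have i: "set_integrable lborel (ball x R) (\<lambda>y. \<bar>u y - m'\<bar> powr q)"
    "set_integrable lborel (ball x R) (\<lambda>y. \<bar>u y - m\<bar> powr q)"
    "set_integrable lborel (ball x R) (\<lambda>y. (q * (m - m')) * signed_powr (q - 1) (u y - m))"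
    using q by (auto intro!: integrable_parts balance_eq)
  then have if': "set_integrable lborel (ball x R) f"
    unfolding f_def by (intro set_integral_diff set_integral_add)
  have "(LINT y:ball x R|lborel. f y) = (LINT y:ball x R|lborel. \<bar>u y - m'\<bar> powr q) -
      ((LINT y:ball x R|lborel. \<bar>u y - m\<bar> powr q) + (LINT y:ball x R|lborel. (q * (m - m')) * signed_powr (q - 1) (u y - m)))"
    unfolding f_def using i by (simp add: set_integral_diff set_integral_add)
  also have "(LINT y:ball x R|lborel. (q * (m - m')) * signed_powr (q - 1) (u y - m)) = 0"
    using m balance_eq(2)[of "q - 1" m] q by simp
  finally have eq: "(LINT y:ball x R|lborel. f y) = (LINT y:ball x R|lborel. \<bar>u y - m'\<bar> powr q) - (LINT y:ball x R|lborel. \<bar>u y - m\<bar> powr q)"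
    by simp
  have fpos: "0 < f y" for y
    using abs_powr_strictly_convex[OF q, of "u y - m" "u y - m'"] \<open>m' \<noteq> m\<close> by (simp add: f_def algebra_simps)
  have "(LINT y:ball x R|lborel. f y) \<noteq> 0"
  proof
    assume "(LINT y:ball x R|lborel. f y) = 0"
    then have "AE y in lborel. indicator (ball x R) y * f y = 0"
      using if' fpos unfolding set_lebesgue_integral_def set_integrable_def
      by (subst (asm) integral_nonneg_eq_0_iff_AE) (auto simp: less_imp_le)
    then have "AE y in lborel. y \<notin> ball x R"
      using fpos by (auto elim!: eventually_mono simp: indicator_def less_le split: if_splits)
    then have "emeasure lborel (ball x R) = 0"
      by (subst (asm) AE_iff_measurable[of "ball x R"]) auto
    then show False
      using content_ball_pos[OF R_pos, of x] by (simp add: measure_def)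
  qed
  moreover have "0 \<le> (LINT y:ball x R|lborel. f y)"
    using fpos by (intro set_integral_nonneg) (auto simp: less_imp_le)
  ultimately have "(LINT y:ball x R|lborel. \<bar>u y - m\<bar> powr q) < (LINT y:ball x R|lborel. \<bar>u y - m'\<bar> powr q)"
    using eq by linarith
  moreover have "0 \<le> (LINT y:ball x R|lborel. \<bar>u y - m\<bar> powr q)"
    by (intro set_integral_nonneg) auto
  ultimately show ?thesis
    using q unfolding Lq_norm_real by (simp add: powr_less_mono2)
qed

text \<open>The strict inequality makes the zero of the balance the only minimiser, which resolves
  the description operator in \<open>q_mean\<close>.\<close>

lemma balance_q_mean:
  assumes q: "1 < q"
  shows "balance (q - 1) (q_mean (ereal q) (ball x R) u) = 0"
proof -
  obtain m where m: "balance (q - 1) m = 0"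
    using ex_balance_0[of "q - 1"] q by auto
  have "q_mean (ereal q) (ball x R) u = m"
    unfolding q_mean_def
  proof (rule the_equality)
    show "\<forall>m'. Lq_norm (ereal q) (ball x R) (\<lambda>y. u y - m) \<le> Lq_norm (ereal q) (ball x R) (\<lambda>y. u y - m')"
      using Lq_norm_less[OF q m] by (metis less_imp_le order_refl)
    show "m'' = m" if "\<forall>m'. Lq_norm (ereal q) (ball x R) (\<lambda>y. u y - m'') \<le> Lq_norm (ereal q) (ball x R) (\<lambda>y. u y - m')" for m''
      using Lq_norm_less[OF q m, of m''] that by (metis not_less)
  qed
  with m show ?thesis by simp
qed

text \<open>The balance decreases in m and vanishes at the q-mean, so its sign at a trial level
  tells on which side the q-mean lies. The asymptotics can thus be read from explicit trial
  levels.\<close>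

lemma q_mean_le:
  assumes "1 < q" "balance (q - 1) m < 0"
  shows "q_mean (ereal q) (ball x R) u \<le> m"
  using balance_antimono[of "q - 1" m "q_mean (ereal q) (ball x R) u"] balance_q_mean[OF assms(1)] assms
  by (cases "q_mean (ereal q) (ball x R) u \<le> m") auto

lemma q_mean_ge:
  assumes "1 < q" "0 < balance (q - 1) m"
  shows "m \<le> q_mean (ereal q) (ball x R) u"
  using balance_antimono[of "q - 1" "q_mean (ereal q) (ball x R) u" m] balance_q_mean[OF assms(1)] assms
  by (cases "m \<le> q_mean (ereal q) (ball x R) u") auto

text \<open>By continuity the essential supremum is a plain supremum: a value above it would persist
  on a nonempty open set, which has positive measure. The hypothesis pins the supremum of u at 1, so
  only its infimum remains in the formula.\<close>

lemma Lq_norm_infinity: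
  assumes sup: "\<And>\<delta>. \<delta> > 0 \<Longrightarrow> \<exists>y\<in>ball x R. 1 - \<delta> < u y"
  shows "Lq_norm \<infinity> (ball x R) (\<lambda>y. u y - m) = ereal (max (1 - m) (m - Inf (u ` ball x R)))"
proof -
  define M where "M = restrict_space lborel (ball x R)"
  define E where "E = esssup M (\<lambda>y. ereal \<bar>u y - m\<bar>)"
  define a where "a = Inf (u ` ball x R)"
  have bdd: "bdd_below (u ` ball x R)" using range by (auto intro!: bdd_belowI[of _ 0])
  have a: "a \<le> u y" if "y \<in> ball x R" for y
    unfolding a_def by (rule cInf_lower[OF _ bdd]) (use that in auto)
  have meas: "(\<lambda>y. ereal \<bar>u y - m\<bar>) \<in> borel_measurable M"
  proof -
    have "(\<lambda>y. \<bar>u y - m\<bar>) \<in> borel_measurable (restrict_space borel (ball x R))"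
      by (intro borel_measurable_continuous_on_restrict continuous_intros cont)
    moreover have "sets M = sets (restrict_space borel (ball x R))"
      by (simp add: M_def sets_restrict_space)
    ultimately have "(\<lambda>y. \<bar>u y - m\<bar>) \<in> borel_measurable M"
      by (simp cong: measurable_cong_sets)
    then show ?thesis by (rule borel_measurable_ereal)
  qed
  have E_ge: "ereal \<bar>u y - m\<bar> \<le> E" if y: "y \<in> ball x R" for y
  proof (rule ccontr)
    assume "\<not> ?thesis"
    then have lt: "E < ereal \<bar>u y - m\<bar>" by simp
    then obtain c where c: "E < ereal c" "c < \<bar>u y - m\<bar>"
      using ereal_dense2[OF lt] by auto
    define W where "W = ball x R \<inter> (\<lambda>y. \<bar>u y - m\<bar>) -` {c<..}"
    have "open W" unfolding W_def
      by (intro continuous_open_preimage continuous_intros cont) auto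
    have "AE y in M. ereal \<bar>u y - m\<bar> \<le> E" unfolding E_def by (rule esssup_AE)
    then have "AE y in M. y \<notin> W"
    proof (rule eventually_mono)
      fix w assume "ereal \<bar>u w - m\<bar> \<le> E"
      then have "ereal \<bar>u w - m\<bar> < ereal c" using c(1) by (rule le_less_trans)
      then show "w \<notin> W" by (simp add: W_def)
    qed
    then have "AE y in lborel. y \<notin> W"
      unfolding M_def by (subst (asm) AE_restrict_space_iff) (auto simp: W_def)
    then have "emeasure lborel W = 0"
      using \<open>open W\<close> by (subst (asm) AE_iff_measurable[of W]) auto
    moreover have "y \<in> W" using y c by (simp add: W_def)
    ultimately show False
      using open_not_negligible[OF \<open>open W\<close>] by (auto simp: negligible_iff_emeasure0 \<open>open W\<close> negligible_iff_null_sets null_sets_def)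
  qed
  have "E \<le> ereal (max (1 - m) (m - a))"
    unfolding E_def
  proof (rule esssup_I[OF meas], rule AE_I2)
    fix y assume "y \<in> space M"
    then have "y \<in> ball x R" by (simp add: M_def space_restrict_space)
    then have "\<bar>u y - m\<bar> \<le> max (1 - m) (m - a)"
      using range[of y] a[of y] by linarith
    then show "ereal \<bar>u y - m\<bar> \<le> ereal (max (1 - m) (m - a))"
      by (simp only: ereal_less_eq)
  qed
  moreover have "ereal (1 - m) \<le> E"
  proof (rule ereal_le_epsilon2)
    fix \<delta> :: real assume "0 < \<delta>"
    then obtain y where y: "y \<in> ball x R" "1 - \<delta> < u y" using sup by blast
    then have "ereal (1 - m) \<le> ereal \<bar>u y - m\<bar> + ereal \<delta>" by auto
    also have "\<dots> \<le> E + ereal \<delta>" by (intro add_right_mono E_ge y)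
    finally show "ereal (1 - m) \<le> E + ereal \<delta>" .
  qed
  moreover have "ereal (m - a) \<le> E"
  proof (rule ereal_le_epsilon2)
    fix \<delta> :: real assume \<delta>: "0 < \<delta>"
    have "u ` ball x R \<noteq> {}" using R_pos by auto
    then obtain y where y: "y \<in> ball x R" "u y < a + \<delta>"
      using cInf_lessD[of "u ` ball x R" "a + \<delta>"] \<delta> by (auto simp: a_def)
    then have "ereal (m - a) \<le> ereal \<bar>u y - m\<bar> + ereal \<delta>" by auto
    also have "\<dots> \<le> E + ereal \<delta>" by (intro add_right_mono E_ge y)
    finally show "ereal (m - a) \<le> E + ereal \<delta>" .
  qed
  ultimately have "E = ereal (max (1 - m) (m - a))"
    by (intro antisym) (auto simp: max_def)
  then show ?thesis by (simp add: Lq_norm_def E_def M_def a_def)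
qed

text \<open>The branches 1 - m and m - Inf have opposite slopes, so their maximum is smallest
  exactly where they cross.\<close>

lemma q_mean_infinity:
  assumes sup: "\<And>\<delta>. \<delta> > 0 \<Longrightarrow> \<exists>y\<in>ball x R. 1 - \<delta> < u y"
  shows "q_mean \<infinity> (ball x R) u = (1 + Inf (u ` ball x R)) / 2"
  unfolding q_mean_def
proof (rule the_equality)
  define a where "a = Inf (u ` ball x R)"
  have Lq: "Lq_norm \<infinity> (ball x R) (\<lambda>y. u y - m) = ereal (max (1 - m) (m - a))" for m
    unfolding a_def using sup by (rule Lq_norm_infinity)
  show "\<forall>m'. Lq_norm \<infinity> (ball x R) (\<lambda>y. u y - (1 + Inf (u ` ball x R)) / 2) \<le> Lq_norm \<infinity> (ball x R) (\<lambda>y. u y - m')"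
    unfolding a_def[symmetric] Lq by (auto simp: max_def field_simps)
  fix m assume "\<forall>m'. Lq_norm \<infinity> (ball x R) (\<lambda>y. u y - m) \<le> Lq_norm \<infinity> (ball x R) (\<lambda>y. u y - m')"
  from this[rule_format, of "(1 + a) / 2"]
  show "m = (1 + Inf (u ` ball x R)) / 2"
    unfolding a_def[symmetric] Lq by (simp add: max_def field_simps split: if_splits)
qed

end

lemma exp_inverse_powr_limit:
  assumes "0 < (d::real)"
  shows "((\<lambda>\<epsilon>. exp (- (d / \<epsilon>)) / \<epsilon> powr a) \<longlongrightarrow> 0) (at_right 0)"
proof -
  \<comment> \<open>The exponent is rounded up to a natural number, since \<epsilon>^n \<le>
    \<epsilon>^a for \<epsilon> < 1 and the exponential beats integer powers.\<close>
  define n where "n = nat \<lceil>a\<rceil>"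
  have n: "a \<le> real n" unfolding n_def by (rule real_nat_ceiling_ge)
  have "filterlim (\<lambda>\<epsilon>. d * inverse \<epsilon>) at_top (at_right 0)"
    by (rule filterlim_tendsto_pos_mult_at_top[OF tendsto_const assms filterlim_inverse_at_top_right])
  from filterlim_compose[OF tendsto_power_div_exp_0 this, of n]
  have "((\<lambda>\<epsilon>. (d * inverse \<epsilon>) ^ n / exp (d * inverse \<epsilon>) * inverse (d ^ n)) \<longlongrightarrow> 0) (at_right 0)"
    by (rule tendsto_mult_left_zero)
  then show ?thesis
  proof (rule tendsto_sandwich[OF _ _ tendsto_const, rotated 2])
    show "\<forall>\<^sub>F \<epsilon> in at_right 0. 0 \<le> exp (- (d / \<epsilon>)) / \<epsilon> powr a"
      by (intro always_eventually allI) simp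
    have "\<forall>\<^sub>F \<epsilon> in at_right 0. \<epsilon> < (1::real)"
      by (rule eventually_at_right_real[THEN eventually_mono]) auto
    then show "\<forall>\<^sub>F \<epsilon> in at_right 0. exp (- (d / \<epsilon>)) / \<epsilon> powr a \<le>
        (d * inverse \<epsilon>) ^ n / exp (d * inverse \<epsilon>) * inverse (d ^ n)"
      using eventually_at_right_less[of "0::real"]
    proof eventually_elim
      case (elim \<epsilon>)
      have "\<epsilon> ^ n \<le> \<epsilon> powr a"
        using powr_mono'[OF n, of \<epsilon>] elim by (simp add: powr_realpow)
      then have "exp (- (d / \<epsilon>)) / \<epsilon> powr a \<le> exp (- (d / \<epsilon>)) / \<epsilon> ^ n"
        using elim by (intro divide_left_mono) auto
      also have "\<dots> = (d * inverse \<epsilon>) ^ n / exp (d * inverse \<epsilon>) * inverse (d ^ n)"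
        using assms elim by (simp add: exp_minus power_mult_distrib field_simps)
      finally show ?case .
    qed
  qed
qed

section \<open>Limits of the boundary layer and interior integrals\<close>

context touching_ball
begin

definition paraboloid :: "(real^'n) set" where
  "paraboloid = {\<eta>. (\<Sum>i\<in>-{k}. (\<eta> $ i)\<^sup>2) < 2 * R * \<eta> $ k}"

lemma measurable_stretch: "stretch \<epsilon> \<in> borel_measurable borel"
  unfolding stretch_def by measurable

text \<open>The Jacobian: \<epsilon> from the normal direction and sqrt \<epsilon> from each of the
  N - 1 tangential ones.\<close>

lemma integral_stretch:
  assumes F[measurable]: "F \<in> borel_measurable borel" and \<epsilon>: "0 < \<epsilon>"
  shows "integral\<^sup>L lborel F = \<epsilon> powr ((real CARD('n) + 1) / 2) * (\<integral>\<eta>. F (z + stretch \<epsilon> \<eta>) \<partial>lborel)"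
proof -
  let ?d = "\<lambda>i. if i = k then \<epsilon> else sqrt \<epsilon>"
  have "(\<Prod>i\<in>UNIV. \<bar>?d i\<bar>) = \<epsilon> * (\<Prod>i\<in>UNIV - {k}. \<bar>?d i\<bar>)"
    using \<epsilon> by (subst prod.remove[of UNIV k]) auto
  also have "(\<Prod>i\<in>UNIV - {k}. \<bar>?d i\<bar>) = (\<Prod>i\<in>UNIV - {k}. sqrt \<epsilon>)"
    using \<epsilon> by (intro prod.cong) auto
  also have "\<dots> = sqrt \<epsilon> ^ (CARD('n) - 1)"
    by (simp add: card_Diff_singleton)
  also have "\<dots> = \<epsilon> powr (real (CARD('n) - 1) / 2)"
    using \<epsilon> powr_realpow[of "sqrt \<epsilon>" "CARD('n) - 1"] by (simp add: powr_half_sqrt[symmetric] powr_powr)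
  also have "\<epsilon> * \<epsilon> powr (real (CARD('n) - 1) / 2) = \<epsilon> powr (1 + real (CARD('n) - 1) / 2)"
    using \<epsilon> by (simp add: powr_add)
  also have "1 + real (CARD('n) - 1) / 2 = (real CARD('n) + 1) / 2"
    by (simp add: of_nat_diff Suc_leI field_simps)
  finally have prod: "(\<Prod>i\<in>UNIV. \<bar>?d i\<bar>) = \<epsilon> powr ((real CARD('n) + 1) / 2)" .
  have "integral\<^sup>L lborel F = (\<integral>w. F (z + w) \<partial>lborel)"
    by (rule lborel_integral_translate[symmetric]) measurable
  also have "\<dots> = (\<Prod>i\<in>UNIV. \<bar>?d i\<bar>) * (\<integral>\<eta>. F (z + stretch \<epsilon> \<eta>) \<partial>lborel)"
    unfolding stretch_def
    by (rule lborel_integral_orthonormal_scaling[OF e, where G="\<lambda>w. F (z + w)"]) (use \<epsilon> in auto)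
  finally show ?thesis unfolding prod .
qed

lemma paraboloid_integral:
  assumes \<beta>: "0 < \<beta>" and b: "\<And>i. i \<noteq> k \<Longrightarrow> b i < \<beta> / (2 * R)"
  shows "integrable lborel (\<lambda>\<eta>. indicator paraboloid \<eta> * exp (- (\<beta> * \<eta> $ k) + (\<Sum>i\<in>-{k}. b i * (\<eta> $ i)\<^sup>2)))"
    "(\<integral>\<eta>. indicator paraboloid \<eta> * exp (- (\<beta> * \<eta> $ k) + (\<Sum>i\<in>-{k}. b i * (\<eta> $ i)\<^sup>2)) \<partial>lborel) =
      (\<Prod>i\<in>-{k}. sqrt (pi / (\<beta> / (2 * R) - b i))) / \<beta>"
proof -
  let ?f = "\<lambda>\<eta>. indicator paraboloid \<eta> * exp (- (\<beta> * \<eta> $ k) + (\<Sum>i\<in>-{k}. b i * (\<eta> $ i)\<^sup>2))"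
  let ?K = "(\<Prod>i\<in>-{k}. sqrt (pi / (\<beta> / (2 * R) - b i))) / \<beta>"
  have m: "?f \<in> borel_measurable lborel"
    unfolding paraboloid_def by measurable
  have "0 \<le> ?K"
    using \<beta> by (intro divide_nonneg_pos prod_nonneg) (auto simp: less_imp_le[OF b])
  then have "has_bochner_integral lborel ?f ?K"
    using nn_integral_paraboloid[where k=k and b=b, OF \<beta> R_pos b] m unfolding paraboloid_def[symmetric]
    by (intro has_bochner_integral_nn_integral) auto
  then show "integrable lborel ?f" "integral\<^sup>L lborel ?f = ?K"
    by (auto simp: has_bochner_integral_iff)
qed

text \<open>The closed form of the integral of exp(-\<beta> tau) over the paraboloid, that is, of
  the blow-up limit of u to the power p when \<beta> = p / sqrt tp.\<close>

definition boundary_mass :: "real \<Rightarrow> real" where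
  "boundary_mass \<beta> = (\<Prod>i\<in>-{k}. sqrt (pi / (\<beta> / (2 * R) - \<beta> * kap i / 2))) / \<beta>"

lemma boundary_mass_pos:
  assumes "0 < \<beta>"
  shows "0 < boundary_mass \<beta>"
proof -
  have "\<beta> * kap i / 2 < \<beta> / (2 * R)" if "i \<noteq> k" for i
    using mult_strict_left_mono[OF curvature[OF that] assms] by simp
  then show ?thesis
    unfolding boundary_mass_def using assms by (intro divide_pos_pos prod_pos) auto
qed

end

locale touching_ball_solutions = touching_ball \<Omega> U x z R \<psi> grad hess e k kap
  for \<Omega> U :: "(real^'n) set" and x z R \<psi> grad hess e k kap +
  fixes tp tn :: real and u :: "real \<Rightarrow> real^'n \<Rightarrow> real"
  assumes sol: "\<And>\<epsilon>. \<epsilon> > 0 \<Longrightarrow> pucci_dirichlet tp tn \<epsilon> \<Omega> (u \<epsilon>)"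
begin

lemma tp: "0 < tp"
proof -
  interpret pucci_dirichlet tp tn 1 \<Omega> "u 1" by (rule sol) simp
  show ?thesis by (rule tp_pos)
qed

lemma unit_function:
  assumes "\<epsilon> > 0"
  shows "unit_function_on_ball x R (u \<epsilon>)"
proof -
  interpret pucci_dirichlet tp tn \<epsilon> \<Omega> "u \<epsilon>" by (rule sol) fact
  have "ball x R \<subseteq> closure \<Omega>" using ball_sub closure_subset by blast
  then show ?thesis
    using R_pos continuous_on_subset[OF continuous_u] u_nonneg u_le_1 ball_sub
    by unfold_locales blast+
qed

definition decay_const :: real where
  "decay_const = decay_rate tp tn CARD('n)"

lemma decay_const_pos: "0 < decay_const"
proof -
  interpret pucci_dirichlet tp tn 1 \<Omega> "u 1" by (rule sol) simp
  show ?thesis unfolding decay_const_def by (rule decay_rate_pos)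
qed

text \<open>The subtracted level m tends to 0 whereas u keeps a positive limit in the blown-up
  coordinates, so the level disappears from the limit. It is left general here and becomes c
  \<epsilon>^a below.\<close>

lemma boundary_layer_limit:
  assumes p: "0 < p" and m: "\<And>\<epsilon>. \<epsilon> > 0 \<Longrightarrow> 0 \<le> m \<epsilon>" "(m \<longlongrightarrow> 0) (at_right 0)"
  shows "((\<lambda>\<epsilon>. \<epsilon> powr (- ((real CARD('n) + 1) / 2)) * (LINT y:ball x R|lborel. max (u \<epsilon> y - m \<epsilon>) 0 powr p)) \<longlongrightarrow>
    boundary_mass (p / sqrt tp)) (at_right 0)"
proof -
  define \<beta> where "\<beta> = p / sqrt tp"
  have \<beta>: "0 < \<beta>" using p tp by (simp add: \<beta>_def)
  define F where "F \<epsilon> y = indicator (ball x R) y * max (u \<epsilon> y - m \<epsilon>) 0 powr p" for \<epsilon> y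
  define f where "f \<eta> = indicator paraboloid \<eta> * exp (- (\<beta> * \<eta> $ k) + (\<Sum>i\<in>-{k}. (\<beta> * kap i / 2) * (\<eta> $ i)\<^sup>2))" for \<eta>
  have F[measurable]: "F \<epsilon> \<in> borel_measurable borel" if "\<epsilon> > 0" for \<epsilon>
  proof -
    interpret unit_function_on_ball x R "u \<epsilon>" by (rule unit_function) fact
    show ?thesis
      unfolding F_def[abs_def] by (rule measurable_compose_u[where F="\<lambda>t. max (t - m \<epsilon>) 0 powr p"]) measurable
  qed
  have f_tau: "f \<eta> = indicator paraboloid \<eta> * exp (- tau \<eta> / sqrt tp) powr p" for \<eta>
  proof -
    have "exp (- tau \<eta> / sqrt tp) powr p = exp (- (\<beta> * tau \<eta>))"
      by (simp add: powr_def \<beta>_def)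
    also have "- (\<beta> * tau \<eta>) = - (\<beta> * \<eta> $ k) + (\<Sum>i\<in>-{k}. (\<beta> * kap i / 2) * (\<eta> $ i)\<^sup>2)"
      by (simp add: tau_def right_diff_distrib sum_distrib_left sum_divide_distrib mult.assoc)
    finally show ?thesis by (simp add: f_def)
  qed
  have bcurv: "\<beta> * kap i / 2 < \<beta> / (2 * R)" if "i \<noteq> k" for i
    using mult_strict_left_mono[OF curvature[OF that] \<beta>] by simp
  obtain c where c: "c > 0"
    "\<And>\<epsilon> \<eta>. 0 < \<epsilon> \<Longrightarrow> z + stretch \<epsilon> \<eta> \<in> ball x R \<Longrightarrow>
       u \<epsilon> (z + stretch \<epsilon> \<eta>) \<le> 2 * CARD('n) * exp (- (decay_const * c * \<eta> $ k))"
    using solution_decay sol unfolding decay_const_def by metis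
  \<comment> \<open>The uniform decay estimate raised to the power p and restricted to the
    paraboloid. With zero quadratic coefficients \<open>paraboloid_integral\<close> gives its
    integrability.\<close>
  define w where "w \<eta> = (2 * real CARD('n)) powr p * (indicator paraboloid \<eta> *
      exp (- ((decay_const * c * p) * \<eta> $ k) + (\<Sum>i\<in>-{k}. 0 * (\<eta> $ i)\<^sup>2)))" for \<eta>
  have "((\<lambda>\<epsilon>. \<integral>\<eta>. F \<epsilon> (z + stretch \<epsilon> \<eta>) \<partial>lborel) \<longlongrightarrow> integral\<^sup>L lborel f) (at_right 0)"
  proof (rule integral_dominated_convergence_at_right)
    show "f \<in> borel_measurable lborel"
      unfolding f_def[abs_def] paraboloid_def by measurable
    show "(\<lambda>\<eta>. F \<epsilon> (z + stretch \<epsilon> \<eta>)) \<in> borel_measurable lborel" if "0 < \<epsilon>" for \<epsilon>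
      using F[OF that] measurable_stretch[measurable] by measurable
    show "integrable lborel w"
      unfolding w_def using decay_const_pos c(1) p R_pos
      by (intro integrable_mult_right paraboloid_integral) auto
    show "((\<lambda>\<epsilon>. F \<epsilon> (z + stretch \<epsilon> \<eta>)) \<longlongrightarrow> f \<eta>) (at_right 0)" for \<eta>
    proof (cases "\<eta> \<in> paraboloid")
      case True
      then have \<eta>: "(\<Sum>i\<in>-{k}. (\<eta> $ i)\<^sup>2) < 2 * R * \<eta> $ k" by (simp add: paraboloid_def)
      have "((\<lambda>\<epsilon>. max (u \<epsilon> (z + stretch \<epsilon> \<eta>) - m \<epsilon>) 0) \<longlongrightarrow> max (exp (- tau \<eta> / sqrt tp) - 0) 0) (at_right 0)"
        by (intro tendsto_intros m(2) solution_limit[OF sol \<eta>])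
      then have "((\<lambda>\<epsilon>. max (u \<epsilon> (z + stretch \<epsilon> \<eta>) - m \<epsilon>) 0 powr p) \<longlongrightarrow> max (exp (- tau \<eta> / sqrt tp) - 0) 0 powr p) (at_right 0)"
        using p by (intro tendsto_powr2 tendsto_const) auto
      then have "((\<lambda>\<epsilon>. max (u \<epsilon> (z + stretch \<epsilon> \<eta>) - m \<epsilon>) 0 powr p) \<longlongrightarrow> f \<eta>) (at_right 0)"
        using True by (simp add: f_tau max_def)
      moreover have "\<forall>\<^sub>F \<epsilon> in at_right 0. max (u \<epsilon> (z + stretch \<epsilon> \<eta>) - m \<epsilon>) 0 powr p = F \<epsilon> (z + stretch \<epsilon> \<eta>)"
        using eventually_stretch_in_ball[OF \<eta>] by eventually_elim (simp add: F_def)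
      ultimately show ?thesis by (rule Lim_transform_eventually)
    next
      case False
      \<comment> \<open>Outside the paraboloid, even on its boundary surface, the rescaled point
        misses the ball for every \<epsilon>, so the integrand is exactly 0.\<close>
      have "z + stretch \<epsilon> \<eta> \<notin> ball x R" if "\<epsilon> > 0" for \<epsilon>
      proof -
        have "0 \<le> \<epsilon> * (\<eta> $ k)\<^sup>2" using that by simp
        with False show ?thesis
          unfolding mem_ball_stretch[OF that] paraboloid_def mem_Collect_eq by linarith
      qed
      then have "\<forall>\<^sub>F \<epsilon> in at_right 0. f \<eta> = F \<epsilon> (z + stretch \<epsilon> \<eta>)"
        using False eventually_at_right_less[of "0::real"] by (auto simp: F_def f_def elim!: eventually_mono)
      then show ?thesis by (rule Lim_transform_eventually[OF tendsto_const])
    qed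
    show "norm (F \<epsilon> (z + stretch \<epsilon> \<eta>)) \<le> w \<eta>" if \<epsilon>: "0 < \<epsilon>" for \<epsilon> \<eta>
    proof (cases "z + stretch \<epsilon> \<eta> \<in> ball x R")
      case True
      moreover have "0 \<le> \<epsilon> * (\<eta> $ k)\<^sup>2" using \<epsilon> by simp
      ultimately have P: "\<eta> \<in> paraboloid"
        unfolding mem_ball_stretch[OF \<epsilon>] paraboloid_def mem_Collect_eq by linarith
      have "u \<epsilon> (z + stretch \<epsilon> \<eta>) - m \<epsilon> \<le> 2 * CARD('n) * exp (- (decay_const * c * \<eta> $ k))"
        using c(2)[OF \<epsilon> True] m(1)[OF \<epsilon>] by linarith
      then have "max (u \<epsilon> (z + stretch \<epsilon> \<eta>) - m \<epsilon>) 0 powr p \<le> (2 * CARD('n) * exp (- (decay_const * c * \<eta> $ k))) powr p"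
        using p by (intro powr_mono2) auto
      also have "\<dots> = (2 * real CARD('n)) powr p * exp (- ((decay_const * c * p) * \<eta> $ k))"
        by (simp add: powr_mult) (simp add: powr_def mult.commute mult.left_commute)
      finally show ?thesis using True P by (simp add: F_def w_def)
    next
      case False
      then show ?thesis by (simp add: F_def w_def)
    qed
  qed
  moreover have "integral\<^sup>L lborel f = boundary_mass \<beta>"
    unfolding f_def[abs_def] boundary_mass_def by (rule paraboloid_integral(2)[OF \<beta> bcurv])
  moreover have "\<forall>\<^sub>F \<epsilon> in at_right 0. (\<integral>\<eta>. F \<epsilon> (z + stretch \<epsilon> \<eta>) \<partial>lborel) =
      \<epsilon> powr (- ((real CARD('n) + 1) / 2)) * (LINT y:ball x R|lborel. max (u \<epsilon> y - m \<epsilon>) 0 powr p)"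
    using eventually_at_right_less[of "0::real"]
  proof eventually_elim
    case (elim \<epsilon>)
    have "(LINT y:ball x R|lborel. max (u \<epsilon> y - m \<epsilon>) 0 powr p) = integral\<^sup>L lborel (F \<epsilon>)"
      by (simp add: set_lebesgue_integral_def F_def[abs_def])
    also have "\<dots> = \<epsilon> powr ((real CARD('n) + 1) / 2) * (\<integral>\<eta>. F \<epsilon> (z + stretch \<epsilon> \<eta>) \<partial>lborel)"
      by (rule integral_stretch[OF F[OF elim] elim])
    finally show ?case using elim by (simp add: powr_minus)
  qed
  ultimately show ?thesis
    unfolding \<beta>_def by (auto intro: Lim_transform_eventually)
qed

lemma u_pointwise_decay:
  assumes "y \<in> ball x R"
  obtains d where "0 < d" "\<And>\<epsilon>. 0 < \<epsilon> \<Longrightarrow> u \<epsilon> y \<le> 2 * CARD('n) * exp (- (d / \<epsilon>))"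
proof -
  obtain r where r: "0 < r" "ball y r \<subseteq> \<Omega>"
    using open_dom assms ball_sub by (meson open_contains_ball subsetD)
  have "u \<epsilon> y \<le> 2 * CARD('n) * exp (- (decay_const * r / \<epsilon>))" if "0 < \<epsilon>" for \<epsilon>
  proof -
    interpret pucci_dirichlet tp tn \<epsilon> \<Omega> "u \<epsilon>" by (rule sol) fact
    show ?thesis unfolding decay_const_def by (rule u_decay[OF r])
  qed
  then show thesis using that[of "decay_const * r"] decay_const_pos r by simp
qed

text \<open>At a fixed point of the ball u is exponentially small, hence negligible against every
  power of \<epsilon>. The integrand tends to 1 pointwise and is bounded by 1.\<close>

lemma interior_limit:
  assumes p: "0 < p" and c: "0 < c" and a: "0 < a"
  shows "((\<lambda>\<epsilon>. LINT y:ball x R|lborel. max (1 - u \<epsilon> y / (c * \<epsilon> powr a)) 0 powr p) \<longlongrightarrow>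
    measure lborel (ball x R)) (at_right 0)"
proof -
  have "((\<lambda>\<epsilon>. \<integral>y. indicator (ball x R) y * max (1 - u \<epsilon> y / (c * \<epsilon> powr a)) 0 powr p \<partial>lborel) \<longlongrightarrow>
      (\<integral>y. indicator (ball x R) y \<partial>lborel)) (at_right 0)"
  proof (rule integral_dominated_convergence_at_right[where w="\<lambda>y. indicator (ball x R) y * 1"])
    show "(\<lambda>y. indicator (ball x R) y * max (1 - u \<epsilon> y / (c * \<epsilon> powr a)) 0 powr p) \<in> borel_measurable lborel" if "0 < \<epsilon>" for \<epsilon>
    proof -
      interpret unit_function_on_ball x R "u \<epsilon>" by (rule unit_function) fact
      show ?thesis
        using measurable_compose_u[where F="\<lambda>t. max (1 - t / (c * \<epsilon> powr a)) 0 powr p"] by simp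
    qed
    interpret u1: unit_function_on_ball x R "u 1" by (rule unit_function) simp
    show "integrable lborel (\<lambda>y. indicator (ball x R) y * (1::real))"
      by (rule u1.integrable_indicator_ball)
    show "norm (indicator (ball x R) y * max (1 - u \<epsilon> y / (c * \<epsilon> powr a)) 0 powr p) \<le> indicator (ball x R) y * 1"
      if "0 < \<epsilon>" for \<epsilon> y
    proof (cases "y \<in> ball x R")
      case True
      interpret unit_function_on_ball x R "u \<epsilon>" by (rule unit_function) fact
      have "0 \<le> u \<epsilon> y / (c * \<epsilon> powr a)" using range[OF True] c by simp
      then have "max (1 - u \<epsilon> y / (c * \<epsilon> powr a)) 0 powr p \<le> 1 powr p"
        using p by (intro powr_mono2) auto
      then show ?thesis using True by simp
    qed simp
    show "((\<lambda>\<epsilon>. indicator (ball x R) y * max (1 - u \<epsilon> y / (c * \<epsilon> powr a)) 0 powr p) \<longlongrightarrow> indicator (ball x R) y) (at_right 0)" for y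
    proof (cases "y \<in> ball x R")
      case True
      obtain d where d: "0 < d" "\<And>\<epsilon>. 0 < \<epsilon> \<Longrightarrow> u \<epsilon> y \<le> 2 * CARD('n) * exp (- (d / \<epsilon>))"
        using u_pointwise_decay[OF True] by blast
      have lim: "((\<lambda>\<epsilon>. 2 * real CARD('n) / c * (exp (- (d / \<epsilon>)) / \<epsilon> powr a)) \<longlongrightarrow> 2 * real CARD('n) / c * 0) (at_right 0)"
        by (intro tendsto_mult tendsto_const exp_inverse_powr_limit d)
      have "((\<lambda>\<epsilon>. u \<epsilon> y / (c * \<epsilon> powr a)) \<longlongrightarrow> 0) (at_right 0)"
      proof (rule tendsto_sandwich[OF _ _ tendsto_const lim[unfolded mult_zero_right]])
        show "\<forall>\<^sub>F \<epsilon> in at_right 0. 0 \<le> u \<epsilon> y / (c * \<epsilon> powr a)"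
          using eventually_at_right_less[of "0::real"]
        proof eventually_elim
          case (elim \<epsilon>)
          interpret unit_function_on_ball x R "u \<epsilon>" by (rule unit_function) fact
          show ?case using range[OF True] c by simp
        qed
        show "\<forall>\<^sub>F \<epsilon> in at_right 0. u \<epsilon> y / (c * \<epsilon> powr a) \<le> 2 * real CARD('n) / c * (exp (- (d / \<epsilon>)) / \<epsilon> powr a)"
          using eventually_at_right_less[of "0::real"]
        proof eventually_elim
          case (elim \<epsilon>)
          have "u \<epsilon> y / (c * \<epsilon> powr a) \<le> (2 * CARD('n) * exp (- (d / \<epsilon>))) / (c * \<epsilon> powr a)"
            using d(2)[OF elim] c by (intro divide_right_mono) auto
          then show ?case by simp
        qed
      qed
      then have "((\<lambda>\<epsilon>. max (1 - u \<epsilon> y / (c * \<epsilon> powr a)) 0) \<longlongrightarrow> max (1 - 0) 0) (at_right 0)"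
        by (intro tendsto_intros)
      then have "((\<lambda>\<epsilon>. max (1 - u \<epsilon> y / (c * \<epsilon> powr a)) 0 powr p) \<longlongrightarrow> max (1 - 0) 0 powr p) (at_right 0)"
        using p by (intro tendsto_powr2 tendsto_const) auto
      then show ?thesis using True by simp
    qed simp
  qed (intro borel_measurable_indicator, simp)
  then show ?thesis by (simp add: set_lebesgue_integral_def)
qed

end

section \<open>Asymptotics of the \<open>q\<close>-means\<close>

context touching_ball_solutions
begin

text \<open>The exponent \<open>a\<close> is chosen so that (c \<epsilon>^a)^p = c^p
  \<epsilon>^((N+1)/2): at this level the bulk integral has the same order as the boundary layer
  integral, and dividing by that order leaves a nontrivial competition.\<close>

lemma balance_limit:
  assumes p: "0 < p" and c: "0 < c"
  defines "a \<equiv> (real CARD('n) + 1) / (2 * p)"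
  shows "((\<lambda>\<epsilon>. \<epsilon> powr (- ((real CARD('n) + 1) / 2)) * unit_function_on_ball.balance x R (u \<epsilon>) p (c * \<epsilon> powr a)) \<longlongrightarrow>
    boundary_mass (p / sqrt tp) - c powr p * measure lborel (ball x R)) (at_right 0)"
proof -
  define s where "s = (real CARD('n) + 1) / 2"
  have a: "0 < a" and ap: "a * p = s" using p by (simp_all add: a_def s_def field_simps)
  have "((\<lambda>\<epsilon>. c * \<epsilon> powr a) \<longlongrightarrow> c * 0 powr a) (at_right 0)"
    using a eventually_at_right_less[of "0::real"]
    by (intro tendsto_mult tendsto_const tendsto_powr2 tendsto_ident_at) (auto elim: eventually_mono)
  then have "((\<lambda>\<epsilon>. c * \<epsilon> powr a) \<longlongrightarrow> 0) (at_right 0)" by simp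
  then have "((\<lambda>\<epsilon>. \<epsilon> powr (- s) * (LINT y:ball x R|lborel. max (u \<epsilon> y - c * \<epsilon> powr a) 0 powr p) -
      c powr p * (LINT y:ball x R|lborel. max (1 - u \<epsilon> y / (c * \<epsilon> powr a)) 0 powr p)) \<longlongrightarrow>
    boundary_mass (p / sqrt tp) - c powr p * measure lborel (ball x R)) (at_right 0)"
    unfolding s_def using c by (intro tendsto_diff tendsto_mult tendsto_const boundary_layer_limit interior_limit p a) auto
  moreover have "\<forall>\<^sub>F \<epsilon> in at_right 0.
      \<epsilon> powr (- s) * (LINT y:ball x R|lborel. max (u \<epsilon> y - c * \<epsilon> powr a) 0 powr p) -
        c powr p * (LINT y:ball x R|lborel. max (1 - u \<epsilon> y / (c * \<epsilon> powr a)) 0 powr p) =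
      \<epsilon> powr (- s) * unit_function_on_ball.balance x R (u \<epsilon>) p (c * \<epsilon> powr a)"
    using eventually_at_right_less[of "0::real"]
  proof eventually_elim
    case (elim \<epsilon>)
    interpret unit_function_on_ball x R "u \<epsilon>" by (rule unit_function) fact
    define m where "m = c * \<epsilon> powr a"
    have m: "0 < m" using c elim by (simp add: m_def)
    have mp: "m powr p = c powr p * \<epsilon> powr s"
      using c elim by (simp add: m_def powr_mult powr_powr ap)
    have "max (m - t) 0 powr p = m powr p * max (1 - t / m) 0 powr p" for t
    proof -
      have "max (m - t) 0 = m * max (1 - t / m) 0"
        using m by (simp add: max_mult_distrib_left right_diff_distrib)
      then show ?thesis using m by (simp add: powr_mult)
    qed
    then have "(LINT y:ball x R|lborel. max (m - u \<epsilon> y) 0 powr p) = m powr p * (LINT y:ball x R|lborel. max (1 - u \<epsilon> y / m) 0 powr p)"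
      by simp
    then show ?case
      using elim unfolding balance_def m_def[symmetric] mp right_diff_distrib
      by (simp add: powr_minus)
  qed
  ultimately show ?thesis
    unfolding s_def by (rule Lim_transform_eventually)
qed

text \<open>The limiting balance \<open>bm - c powr p * V\<close> is strictly decreasing in c and
  vanishes at c0. Trial levels c \<epsilon>^a with c slightly below or above c0 therefore trap the
  q-mean for small \<epsilon>.\<close>

lemma q_mean_limit:
  assumes q: "1 < q"
  shows "((\<lambda>\<epsilon>. \<epsilon> powr (- ((real CARD('n) + 1) / (2 * (q - 1)))) * q_mean (ereal q) (ball x R) (u \<epsilon>)) \<longlongrightarrow>
    (boundary_mass ((q - 1) / sqrt tp) / measure lborel (ball x R)) powr (1 / (q - 1))) (at_right 0)"
proof -
  define p where "p = q - 1"
  define a where "a = (real CARD('n) + 1) / (2 * p)"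
  define bm where "bm = boundary_mass (p / sqrt tp)"
  define V where "V = measure lborel (ball x R)"
  define c0 where "c0 = (bm / V) powr (1 / p)"
  have p: "0 < p" using q by (simp add: p_def)
  have bm: "0 < bm" unfolding bm_def using p tp by (intro boundary_mass_pos) auto
  have V: "0 < V" unfolding V_def by (rule content_ball_pos[OF R_pos])
  have c0: "0 < c0" "c0 powr p = bm / V" using bm V p by (simp_all add: c0_def powr_powr)
  have lim: "((\<lambda>\<epsilon>. \<epsilon> powr (- ((real CARD('n) + 1) / 2)) * unit_function_on_ball.balance x R (u \<epsilon>) p (c * \<epsilon> powr a)) \<longlongrightarrow>
      bm - c powr p * V) (at_right 0)" if "0 < c" for c
    using balance_limit[OF p that] unfolding a_def bm_def V_def .
  have lower: "\<forall>\<^sub>F \<epsilon> in at_right 0. c \<le> \<epsilon> powr (- a) * q_mean (ereal q) (ball x R) (u \<epsilon>)" if c: "0 < c" "c < c0" for c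
  proof -
    have "c powr p < c0 powr p" using c p by (intro powr_less_mono2) auto
    then have "0 < bm - c powr p * V" using V by (simp add: c0 field_simps)
    from order_tendstoD(1)[OF lim[OF c(1)] this] show ?thesis
      using eventually_at_right_less[of "0::real"]
    proof eventually_elim
      case (elim \<epsilon>)
      interpret unit_function_on_ball x R "u \<epsilon>" by (rule unit_function) fact
      have "0 < balance (q - 1) (c * \<epsilon> powr a)" using elim by (simp add: p_def zero_less_mult_iff)
      from q_mean_ge[OF q this] show ?case
        using elim by (simp add: powr_minus field_simps)
    qed
  qed
  have upper: "\<forall>\<^sub>F \<epsilon> in at_right 0. \<epsilon> powr (- a) * q_mean (ereal q) (ball x R) (u \<epsilon>) \<le> c" if c: "c0 < c" for c
  proof -
    have c': "0 < c" using c c0 by simp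
    have "c0 powr p < c powr p" using c c0 p by (intro powr_less_mono2) auto
    then have "bm - c powr p * V < 0" using V by (simp add: c0 field_simps)
    from order_tendstoD(2)[OF lim[OF c'] this] show ?thesis
      using eventually_at_right_less[of "0::real"]
    proof eventually_elim
      case (elim \<epsilon>)
      interpret unit_function_on_ball x R "u \<epsilon>" by (rule unit_function) fact
      have "balance (q - 1) (c * \<epsilon> powr a) < 0" using elim by (simp add: p_def mult_less_0_iff)
      from q_mean_le[OF q this] show ?case
        using elim by (simp add: powr_minus field_simps)
    qed
  qed
  have "((\<lambda>\<epsilon>. \<epsilon> powr (- a) * q_mean (ereal q) (ball x R) (u \<epsilon>)) \<longlongrightarrow> c0) (at_right 0)"
  proof (rule order_tendstoI)
    fix l assume "l < c0"
    then obtain c where c: "max l 0 < c" "c < c0" using c0(1) dense[of "max l 0" c0] by auto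
    then have "0 < c" by simp
    from lower[OF this c(2)] show "\<forall>\<^sub>F \<epsilon> in at_right 0. l < \<epsilon> powr (- a) * q_mean (ereal q) (ball x R) (u \<epsilon>)"
      by (rule eventually_mono) (use c in auto)
  next
    fix l assume "c0 < l"
    then obtain c where c: "c0 < c" "c < l" using dense by blast
    from upper[OF c(1)] show "\<forall>\<^sub>F \<epsilon> in at_right 0. \<epsilon> powr (- a) * q_mean (ereal q) (ball x R) (u \<epsilon>) < l"
      by (rule eventually_mono) (use c in auto)
  qed
  then show ?thesis by (simp add: a_def c0_def bm_def V_def p_def)
qed

lemma q_mean_infinity_limit: "((\<lambda>\<epsilon>. q_mean \<infinity> (ball x R) (u \<epsilon>)) \<longlongrightarrow> 1 / 2) (at_right 0)"
proof -
  have xB: "x \<in> ball x R" using R_pos by simp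
  have zc: "z \<in> closure (ball x R)"
    using touch R_pos by auto
  have eq: "q_mean \<infinity> (ball x R) (u \<epsilon>) = (1 + Inf (u \<epsilon> ` ball x R)) / 2" if \<epsilon>: "0 < \<epsilon>" for \<epsilon>
  proof -
    interpret pucci_dirichlet tp tn \<epsilon> \<Omega> "u \<epsilon>" by (rule sol) fact
    interpret unit_function_on_ball x R "u \<epsilon>" by (rule unit_function) fact
    show ?thesis
    proof (rule q_mean_infinity)
      \<comment> \<open>The supremum 1 is approached near z, which lies in the closure of the ball
        and carries the boundary value 1.\<close>
      fix \<delta> :: real assume "0 < \<delta>"
      moreover have "z \<in> closure \<Omega>" using z_frontier by (simp add: frontier_def)
      ultimately obtain d where d: "0 < d" "\<And>y. y \<in> closure \<Omega> \<Longrightarrow> dist y z < d \<Longrightarrow> dist (u \<epsilon> y) (u \<epsilon> z) < \<delta>"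
        using continuous_u unfolding continuous_on_iff by blast
      obtain y where y: "y \<in> ball x R" "dist y z < d"
        using zc d(1) unfolding closure_approachable by blast
      have "dist (u \<epsilon> y) (u \<epsilon> z) < \<delta>"
        using y ball_sub closure_subset by (intro d) blast+
      then have "1 - \<delta> < u \<epsilon> y"
        by (simp add: boundary_u[OF z_frontier] dist_real_def)
      with y show "\<exists>y\<in>ball x R. 1 - \<delta> < u \<epsilon> y" by blast
    qed
  qed
  obtain d where d: "0 < d" "\<And>\<epsilon>. 0 < \<epsilon> \<Longrightarrow> u \<epsilon> x \<le> 2 * CARD('n) * exp (- (d / \<epsilon>))"
    using u_pointwise_decay[OF xB] by blast
  have lim: "((\<lambda>\<epsilon>. 2 * real CARD('n) * (exp (- (d / \<epsilon>)) / \<epsilon> powr 0)) \<longlongrightarrow> 2 * real CARD('n) * 0) (at_right 0)"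
    by (intro tendsto_mult tendsto_const exp_inverse_powr_limit d)
  \<comment> \<open>The infimum is squeezed between 0 and the exponentially small value at the
    centre x.\<close>
  have "((\<lambda>\<epsilon>. Inf (u \<epsilon> ` ball x R)) \<longlongrightarrow> 0) (at_right 0)"
  proof (rule tendsto_sandwich[OF _ _ tendsto_const lim[unfolded mult_zero_right]])
    show "\<forall>\<^sub>F \<epsilon> in at_right 0. 0 \<le> Inf (u \<epsilon> ` ball x R)"
      using eventually_at_right_less[of "0::real"]
    proof eventually_elim
      case (elim \<epsilon>)
      interpret unit_function_on_ball x R "u \<epsilon>" by (rule unit_function) fact
      show ?case using range xB by (intro cInf_greatest) auto
    qed
    show "\<forall>\<^sub>F \<epsilon> in at_right 0. Inf (u \<epsilon> ` ball x R) \<le> 2 * real CARD('n) * (exp (- (d / \<epsilon>)) / \<epsilon> powr 0)"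
      using eventually_at_right_less[of "0::real"]
    proof eventually_elim
      case (elim \<epsilon>)
      interpret unit_function_on_ball x R "u \<epsilon>" by (rule unit_function) fact
      have "Inf (u \<epsilon> ` ball x R) \<le> u \<epsilon> x"
        using range xB by (intro cInf_lower bdd_belowI[of _ 0]) auto
      also have "\<dots> \<le> 2 * CARD('n) * exp (- (d / \<epsilon>))" by (rule d(2)[OF elim])
      finally show ?case using elim by simp
    qed
  qed
  then have "((\<lambda>\<epsilon>. (1 + Inf (u \<epsilon> ` ball x R)) / 2) \<longlongrightarrow> (1 + 0) / 2) (at_right 0)"
    by (intro tendsto_intros) auto
  moreover have "\<forall>\<^sub>F \<epsilon> in at_right 0. (1 + Inf (u \<epsilon> ` ball x R)) / 2 = q_mean \<infinity> (ball x R) (u \<epsilon>)"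
    using eventually_at_right_less[of "0::real"] by eventually_elim (simp add: eq)
  ultimately show ?thesis
    by (auto intro: Lim_transform_eventually)
qed

end

text \<open>Legendre's duplication formula at (n+1)/2. From n to n + 1 the old second factor becomes
  the first, and the new second factor is the old first one shifted by 1, so a single use of the
  functional equation suffices.\<close>

lemma Gamma_half_product:
  "Gamma ((real n + 1) / 2) * Gamma (real n / 2 + 1) = sqrt pi * fact n / 2 ^ n"
proof (induction n)
  case 0
  show ?case by (simp add: Gamma_one_half_real)
next
  case (Suc n)
  have "Gamma (real (Suc n) / 2 + 1) = Gamma ((real n + 1) / 2 + 1)"
    by (simp add: add.commute)
  also have "\<dots> = (real n + 1) / 2 * Gamma ((real n + 1) / 2)"
    by (rule Gamma_plus1) (auto simp: nonpos_Ints_def dest: arg_cong[where f="\<lambda>t. t"] elim!: nonpos_Ints_cases)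
  finally have "Gamma ((real (Suc n) + 1) / 2) * Gamma (real (Suc n) / 2 + 1) =
      (real n + 1) / 2 * (Gamma ((real n + 1) / 2) * Gamma (real n / 2 + 1))"
    by (simp add: add_divide_distrib add.commute mult.commute mult.left_commute)
  then show ?case
    unfolding Suc.IH by (simp add: field_simps)
qed

section \<open>Evaluation of the limit constant\<close>

context touching_ball
begin

definition curvature_product :: real where
  "curvature_product = (\<Prod>i\<in>-{k}. 1 - R * kap i)"

lemma curvature_factor_pos: "i \<noteq> k \<Longrightarrow> 0 < 1 - R * kap i"
  using curvature[of i] R_pos by (simp add: field_simps)

lemma curvature_product_pos: "0 < curvature_product"
  unfolding curvature_product_def by (rule prod_pos) (rule curvature_factor_pos, simp)

text \<open>Logarithms turn the identity of powers checked in \<open>limit_constant\<close> into a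
  linear one. The N - 1 square roots give the coefficient (N-1)/2, and the factor 1 / \<beta> raises
  that of ln \<beta> to (N+1)/2.\<close>

lemma ln_boundary_mass:
  assumes \<beta>: "0 < \<beta>"
  shows "ln (boundary_mass \<beta>) = (real CARD('n) - 1) / 2 * (ln 2 + ln pi + ln R) -
    (real CARD('n) + 1) / 2 * ln \<beta> - ln curvature_product / 2"
proof -
  define g where "g i = sqrt (pi / (\<beta> / (2 * R) - \<beta> * kap i / 2))" for i
  have f: "pi / (\<beta> / (2 * R) - \<beta> * kap i / 2) = (2 * pi * R / \<beta>) / (1 - R * kap i)" if "i \<noteq> k" for i
  proof -
    have "\<beta> / (2 * R) - \<beta> * kap i / 2 = \<beta> / (2 * R) * (1 - R * kap i)"
      using R_pos by (simp add: field_simps)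
    then show ?thesis using \<beta> R_pos by (simp add: field_simps)
  qed
  have l: "ln (g i) = (ln 2 + ln pi + ln R - ln \<beta>) / 2 - ln (1 - R * kap i) / 2"
    if "i \<noteq> k" for i
    unfolding g_def f[OF that] using \<beta> R_pos curvature_factor_pos[OF that]
    by (simp add: ln_sqrt ln_div ln_mult diff_divide_distrib add_divide_distrib)
  have pos: "0 < g i" if "i \<noteq> k" for i
    unfolding g_def f[OF that] using \<beta> R_pos curvature_factor_pos[OF that] by simp
  have "ln (\<Prod>i\<in>-{k}. g i) =
      (\<Sum>i\<in>-{k}. (ln 2 + ln pi + ln R - ln \<beta>) / 2 - ln (1 - R * kap i) / 2)"
    using pos less_imp_neq[OF pos, symmetric] by (subst ln_prod) (auto simp: l intro!: sum.cong)
  also have "\<dots> = (real CARD('n) - 1) / 2 * (ln 2 + ln pi + ln R - ln \<beta>) - (\<Sum>i\<in>-{k}. ln (1 - R * kap i)) / 2"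
  proof -
    have "card (-{k}) = CARD('n) - 1" by (simp add: Compl_eq_Diff_UNIV card_Diff_singleton)
    moreover have "1 \<le> CARD('n)" by (simp add: Suc_leI)
    ultimately show ?thesis
      by (simp add: sum_subtractf sum_divide_distrib of_nat_diff)
  qed
  also have "(\<Sum>i\<in>-{k}. ln (1 - R * kap i)) = ln curvature_product"
    unfolding curvature_product_def
    by (subst ln_prod) (use curvature_factor_pos in \<open>force+\<close>)
  finally have "ln (\<Prod>i\<in>-{k}. g i) =
      (real CARD('n) - 1) / 2 * (ln 2 + ln pi + ln R - ln \<beta>) - ln curvature_product / 2" .
  moreover have "0 < (\<Prod>i\<in>-{k}. g i)"
    by (intro prod_pos) (auto intro: pos)
  ultimately have "ln ((\<Prod>i\<in>-{k}. g i) / \<beta>) =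
      (real CARD('n) - 1) / 2 * (ln 2 + ln pi + ln R - ln \<beta>) - ln curvature_product / 2 - ln \<beta>"
    using \<beta> by (simp add: ln_divide_pos)
  then show ?thesis
    unfolding boundary_mass_def g_def by (simp add: field_simps)
qed

text \<open>Both sides are positive and their logarithms agree. The exponents of R add up to (N+1)/2
  + (N-1)/2 - N = 0; those of pi to (N-1)/2 - N/2 + 1/2 = 0, the last 1/2 coming from the
  duplication formula, which also replaces the Gamma value in the volume of the ball.\<close>

lemma limit_constant:
  assumes p: "0 < p" and \<theta>: "0 < \<theta>"
  shows "R powr ((real CARD('n) + 1) / (2 * p)) * (boundary_mass (p / sqrt \<theta>) / measure lborel (ball x R)) powr (1 / p) =
    q_mean_const CARD('n) (p + 1) * (curvature_product / \<theta> powr ((real CARD('n) + 1) / 2)) powr (- (1 / (2 * p)))"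
proof -
  define N where "N = real CARD('n)"
  define G where "G = Gamma ((N + 1) / 2)"
  define G' where "G' = Gamma (N / 2 + 1)"
  have N: "0 < N" by (simp add: N_def)
  have G: "0 < G" "0 < G'" using N by (auto simp: G_def G'_def intro!: Gamma_real_pos)
  have bm: "0 < boundary_mass (p / sqrt \<theta>)" using p \<theta> by (intro boundary_mass_pos) auto
  have P: "0 < curvature_product" by (rule curvature_product_pos)
  have V: "measure lborel (ball x R) = pi powr (N / 2) / G' * R powr N"
    using content_ball[of R x] R_pos by (simp add: unit_ball_vol_def N_def G'_def powr_realpow)
  have "ln (G * G') = ln (sqrt pi * fact CARD('n) / 2 ^ CARD('n))"
    using Gamma_half_product[of "CARD('n)"] by (simp add: G_def G'_def N_def)
  then have dup: "ln G + ln G' = ln pi / 2 + ln (fact CARD('n)) - N * ln 2"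
    using G by (simp add: ln_mult ln_div ln_sqrt ln_realpow N_def)
  have lnV: "ln (measure lborel (ball x R)) = N / 2 * ln pi - ln G' + N * ln R" and Vpos: "0 < measure lborel (ball x R)"
    unfolding V using G R_pos by (simp_all add: ln_mult ln_div ln_powr)
  have lnb: "ln (p / sqrt \<theta>) = ln p - ln \<theta> / 2"
    using p \<theta> by (simp add: ln_div ln_sqrt)
  define A where "A = 2 powr (- ((N + 1) / 2)) * fact CARD('n) / (p powr ((N + 1) / 2) * G)"
  have lnA: "ln A =
      - ((N + 1) / 2) * ln 2 + ln (fact CARD('n)) - (N + 1) / 2 * ln p - ln G"
    unfolding A_def using p G by (simp add: ln_mult ln_div ln_powr)
  have Apos: "0 < A"
    unfolding A_def using p G by simp
  have mean: "q_mean_const CARD('n) (p + 1) = A powr (1 / p)"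
    by (simp add: q_mean_const_def A_def N_def G_def)
  have "ln (R powr ((N + 1) / (2 * p)) * (boundary_mass (p / sqrt \<theta>) / measure lborel (ball x R)) powr (1 / p)) =
      (1 / p) * ((N + 1) / 2 * ln R + (ln (boundary_mass (p / sqrt \<theta>)) - ln (measure lborel (ball x R))))"
    using R_pos bm Vpos p by (simp add: ln_mult ln_powr ln_div field_simps)
  also have "(N + 1) / 2 * ln R + (ln (boundary_mass (p / sqrt \<theta>)) - ln (measure lborel (ball x R))) =
      (- ((N + 1) / 2) * ln 2 + ln (fact CARD('n)) - (N + 1) / 2 * ln p - ln G) +
        - (1 / 2) * (ln curvature_product - (N + 1) / 2 * ln \<theta>)"
  proof -
    have "0 < p / sqrt \<theta>" using p \<theta> by simp
    note lnbm = ln_boundary_mass[OF this, folded N_def]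
    have g: "ln G' = ln pi / 2 + ln (fact CARD('n)) - N * ln 2 - ln G" using dup by linarith
    show ?thesis unfolding lnbm lnV lnb g by (simp add: field_simps)
  qed
  also have "(1 / p) * \<dots> = ln (q_mean_const CARD('n) (p + 1) * (curvature_product / \<theta> powr ((N + 1) / 2)) powr (- (1 / (2 * p))))"
    unfolding mean lnA[symmetric]
    using Apos P \<theta> p by (simp add: ln_mult ln_powr ln_div field_simps)
  finally show ?thesis
    unfolding N_def[symmetric] mean
    using R_pos bm Vpos Apos P \<theta> by (subst (asm) ln_inj_iff) auto
qed

end

lemma (in touching_ball_solutions) scaled_q_mean_limit:
  assumes q: "1 < q"
  shows "((\<lambda>\<epsilon>. (R / \<epsilon>) powr ((real CARD('n) + 1) / (2 * (q - 1))) * q_mean (ereal q) (ball x R) (u \<epsilon>)) \<longlongrightarrow>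
    q_mean_const CARD('n) q * (curvature_product / tp powr ((real CARD('n) + 1) / 2)) powr (- (1 / (2 * (q - 1))))) (at_right 0)"
proof -
  let ?a = "(real CARD('n) + 1) / (2 * (q - 1))"
  have "((\<lambda>\<epsilon>. R powr ?a * (\<epsilon> powr (- ?a) * q_mean (ereal q) (ball x R) (u \<epsilon>))) \<longlongrightarrow>
      R powr ?a * (boundary_mass ((q - 1) / sqrt tp) / measure lborel (ball x R)) powr (1 / (q - 1))) (at_right 0)"
    by (intro tendsto_mult tendsto_const q_mean_limit q)
  moreover have "R powr ?a * (boundary_mass ((q - 1) / sqrt tp) / measure lborel (ball x R)) powr (1 / (q - 1)) =
      q_mean_const CARD('n) q * (curvature_product / tp powr ((real CARD('n) + 1) / 2)) powr (- (1 / (2 * (q - 1))))"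
    using limit_constant[of "q - 1" tp] q tp by simp
  moreover have "\<forall>\<^sub>F \<epsilon> in at_right 0. R powr ?a * (\<epsilon> powr (- ?a) * q_mean (ereal q) (ball x R) (u \<epsilon>)) =
      (R / \<epsilon>) powr ?a * q_mean (ereal q) (ball x R) (u \<epsilon>)"
    using eventually_at_right_less[of "0::real"]
  proof eventually_elim
    case (elim \<epsilon>)
    have "(R / \<epsilon>) powr ?a = R powr ?a * \<epsilon> powr (- ?a)"
      using R_pos elim by (simp only: powr_divide powr_minus_divide less_imp_le) simp
    then show ?case by (simp only: mult.assoc)
  qed
  ultimately show ?thesis
    by (auto intro: Lim_transform_eventually)
qed

section \<open>Principal curvatures as second derivatives of a defining function\<close>

text \<open>Differentiating grad = |grad| \<nu> at z expresses the Hessian as |grad| d\<nu> plus a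
  multiple of \<nu> z. Paired with a tangent vector the multiple drops out, so on the tangent space
  the Hessian is -|grad| times the Weingarten map.\<close>

lemma principal_curvatures_hessian:
  fixes \<Omega> :: "(real^'n) set"
  assumes "principal_curvatures \<Omega> z \<kappa>"
  obtains U \<psi> grad hess e k h where
    "local_defining_function \<Omega> z U \<psi> grad" "C2_with U \<psi> grad hess" "orthonormal_family e"
    "e k = grad z /\<^sub>R norm (grad z)" "bij_betw h (-{k}) {1..CARD('n) - 1}"
    "\<And>i j. i \<noteq> k \<Longrightarrow> j \<noteq> k \<Longrightarrow> e j \<bullet> (hess z *v e i) = (if i = j then - (norm (grad z) * \<kappa> (h i)) else 0)"
proof -
  obtain U \<psi> grad \<nu> d\<nu> f where ldf: "local_defining_function \<Omega> z U \<psi> grad"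
    and \<nu>: "\<And>y. y \<in> U \<Longrightarrow> \<nu> y = grad y /\<^sub>R norm (grad y)" and d\<nu>: "(\<nu> has_derivative d\<nu>) (at z)"
    and f: "\<And>i j. i \<in> {1..CARD('n) - 1} \<Longrightarrow> j \<in> {1..CARD('n) - 1} \<Longrightarrow> f i \<bullet> f j = (if i = j then 1 else 0)"
    and f\<nu>: "\<And>j. j \<in> {1..CARD('n) - 1} \<Longrightarrow> f j \<bullet> \<nu> z = 0"
    and curv: "\<And>j. j \<in> {1..CARD('n) - 1} \<Longrightarrow> - d\<nu> (f j) = \<kappa> j *\<^sub>R f j"
    using assms unfolding principal_curvatures_def by blast
  obtain hess where C2: "C2_with U \<psi> grad hess" and zU: "z \<in> U" and nz: "\<And>y. y \<in> U \<Longrightarrow> grad y \<noteq> 0"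
    using ldf unfolding local_defining_function_def by blast
  have U: "open U" and dg: "(grad has_derivative (\<lambda>v. hess z *v v)) (at z)"
    using C2 zU by (auto simp: C2_with_def)
  define k :: 'n where "k = undefined"
  have "card (-{k}) = card {1..CARD('n) - 1}"
    by (simp add: Compl_eq_Diff_UNIV card_Diff_singleton)
  \<comment> \<open>Renumbers the curvatures 1, ..., N - 1 by the indices other than
    \<open>k\<close>.\<close>
  then obtain h where h: "bij_betw h (-{k}) {1..CARD('n) - 1}"
    using finite_same_card_bij[of "-{k}" "{1..CARD('n) - 1}"] by auto
  have hr: "h i \<in> {1..CARD('n) - 1}" if "i \<noteq> k" for i
    using bij_betwE[OF h] that by blast
  have hinj: "h i = h j \<longleftrightarrow> i = j" if "i \<noteq> k" "j \<noteq> k" for i j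
    using bij_betw_imp_inj_on[OF h] that by (auto simp: inj_on_def)
  define e where "e i = (if i = k then \<nu> z else f (h i))" for i
  have n\<nu>: "norm (\<nu> z) = 1" using nz[OF zU] by (simp add: \<nu>[OF zU])
  have e: "orthonormal_family e"
    unfolding orthonormal_family_def
  proof (intro allI)
    fix i j
    show "e i \<bullet> e j = (if i = j then 1 else 0)"
      using n\<nu> f[OF hr hr, of i j] f\<nu>[OF hr, of i] f\<nu>[OF hr, of j] hinj[of i j]
      by (cases "i = k"; cases "j = k") (auto simp: e_def inner_commute norm_eq_1)
  qed
  have "((\<lambda>y. norm (grad y)) has_derivative (\<lambda>v. (hess z *v v) \<bullet> sgn (grad z))) (at z)"
    using has_derivative_compose[OF dg has_derivative_norm[OF nz[OF zU]]] by simp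
  from has_derivative_scaleR[OF this d\<nu>]
  have "((\<lambda>y. norm (grad y) *\<^sub>R \<nu> y) has_derivative
      (\<lambda>v. norm (grad z) *\<^sub>R d\<nu> v + ((hess z *v v) \<bullet> sgn (grad z)) *\<^sub>R \<nu> z)) (at z)" .
  then have "(grad has_derivative
      (\<lambda>v. norm (grad z) *\<^sub>R d\<nu> v + ((hess z *v v) \<bullet> sgn (grad z)) *\<^sub>R \<nu> z)) (at z)"
    by (rule has_derivative_transform_within_open[OF _ U zU]) (use nz in \<open>simp add: \<nu>\<close>)
  from has_derivative_unique[OF dg this]
  have hz: "hess z *v v = norm (grad z) *\<^sub>R d\<nu> v + ((hess z *v v) \<bullet> sgn (grad z)) *\<^sub>R \<nu> z" for v
    by (rule fun_cong)
  have "e j \<bullet> (hess z *v e i) = (if i = j then - (norm (grad z) * \<kappa> (h i)) else 0)" if "i \<noteq> k" "j \<noteq> k" for i j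
  proof -
    have "d\<nu> (e i) = - (\<kappa> (h i) *\<^sub>R e i)"
      using arg_cong[OF curv[OF hr[OF that(1)]], of uminus] that by (simp add: e_def)
    moreover have "e j \<bullet> \<nu> z = 0" using f\<nu>[OF hr[OF that(2)]] that by (simp add: e_def)
    ultimately have "e j \<bullet> (hess z *v e i) = - (norm (grad z) * \<kappa> (h i)) * (e j \<bullet> e i)"
      by (subst hz) (simp add: inner_add_right inner_diff_right)
    then show ?thesis using e by (simp add: orthonormal_family_def)
  qed
  moreover have "e k = grad z /\<^sub>R norm (grad z)" by (simp add: e_def \<nu>[OF zU])
  ultimately show thesis using that ldf C2 e h by blast
qed

theorem theorem5p1:
  fixes \<Omega> :: "(real^'n) set" and lam Lam R :: real and x z :: "real^'n"
    and \<kappa> :: "nat \<Rightarrow> real" and um up :: "real \<Rightarrow> real^'n \<Rightarrow> real"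
  defines "N \<equiv> CARD('n)"
  defines "Pi0 \<equiv> (\<Prod>j\<in>{1..N - 1}. 1 - R * \<kappa> j)"
  assumes "N \<ge> 2" and "0 < lam" and "lam \<le> Lam"
    and "C2_domain \<Omega>"
    and "x \<in> \<Omega>" and "R > 0" and "z \<in> frontier \<Omega>"
    and "ball x R \<subseteq> \<Omega>" and "cball x R \<inter> (UNIV - \<Omega>) = {z}"
    and "principal_curvatures \<Omega> z \<kappa>"
    and "\<And>j. j \<in> {1..N - 1} \<Longrightarrow> \<kappa> j < 1 / R"
    and "\<And>\<epsilon>. \<epsilon> > 0 \<Longrightarrow> dirichlet_solution (pucci_minus lam Lam) \<epsilon> \<Omega> (um \<epsilon>)"
    and "\<And>\<epsilon>. \<epsilon> > 0 \<Longrightarrow> dirichlet_solution (pucci_plus lam Lam) \<epsilon> \<Omega> (up \<epsilon>)"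
  shows "(\<forall>q::real. q > 1 \<longrightarrow>
           ((\<lambda>\<epsilon>. (R / \<epsilon>) powr ((real N + 1) / (2 * (q - 1))) * q_mean (ereal q) (ball x R) (um \<epsilon>))
              \<longlongrightarrow> q_mean_const N q *
                  (Pi0 / lam powr ((real N + 1) / 2)) powr (- (1 / (2 * (q - 1))))) (at_right 0) \<and>
           ((\<lambda>\<epsilon>. (R / \<epsilon>) powr ((real N + 1) / (2 * (q - 1))) * q_mean (ereal q) (ball x R) (up \<epsilon>))
              \<longlongrightarrow> q_mean_const N q *
                  (Pi0 / Lam powr ((real N + 1) / 2)) powr (- (1 / (2 * (q - 1))))) (at_right 0)) \<and>
         ((\<lambda>\<epsilon>. q_mean \<infinity> (ball x R) (um \<epsilon>)) \<longlongrightarrow> 1 / 2) (at_right 0) \<and>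
         ((\<lambda>\<epsilon>. q_mean \<infinity> (ball x R) (up \<epsilon>)) \<longlongrightarrow> 1 / 2) (at_right 0)"
proof -
  obtain U \<psi> grad hess e k h where
    ldf: "local_defining_function \<Omega> z U \<psi> grad" and C2: "C2_with U \<psi> grad hess"
    and e: "orthonormal_family e" "e k = grad z /\<^sub>R norm (grad z)"
    and h: "bij_betw h (-{k}) {1..CARD('n) - 1}"
    and w: "\<And>i j. i \<noteq> k \<Longrightarrow> j \<noteq> k \<Longrightarrow> e j \<bullet> (hess z *v e i) = (if i = j then - (norm (grad z) * \<kappa> (h i)) else 0)"
    using principal_curvatures_hessian[OF \<open>principal_curvatures \<Omega> z \<kappa>\<close>] by blast
  have op: "open \<Omega>" using \<open>C2_domain \<Omega>\<close> by (simp add: C2_domain_def)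
  have hr: "h i \<in> {1..N - 1}" if "i \<noteq> k" for i
    unfolding N_def using bij_betwE[OF h] that by blast
  interpret touching_ball \<Omega> U x z R \<psi> grad hess e k "\<kappa> \<circ> h"
    by unfold_locales (use assms op ldf C2 e w hr in \<open>auto simp: local_defining_function_def\<close>)
  have Pi0: "curvature_product = Pi0"
    unfolding curvature_product_def Pi0_def N_def o_apply by (rule prod.reindex_bij_betw[OF h])
  have Lam: "0 < Lam" using assms by linarith
  \<comment> \<open>In \<open>pucci_minus\<close> the positive eigenvalues carry \<open>lam\<close>,
    so \<open>lam\<close> takes the place of \<open>tp\<close>; for \<open>pucci_plus\<close> the
    two constants change places.\<close>
  interpret m: touching_ball_solutions \<Omega> U x z R \<psi> grad hess e k "\<kappa> \<circ> h" lam Lam um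
    by unfold_locales (use assms op Lam in \<open>auto simp: pucci_minus_eq\<close>)
  interpret p: touching_ball_solutions \<Omega> U x z R \<psi> grad hess e k "\<kappa> \<circ> h" Lam lam up
    by unfold_locales (use assms op Lam in \<open>auto simp: pucci_plus_eq\<close>)
  show ?thesis
    using m.scaled_q_mean_limit p.scaled_q_mean_limit m.q_mean_infinity_limit p.q_mean_infinity_limit
    unfolding Pi0 N_def by blast
qed

end
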